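(* Let $A=kQ/I$ be a gentle algebra with marked ribbon surface $(\mathcal S_A,\mathcal M_A,\Gamma_A)$. (String case) Let $M=M(c)$ be a string module corresponding to a non-trivial permissible curve $c$ consecutively crossing arcs $\gamma_1,\dots,\gamma_{r-1}$. Let $\mathfrak I$ be the set of all $i$ with $1\le i\le r-1$ such that one of the following holds: ($2\le i\le r-2$) $p(\gamma_{i-1},\gamma_i,c)$ is on the right of $c$ and $p(\gamma_i,\gamma_{i+1},c)$ is on the left of $c$; ($i=1$, $r\ge 3$) $p(\gamma_1,\gamma_2,c)$ is on the left of $c$; ($i=r-1$, $r\ge3$) $p(\gamma_{r-2},\gamma_{r-1},c)$ is on the right of $c$; with $\mathfrak I=\{1\}$ if $r=2$. Then the projective cover of $M$ is $$P(M)\cong\bigoplus_{i\in\mathfrak I}M(c_{\mathrm{proj}}^{\gamma_i}).$$ (Band case) Let $M=M(c,\varphi)$ be a band module corresponding to a permissible closed curve $c$ consecutively (cyclically) crossing arcs $\gamma_1,\dots,\gamma_r=\gamma_0$ and a Jordan block $\varphi$ over a $k$-linear space $V$. Let $\mathfrak I$ be the set of all $i$ with $1\le i\le r$ such that $p(\gamma_{i-1},\gamma_i,c)$ is on the right of $c$ and $p(\gamma_i,\gamma_{i+1},c)$ is on the left of $c$ (indices modulo $r$). Then $$P(M)\cong\bigoplus_{i\in\mathfrak I}M(c_{\mathrm{proj}}^{\gamma_i})^{\oplus\dim_kV}.$$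
   Context: $k$ is an algebraically closed field. $Q$ is a finite quiver; $\alpha\beta$ denotes the path "first $\alpha$, then $\beta$". $A=kQ/I$ is gentle if: $I$ is an admissible ideal generated by paths of length $2$; every vertex is the source of at most two and the target of at most two arrows; for each arrow $\beta$ there is at most one arrow $\alpha$ with $t(\alpha)=s(\beta)$, $\alpha\beta\notin I$, at most one with $t(\alpha)=s(\beta)$, $\alpha\beta\in I$, at most one with $s(\alpha)=t(\beta)$, $\beta\alpha\notin I$, and at most one with $s(\alpha)=t(\beta)$, $\beta\alpha\in I$. Modules are finitely generated right $A$-modules. Marked ribbon surface: a triple $(\mathcal S,\mathcal M,\Gamma)$ where $\mathcal S$ is an oriented connected surface with non-empty boundary, $\mathcal M$ is a finite set of marked points on $\partial\mathcal S$, and $\Gamma$ is a set of curves (arcs) with endpoints in $\mathcal M$, pairwise not intersecting in the interior of $\mathcal S$, dividing $\mathcal S$ into elementary polygons, each having exactly one side not in $\Gamma$ (this side is a boundary segment between marked points or a whole boundary component without marked points). If an elementary polygon has exactly two sides, one in $\Gamma$ and the other a boundary segment between two marked points, one extra point is added on that boundary segment; $E$ is the set of extra points. The algebra of $(\mathcal S,\mathcal M,\Gamma)$ is $kQ_{\mathcal S}/I_{\mathcal S}$: vertices are the arcs; for every elementary polygon with sides $u,v\in\Gamma$ such that $v$ follows $u$ counterclockwise around a common vertex of the polygon there is an arrow $u\to v$; $I_{\mathcal S}$ is generated by all compositions of two arrows $u\to v\to w$ arising from the same elementary polygon. $(\mathcal S_A,\mathcal M_A,\Gamma_A)$ is the marked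 ribbon surface (unique up to homotopy) whose algebra is $A$; vertices of $Q$ are identified with arcs. Permissible curves: curves $c:(0,1)\to\mathcal S\setminus\partial\mathcal S$ with endpoints $c(0^+),c(1^-)\in\mathcal M\cup E$, with minimal number of crossings with $\Gamma$ up to homotopy, such that (a) the winding number of the end segments around any unmarked boundary component is $0$ or $1$ and (b) whenever $c$ consecutively crosses $u,v\in\Gamma$ (crosses $u$ and then $v$ with no crossing in between), $u,v$ have a common endpoint $p(u,v,c)\in\mathcal M$ such that the segment of $c$ between $u$ and $v$ together with $u,v$ locally bounds a triangle with vertex $p(u,v,c)$. A permissible closed curve is a closed curve in the interior of $\mathcal S$ satisfying (b). A permissible curve is non-trivial if it crosses at least one arc. "Left/right of $c$" refers to the orientation of $c$. Modules: for $c$ consecutively crossing $\gamma_1,\dots,\gamma_{r-1}$, consider the walk on the vertices $\gamma_1,\dots,\gamma_{r-1}$ in which $\gamma_{j-1},\gamma_j$ are joined by the arrow $\gamma_{j-1}\to\gamma_j$ if $p(\gamma_{j-1},\gamma_j,c)$ is on the left of $c$ (counterclockwise crossing), and by the inverse of the arrow $\gamma_j\to\gamma_{j-1}$ if it is on the right. $M(c)$ is the corresponding string module (one basis vector per position; arrows of the walk act as identity along it). For a permissible closed curve $c$ crossing $\Gamma_A$ at least twice, the same rule gives a band, and with an indecomposable automorphism (Jordan block) $\varphi$ of $V$, $M(c,\varphi)$ is the corresponding band module ($V$ at each position, all arrows of the walk acting by identity except one acting by $\varphi$). Projective permissible curve $c_{\mathrm{proj}}^{\gamma}$ of an arc $\gamma$: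 a permissible curve consecutively crossing arcs $\delta_1,\dots,\delta_{s-1}$ for which there is a unique $i$ with $\gamma=\delta_i$ such that, denoting by $m$ (respectively $m'$) the endpoint of $\delta_i$ on the right (respectively left) of the curve, $m=p(\delta_1,\delta_2,c)=\cdots=p(\delta_{i-1},\delta_i,c)$ and $m'=p(\delta_i,\delta_{i+1},c)=\cdots=p(\delta_{s-2},\delta_{s-1},c)$, and there is no arc $\delta$ such that $\delta,\delta_1,\dots,\delta_i$ have common endpoint $m$ and surround $m$ in clockwise order, and no arc $\delta'$ such that $\delta_i,\dots,\delta_{s-1},\delta'$ have common endpoint $m'$ and surround $m'$ in counterclockwise order. *)

theory Defs
  imports
    "HOL-Complex_Analysis.Complex_Analysis"
    "HOL-Algebra.QuotRing"
    "HOL-Algebra.Module"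
    "Graph_Theory.Arc_Walk"
begin

section \<open>Gentle algebras\<close>

text \<open>
  A quiver is a finite multi-digraph. A path is a pair of its start vertex and its list of arrows,
  in the order in which they are traversed; the lists \<open>[]\<close> give the trivial paths.
\<close>

type_synonym ('v, 'a) qpath = "'v \<times> 'a list"

definition qpaths :: "('v, 'a) pre_digraph \<Rightarrow> ('v, 'a) qpath set" where
  "qpaths Q = {(u, p). \<exists>v. pre_digraph.awalk Q u p v}"

definition path_algebra :: "('v, 'a) pre_digraph \<Rightarrow> (('v, 'a) qpath \<Rightarrow> 'k::field) ring" where
  "path_algebra Q = \<lparr>
     carrier = {f. finite {w. f w \<noteq> 0} \<and> {w. f w \<noteq> 0} \<subseteq> qpaths Q},
     mult = (\<lambda>f g (u, p). \<Sum>i\<le>length p.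
               f (u, take i p) * g (pre_digraph.awlast Q u (take i p), drop i p)),
     one = (\<lambda>(u, p). if u \<in> verts Q \<and> p = [] then 1 else 0),
     zero = (\<lambda>_. 0),
     add = (\<lambda>f g w. f w + g w)\<rparr>"

definition path_elt :: "('v, 'a) qpath \<Rightarrow> ('v, 'a) qpath \<Rightarrow> 'k::field" where
  "path_elt w = (\<lambda>x. if x = w then 1 else 0)"

text \<open>The \<open>m\<close>-th power of the arrow ideal: the span of the paths of length at least \<open>m\<close>.\<close>

definition arrow_ideal_power ::
  "('v, 'a) pre_digraph \<Rightarrow> nat \<Rightarrow> (('v, 'a) qpath \<Rightarrow> 'k::field) set" where
  "arrow_ideal_power Q m =
     {f \<in> carrier (path_algebra Q). \<forall>w. f w \<noteq> 0 \<longrightarrow> m \<le> length (snd w)}"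

definition admissible_ideal ::
  "('v, 'a) pre_digraph \<Rightarrow> (('v, 'a) qpath \<Rightarrow> 'k::field) set \<Rightarrow> bool" where
  "admissible_ideal Q I \<longleftrightarrow> ideal I (path_algebra Q) \<and> I \<subseteq> arrow_ideal_power Q 2 \<and>
     (\<exists>m\<ge>2. arrow_ideal_power Q m \<subseteq> I)"

definition gentle ::
  "('v, 'a) pre_digraph \<Rightarrow> (('v, 'a) qpath \<Rightarrow> 'k::field) set \<Rightarrow> bool" where
  "gentle Q I \<longleftrightarrow>
     fin_digraph Q \<and> admissible_ideal Q I \<and>
     (\<exists>R \<subseteq> {w \<in> qpaths Q. length (snd w) = 2}. I = Idl\<^bsub>path_algebra Q\<^esub> (path_elt ` R)) \<and>
     (\<forall>x \<in> verts Q. card {\<alpha> \<in> arcs Q. tail Q \<alpha> = x} \<le> 2 \<and> card {\<alpha> \<in> arcs Q. head Q \<alpha> = x} \<le> 2) \<and>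
     (\<forall>\<beta> \<in> arcs Q.
        card {\<alpha> \<in> arcs Q. head Q \<alpha> = tail Q \<beta> \<and> path_elt (tail Q \<alpha>, [\<alpha>, \<beta>]) \<notin> I} \<le> 1 \<and>
        card {\<alpha> \<in> arcs Q. head Q \<alpha> = tail Q \<beta> \<and> path_elt (tail Q \<alpha>, [\<alpha>, \<beta>]) \<in> I} \<le> 1 \<and>
        card {\<alpha> \<in> arcs Q. tail Q \<alpha> = head Q \<beta> \<and> path_elt (tail Q \<beta>, [\<beta>, \<alpha>]) \<notin> I} \<le> 1 \<and>
        card {\<alpha> \<in> arcs Q. tail Q \<alpha> = head Q \<beta> \<and> path_elt (tail Q \<beta>, [\<beta>, \<alpha>]) \<in> I} \<le> 1)"

definition bound_quiver_algebra ::
  "('v, 'a) pre_digraph \<Rightarrow> (('v, 'a) qpath \<Rightarrow> 'k::field) set \<Rightarrow> (('v, 'a) qpath \<Rightarrow> 'k) set ring" where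
  "bound_quiver_algebra Q I = path_algebra Q Quot I"


section \<open>Right modules and projective covers\<close>

text \<open>
  The module record is the one of HOL-Algebra, but \<open>a \<odot>\<^bsub>M\<^esub> x\<close> stands for the right action
  \<open>x a\<close>, and the ring need not be commutative.
  The fields \<open>mult\<close> and \<open>one\<close> of a module are irrelevant.
\<close>

definition right_module :: "'r ring \<Rightarrow> ('r, 'm) module \<Rightarrow> bool" where
  "right_module A M \<longleftrightarrow> ring A \<and> abelian_group M \<and>
     (\<forall>a \<in> carrier A. \<forall>x \<in> carrier M. a \<odot>\<^bsub>M\<^esub> x \<in> carrier M) \<and>
     (\<forall>a \<in> carrier A. \<forall>b \<in> carrier A. \<forall>x \<in> carrier M.
        (a \<oplus>\<^bsub>A\<^esub> b) \<odot>\<^bsub>M\<^esub> x = (a \<odot>\<^bsub>M\<^esub> x) \<oplus>\<^bsub>M\<^esub> (b \<odot>\<^bsub>M\<^esub> x)) \<and>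
     (\<forall>a \<in> carrier A. \<forall>x \<in> carrier M. \<forall>y \<in> carrier M.
        a \<odot>\<^bsub>M\<^esub> (x \<oplus>\<^bsub>M\<^esub> y) = (a \<odot>\<^bsub>M\<^esub> x) \<oplus>\<^bsub>M\<^esub> (a \<odot>\<^bsub>M\<^esub> y)) \<and>
     (\<forall>a \<in> carrier A. \<forall>b \<in> carrier A. \<forall>x \<in> carrier M.
        (a \<otimes>\<^bsub>A\<^esub> b) \<odot>\<^bsub>M\<^esub> x = b \<odot>\<^bsub>M\<^esub> (a \<odot>\<^bsub>M\<^esub> x)) \<and>
     (\<forall>x \<in> carrier M. \<one>\<^bsub>A\<^esub> \<odot>\<^bsub>M\<^esub> x = x)"

definition right_submodule :: "'r ring \<Rightarrow> 'm set \<Rightarrow> ('r, 'm) module \<Rightarrow> bool" where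
  "right_submodule A N M \<longleftrightarrow> N \<subseteq> carrier M \<and> \<zero>\<^bsub>M\<^esub> \<in> N \<and>
     (\<forall>x \<in> N. \<forall>y \<in> N. x \<oplus>\<^bsub>M\<^esub> y \<in> N) \<and> (\<forall>a \<in> carrier A. \<forall>x \<in> N. a \<odot>\<^bsub>M\<^esub> x \<in> N)"

definition right_hom ::
  "'r ring \<Rightarrow> ('r, 'm) module \<Rightarrow> ('r, 'n) module \<Rightarrow> ('m \<Rightarrow> 'n) set" where
  "right_hom A M N = {f \<in> carrier M \<rightarrow> carrier N.
     (\<forall>x \<in> carrier M. \<forall>y \<in> carrier M. f (x \<oplus>\<^bsub>M\<^esub> y) = f x \<oplus>\<^bsub>N\<^esub> f y) \<and>
     (\<forall>a \<in> carrier A. \<forall>x \<in> carrier M. f (a \<odot>\<^bsub>M\<^esub> x) = a \<odot>\<^bsub>N\<^esub> f x)}"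

definition regular_module :: "'r ring \<Rightarrow> ('r, 'r) module" where
  "regular_module A = \<lparr>carrier = carrier A, mult = mult A, one = one A, zero = zero A,
     add = add A, smult = (\<lambda>a x. x \<otimes>\<^bsub>A\<^esub> a)\<rparr>"

text \<open>Used only for finite index sets, where it is the direct sum.\<close>

definition direct_sum :: "'i set \<Rightarrow> ('i \<Rightarrow> ('r, 'm) module) \<Rightarrow> ('r, 'i \<Rightarrow> 'm) module" where
  "direct_sum J M = \<lparr>carrier = (\<Pi>\<^sub>E i\<in>J. carrier (M i)), mult = undefined, one = undefined,
     zero = (\<lambda>i\<in>J. \<zero>\<^bsub>M i\<^esub>),
     add = (\<lambda>x y. \<lambda>i\<in>J. x i \<oplus>\<^bsub>M i\<^esub> y i),
     smult = (\<lambda>a x. \<lambda>i\<in>J. a \<odot>\<^bsub>M i\<^esub> x i)\<rparr>"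

text \<open>Finitely generated projective: a direct summand (retract) of some \<open>A\<^sup>n\<close>.\<close>

definition fg_projective :: "'r ring \<Rightarrow> ('r, 'm) module \<Rightarrow> bool" where
  "fg_projective A P \<longleftrightarrow> right_module A P \<and>
     (\<exists>n. let F = direct_sum {..<n::nat} (\<lambda>_. regular_module A) in
        \<exists>f \<in> right_hom A P F. \<exists>g \<in> right_hom A F P. \<forall>x \<in> carrier P. g (f x) = x)"

definition superfluous :: "'r ring \<Rightarrow> 'm set \<Rightarrow> ('r, 'm) module \<Rightarrow> bool" where
  "superfluous A K P \<longleftrightarrow> right_submodule A K P \<and>
     (\<forall>N. right_submodule A N P \<and> (\<forall>x \<in> carrier P. \<exists>y \<in> N. \<exists>z \<in> K. x = y \<oplus>\<^bsub>P\<^esub> z)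
        \<longrightarrow> N = carrier P)"

definition projective_cover ::
  "'r ring \<Rightarrow> ('r, 'p) module \<Rightarrow> ('p \<Rightarrow> 'm) \<Rightarrow> ('r, 'm) module \<Rightarrow> bool" where
  "projective_cover A P \<pi> M \<longleftrightarrow> right_module A M \<and> fg_projective A P \<and>
     \<pi> \<in> right_hom A P M \<and> \<pi> ` carrier P = carrier M \<and>
     superfluous A {x \<in> carrier P. \<pi> x = \<zero>\<^bsub>M\<^esub>} P"


section \<open>Modules of walks\<close>

text \<open>
  A walk has positions \<open>0, \<dots>, n-1\<close>, labelled by vertices, and letters indexed by \<open>L\<close>; letter \<open>l\<close>
  joins the positions \<open>l\<close> and \<open>(l + 1) mod n\<close> by the arrow \<open>ar l\<close>, which points from \<open>l\<close> to
  \<open>(l + 1) mod n\<close> if \<open>dir l\<close> holds and backwards otherwise. There is a copy of one vector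
  space at each position, and the arrow of letter \<open>l\<close> acts along the letter by \<open>F l\<close>.
  For \<open>L = {..<n-1}\<close>, the vector space \<open>k\<close> and \<open>F l = id\<close> this is a string module, for
  \<open>L = {..<n}\<close> and all but one of the \<open>F l\<close> equal to \<open>id\<close> a band module.
\<close>

definition walk_arrow ::
  "nat \<Rightarrow> nat set \<Rightarrow> (nat \<Rightarrow> 'a) \<Rightarrow> (nat \<Rightarrow> bool) \<Rightarrow> (nat \<Rightarrow> 'w \<Rightarrow> 'w) \<Rightarrow> 'a
     \<Rightarrow> (nat \<Rightarrow> 'w) \<Rightarrow> nat \<Rightarrow> 'w::ab_group_add" where
  "walk_arrow n L ar dir F \<alpha> x = (\<lambda>j.
     (\<Sum>l \<in> {l \<in> L. ar l = \<alpha> \<and> dir l \<and> j = Suc l mod n}. F l (x l)) +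
     (\<Sum>l \<in> {l \<in> L. ar l = \<alpha> \<and> \<not> dir l \<and> j = l}. F l (x (Suc l mod n))))"

definition walk_path ::
  "nat \<Rightarrow> (nat \<Rightarrow> 'v) \<Rightarrow> nat set \<Rightarrow> (nat \<Rightarrow> 'a) \<Rightarrow> (nat \<Rightarrow> bool) \<Rightarrow> (nat \<Rightarrow> 'w \<Rightarrow> 'w) \<Rightarrow> ('v, 'a) qpath
     \<Rightarrow> (nat \<Rightarrow> 'w) \<Rightarrow> nat \<Rightarrow> 'w::ab_group_add" where
  "walk_path n lab L ar dir F w x =
     fold (walk_arrow n L ar dir F) (snd w) (\<lambda>j. if j < n \<and> lab j = fst w then x j else 0)"

text \<open>The elements of \<open>k Q / I\<close> are cosets; they act through any of their representatives.\<close>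

definition walk_module ::
  "('k \<Rightarrow> 'w \<Rightarrow> 'w) \<Rightarrow> nat \<Rightarrow> (nat \<Rightarrow> 'v) \<Rightarrow> nat set \<Rightarrow> (nat \<Rightarrow> 'a) \<Rightarrow> (nat \<Rightarrow> bool) \<Rightarrow>
    (nat \<Rightarrow> 'w \<Rightarrow> 'w) \<Rightarrow> ((('v, 'a) qpath \<Rightarrow> 'k::field) set, nat \<Rightarrow> 'w::ab_group_add) module" where
  "walk_module sc n lab L ar dir F = \<lparr>
     carrier = {x. \<forall>j\<ge>n. x j = 0}, mult = undefined, one = undefined,
     zero = (\<lambda>_. 0), add = (\<lambda>x y j. x j + y j),
     smult = (\<lambda>X x j. let f = (SOME f. f \<in> X) in
       \<Sum>w | f w \<noteq> 0. sc (f w) (walk_path n lab L ar dir F w x j))\<rparr>"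


section \<open>Marked ribbon surfaces\<close>

text \<open>
  The surface is a subset of a Hausdorff space, with an atlas of charts into the closed upper
  half-plane; the orientation is the one for which all charts preserve orientation.
  Besides the triple of surface, marked points and arcs \<open>\<Gamma>\<close> (a family \<open>gamma\<close> indexed by
  \<open>arc_set\<close>), the record names the elementary polygons and parametrises each of
  them by a model polygon in the complex plane.
\<close>

record ('s, 'v, 'p) ribbon_surface =
  surf :: "'s set"
  atlas :: "('s set \<times> ('s \<Rightarrow> complex)) set"
  marked :: "'s set"
  arc_set :: "'v set"
  gamma :: "'v \<Rightarrow> real \<Rightarrow> 's"
  polygons :: "'p set"
  nsides :: "'p \<Rightarrow> nat"          \<comment> \<open>number of sides in \<open>\<Gamma>\<close>\<close>
  holed :: "'p \<Rightarrow> bool"          \<comment> \<open>the remaining side is a boundary component without marked points\<close>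
  cell :: "'p \<Rightarrow> complex \<Rightarrow> 's"   \<comment> \<open>parametrisation by the model polygon\<close>
  side_arc :: "'p \<Rightarrow> nat \<Rightarrow> 'v"   \<comment> \<open>the arc that is the given side\<close>
  side_fwd :: "'p \<Rightarrow> nat \<Rightarrow> bool" \<comment> \<open>that arc runs counterclockwise along the polygon\<close>

definition half_plane :: "complex set" where
  "half_plane = {z. 0 \<le> Im z}"

text \<open>\<open>f\<close>, continuous and injective near \<open>z\<close>, has local degree \<open>1\<close> at \<open>z\<close>.\<close>

definition orientation_preserving_at :: "(complex \<Rightarrow> complex) \<Rightarrow> complex \<Rightarrow> bool" where
  "orientation_preserving_at f z \<longleftrightarrow>
     (\<exists>e>0. \<forall>d. 0 < d \<and> d < e \<longrightarrow> winding_number (f \<circ> circlepath z d) (f z) = 1)"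

definition surf_boundary :: "('s::t2_space, 'v, 'p) ribbon_surface \<Rightarrow> 's set" where
  "surf_boundary S = {x \<in> surf S. \<exists>(U, \<phi>) \<in> atlas S. x \<in> U \<and> Im (\<phi> x) = 0}"

definition oriented_surface :: "('s::t2_space, 'v, 'p) ribbon_surface \<Rightarrow> bool" where
  "oriented_surface S \<longleftrightarrow>
     (\<Union>(U, \<phi>) \<in> atlas S. U) = surf S \<and>
     (\<forall>(U, \<phi>) \<in> atlas S.
        openin (top_of_set (surf S)) U \<and>
        openin (top_of_set half_plane) (\<phi> ` U) \<and>
        (\<exists>\<psi>. homeomorphism U (\<phi> ` U) \<phi> \<psi>)) \<and>
     (\<forall>(U, \<phi>) \<in> atlas S. \<forall>(W, \<psi>) \<in> atlas S. \<forall>x \<in> U \<inter> W. 0 < Im (\<phi> x) \<longrightarrow>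
        orientation_preserving_at (\<psi> \<circ> inv_into U \<phi>) (\<phi> x))"

definition arcs_union :: "('s, 'v, 'p) ribbon_surface \<Rightarrow> 's set" where
  "arcs_union S = (\<Union>v \<in> arc_set S. gamma S v ` {0..1})"

text \<open>
  The model of a polygon is the closed unit disk or, if its side not in \<open>\<Gamma>\<close> is a boundary
  component, the annulus between radius \<open>1/2\<close> and \<open>1\<close>. The unit circle is divided into
  equal parts by the vertices; part \<open>i\<close> runs counterclockwise from vertex \<open>i\<close> to vertex \<open>i + 1\<close>.
  The parts \<open>0, \<dots>, nsides - 1\<close> are the sides in \<open>\<Gamma>\<close>; for the disk there is one more part,
  the side which is a boundary segment.
\<close>

definition parts :: "('s, 'v, 'p) ribbon_surface \<Rightarrow> 'p \<Rightarrow> nat" where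
  "parts S P = (if holed S P then nsides S P else Suc (nsides S P))"

definition model :: "('s, 'v, 'p) ribbon_surface \<Rightarrow> 'p \<Rightarrow> complex set" where
  "model S P = (if holed S P then {z. 1/2 \<le> cmod z \<and> cmod z \<le> 1} else cball 0 1)"

definition model_interior :: "('s, 'v, 'p) ribbon_surface \<Rightarrow> 'p \<Rightarrow> complex set" where
  "model_interior S P = (if holed S P then {z. 1/2 < cmod z \<and> cmod z < 1} else ball 0 1)"

definition rim :: "('s, 'v, 'p) ribbon_surface \<Rightarrow> 'p \<Rightarrow> real \<Rightarrow> complex" where
  "rim S P x = cis (2 * pi * x / real (parts S P))"

definition open_side :: "('s, 'v, 'p) ribbon_surface \<Rightarrow> 'p \<Rightarrow> nat \<Rightarrow> complex set" where
  "open_side S P i = rim S P ` {real i <..< real i + 1}"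

definition free_side :: "('s, 'v, 'p) ribbon_surface \<Rightarrow> 'p \<Rightarrow> complex set" where
  "free_side S P = (if holed S P then sphere 0 (1/2) else open_side S P (nsides S P))"

definition elementary_polygon :: "('s::t2_space, 'v, 'p) ribbon_surface \<Rightarrow> 'p \<Rightarrow> bool" where
  "elementary_polygon S P \<longleftrightarrow>
     0 < nsides S P \<and>
     continuous_on (model S P) (cell S P) \<and> cell S P ` model S P \<subseteq> surf S \<and>
     inj_on (cell S P) (model_interior S P \<union> free_side S P) \<and>
     (\<forall>(U, \<phi>) \<in> atlas S. \<forall>z \<in> model_interior S P. cell S P z \<in> U \<longrightarrow>
        orientation_preserving_at (\<phi> \<circ> cell S P) z) \<and>
     (\<forall>i < nsides S P. side_arc S P i \<in> arc_set S \<and>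
        (\<forall>x \<in> {0..1}. cell S P (rim S P (real i + x)) =
           gamma S (side_arc S P i) (if side_fwd S P i then x else 1 - x))) \<and>
     cell S P ` free_side S P \<subseteq> surf_boundary S - marked S \<and>
     (holed S P \<longrightarrow> cell S P ` free_side S P \<in> components (surf_boundary S))"

definition marked_ribbon_surface :: "('s::t2_space, 'v, 'p) ribbon_surface \<Rightarrow> bool" where
  "marked_ribbon_surface S \<longleftrightarrow>
     oriented_surface S \<and> compact (surf S) \<and> connected (surf S) \<and> surf_boundary S \<noteq> {} \<and>
     finite (marked S) \<and> marked S \<subseteq> surf_boundary S \<and>
     finite (arc_set S) \<and>
     (\<forall>v \<in> arc_set S. path (gamma S v) \<and>
        gamma S v 0 \<in> marked S \<and> gamma S v 1 \<in> marked S \<and>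
        gamma S v ` {0<..<1} \<subseteq> surf S - surf_boundary S) \<and>
     (\<forall>v \<in> arc_set S. \<forall>w \<in> arc_set S. \<forall>x \<in> {0<..<1}. \<forall>y \<in> {0<..<1}.
        gamma S v x = gamma S w y \<longrightarrow> v = w \<and> x = y) \<and>
     finite (polygons S) \<and> (\<forall>P \<in> polygons S. elementary_polygon S P) \<and>
     bij_betw (\<lambda>P. cell S P ` model_interior S P) (polygons S)
       (components (surf S - surf_boundary S - arcs_union S)) \<and>
     \<comment> \<open>an arc has a polygon on its left and one on its right (possibly the same)\<close>
     (\<forall>v \<in> arc_set S. \<forall>b. \<exists>!(P, i).
        P \<in> polygons S \<and> i < nsides S P \<and> side_arc S P i = v \<and> side_fwd S P i = b)"

text \<open>One extra point on the boundary segment of each polygon with two sides.\<close>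

definition extra_points :: "('s, 'v, 'p) ribbon_surface \<Rightarrow> 's set" where
  "extra_points S = {cell S P (rim S P (3/2)) |P. P \<in> polygons S \<and> \<not> holed S P \<and> nsides S P = 1}"

text \<open>
  The corner \<open>(P, a)\<close> of the polygon \<open>P\<close> is the vertex between its sides \<open>a\<close> and
  \<open>next_side S P a\<close>. Seen from this vertex, with the sides numbered counterclockwise along the
  polygon, side \<open>a\<close> follows side \<open>next_side S P a\<close> in the counterclockwise order around the vertex.
\<close>

definition next_side :: "('s, 'v, 'p) ribbon_surface \<Rightarrow> 'p \<Rightarrow> nat \<Rightarrow> nat" where
  "next_side S P a = Suc a mod nsides S P"

definition corners :: "('s, 'v, 'p) ribbon_surface \<Rightarrow> ('p \<times> nat) set" where
  "corners S = {(P, a). P \<in> polygons S \<and> a < nsides S P \<and> (holed S P \<or> Suc a < nsides S P)}"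

definition corner_point :: "('s, 'v, 'p) ribbon_surface \<Rightarrow> 'p \<times> nat \<Rightarrow> 's" where
  "corner_point S = (\<lambda>(P, a). cell S P (rim S P (real a + 1)))"

definition surface_quiver :: "('s, 'v, 'p) ribbon_surface \<Rightarrow> ('v, 'p \<times> nat) pre_digraph" where
  "surface_quiver S = \<lparr>verts = arc_set S, arcs = corners S,
     tail = (\<lambda>(P, a). side_arc S P (next_side S P a)), head = (\<lambda>(P, a). side_arc S P a)\<rparr>"

text \<open>
  The composition of two corners of the same polygon at the two ends of a common side. (The two
  corners have to share the side itself, not only the arc: an arc may be two sides of \<open>P\<close>.)
\<close>

definition corner_relation ::
  "('s, 'v, 'p) ribbon_surface \<Rightarrow> 'p \<times> nat \<Rightarrow> 'p \<times> nat \<Rightarrow> bool" where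
  "corner_relation S = (\<lambda>(P, a) (P', b). P = P' \<and> a = next_side S P b)"

text \<open>
  \<open>k Q / I\<close> is the algebra of the surface; the vertices of \<open>Q\<close> are literally the arcs, and \<open>cor\<close>
  identifies the arrows of \<open>Q\<close> with those of the quiver of the surface.
\<close>

definition algebra_of_surface ::
  "('v, 'a) pre_digraph \<Rightarrow> (('v, 'a) qpath \<Rightarrow> 'k::field) set \<Rightarrow>
    ('s, 'v, 'p) ribbon_surface \<Rightarrow> ('a \<Rightarrow> 'p \<times> nat) \<Rightarrow> bool" where
  "algebra_of_surface Q I S cor \<longleftrightarrow>
     verts Q = verts (surface_quiver S) \<and>
     bij_betw cor (arcs Q) (arcs (surface_quiver S)) \<and>
     (\<forall>\<alpha> \<in> arcs Q. tail Q \<alpha> = tail (surface_quiver S) (cor \<alpha>) \<and>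
                    head Q \<alpha> = head (surface_quiver S) (cor \<alpha>)) \<and>
     I = Idl\<^bsub>path_algebra Q\<^esub> {path_elt (tail Q \<alpha>, [\<alpha>, \<beta>]) |\<alpha> \<beta>.
           \<alpha> \<in> arcs Q \<and> \<beta> \<in> arcs Q \<and> corner_relation S (cor \<alpha>) (cor \<beta>)}"


section \<open>Curves\<close>

text \<open>
  \<open>d\<close> is the stretch of \<open>c\<close> from time \<open>s\<close> to time \<open>t\<close>, which runs inside the polygon \<open>P\<close>,
  drawn in the model of \<open>P\<close>.
\<close>

definition lifts :: "('s::t2_space, 'v, 'p) ribbon_surface \<Rightarrow> (real \<Rightarrow> 's) \<Rightarrow> real \<Rightarrow> real \<Rightarrow> 'p \<Rightarrow>
    (real \<Rightarrow> complex) \<Rightarrow> bool" where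
  "lifts S c s t P d \<longleftrightarrow> P \<in> polygons S \<and> path d \<and> path_image d \<subseteq> model S P \<and>
     d ` {0<..<1} \<subseteq> model_interior S P \<and> (\<forall>x \<in> {0..1}. cell S P (d x) = c (linepath s t x))"

text \<open>At time \<open>t\<close> the curve leaves a polygon through its side \<open>o1\<close> and enters one through \<open>o2\<close>.\<close>

definition crosses_at :: "('s::t2_space, 'v, 'p) ribbon_surface \<Rightarrow> (real \<Rightarrow> 's) \<Rightarrow> real \<Rightarrow>
    ('p \<times> nat) \<times> ('p \<times> nat) \<Rightarrow> bool" where
  "crosses_at S c t = (\<lambda>(o1, o2). o1 \<noteq> o2 \<and>
     snd o1 < nsides S (fst o1) \<and> snd o2 < nsides S (fst o2) \<and>
     (\<exists>e>0. \<exists>d1 d2.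
        lifts S c (t - e) t (fst o1) d1 \<and> d1 1 \<in> open_side S (fst o1) (snd o1) \<and>
        lifts S c t (t + e) (fst o2) d2 \<and> d2 0 \<in> open_side S (fst o2) (snd o2)))"

text \<open>
  A turn \<open>(q, left)\<close> passes the corner \<open>q\<close>; the flag says whether the corner is on the left of
  the curve. The stretch of \<open>c\<close> and the two adjacent sides bound a triangle at the corner: in the
  model polygon the stretch is homotopic to the piece of the rim that runs along one side to
  the corner and from there along the other side. With the interior of a polygon on the left
  of its counterclockwise rim, going from side \<open>a\<close> to the next side keeps the corner on the right.
\<close>

definition turns :: "('s::t2_space, 'v, 'p) ribbon_surface \<Rightarrow> (real \<Rightarrow> 's) \<Rightarrow> real \<Rightarrow> real \<Rightarrow>
    ('p \<times> nat) \<times> bool \<Rightarrow> bool" where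
  "turns S c s t = (\<lambda>((P, a), left). (P, a) \<in> corners S \<and>
     (\<exists>d. \<exists>x \<in> {0<..<1}. \<exists>y \<in> {0<..<1}. lifts S c s t P d \<and>
        homotopic_paths (model S P) d
          (rim S P \<circ> (if left then linepath (real a + 1 + y) (real a + x)
                              else linepath (real a + x) (real a + 1 + y)))))"

definition entered_side :: "('s, 'v, 'p) ribbon_surface \<Rightarrow> ('p \<times> nat) \<times> bool \<Rightarrow> 'p \<times> nat" where
  "entered_side S = (\<lambda>((P, a), left). (P, if left then next_side S P a else a))"

definition exited_side :: "('s, 'v, 'p) ribbon_surface \<Rightarrow> ('p \<times> nat) \<times> bool \<Rightarrow> 'p \<times> nat" where
  "exited_side S = (\<lambda>((P, a), left). (P, if left then a else next_side S P a))"

definition crossing_times :: "('s::t2_space, 'v, 'p) ribbon_surface \<Rightarrow> (real \<Rightarrow> 's) \<Rightarrow> real set" where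
  "crossing_times S c = {t \<in> {0<..<1}. c t \<in> arcs_union S}"

text \<open>
  The crossings of \<open>c\<close> with \<open>\<Gamma>\<close> in their order along \<open>c\<close>, and the turns between any two consecutive
  crossings. All crossings are transversal, and consecutively crossed arcs
  bound a triangle with the stretch of \<open>c\<close> between them.
\<close>

definition itinerary :: "('s::t2_space, 'v, 'p) ribbon_surface \<Rightarrow> (real \<Rightarrow> 's) \<Rightarrow>
    (('p \<times> nat) \<times> ('p \<times> nat)) list \<Rightarrow> (('p \<times> nat) \<times> bool) list \<Rightarrow> bool" where
  "itinerary S c xs ws \<longleftrightarrow>
     finite (crossing_times S c) \<and>
     (let ts = sorted_list_of_set (crossing_times S c) in
        length xs = length ts \<and> length ws = length ts - 1 \<and>
        (\<forall>j < length xs. crosses_at S c (ts ! j) (xs ! j)) \<and>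
        (\<forall>j < length ws. turns S c (ts ! j) (ts ! Suc j) (ws ! j) \<and>
           entered_side S (ws ! j) = snd (xs ! j) \<and> exited_side S (ws ! j) = fst (xs ! Suc j)))"

definition surface_curve :: "('s::t2_space, 'v, 'p) ribbon_surface \<Rightarrow> (real \<Rightarrow> 's) \<Rightarrow> bool" where
  "surface_curve S c \<longleftrightarrow> path c \<and>
     c 0 \<in> marked S \<union> extra_points S \<and> c 1 \<in> marked S \<union> extra_points S \<and>
     c ` {0<..<1} \<subseteq> surf S - surf_boundary S"

definition minimal_crossings :: "('s::t2_space, 'v, 'p) ribbon_surface \<Rightarrow> (real \<Rightarrow> 's) \<Rightarrow> bool" where
  "minimal_crossings S c \<longleftrightarrow> finite (crossing_times S c) \<and>
     (\<forall>c'. surface_curve S c' \<and> homotopic_paths (surf S) c c' \<and> finite (crossing_times S c')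
        \<longrightarrow> card (crossing_times S c) \<le> card (crossing_times S c'))"

text \<open>
  The real part of the winding number of a path which need not be closed is its total change of
  angle in turns; the number of complete turns around the unmarked boundary component is at most one.
\<close>

definition end_winding_ok ::
  "('s::t2_space, 'v, 'p) ribbon_surface \<Rightarrow> (real \<Rightarrow> 's) \<Rightarrow> real \<Rightarrow> real \<Rightarrow> bool" where
  "end_winding_ok S c s t \<longleftrightarrow> (\<forall>P d. holed S P \<and> lifts S c s t P d \<longrightarrow>
     \<lfloor>\<bar>Re (winding_number d 0)\<bar>\<rfloor> \<in> {0, 1})"

definition permissible_curve :: "('s::t2_space, 'v, 'p) ribbon_surface \<Rightarrow> (real \<Rightarrow> 's) \<Rightarrow> bool" where
  "permissible_curve S c \<longleftrightarrow> surface_curve S c \<and> minimal_crossings S c \<and>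
     (let ts = sorted_list_of_set (crossing_times S c) @ [1] in
        end_winding_ok S c 0 (hd ts)) \<and>
     (let ts = 0 # sorted_list_of_set (crossing_times S c) in
        end_winding_ok S c (last ts) 1) \<and>
     (\<exists>xs ws. itinerary S c xs ws)"

definition nontrivial_curve :: "('s::t2_space, 'v, 'p) ribbon_surface \<Rightarrow> (real \<Rightarrow> 's) \<Rightarrow> bool" where
  "nontrivial_curve S c \<longleftrightarrow> crossing_times S c \<noteq> {}"

text \<open>
  A closed curve is a 1-periodic function on the real line. Its crossings are listed for one period;
  the last turn leads from the last crossing to the first crossing of the next period.
\<close>

definition closed_crossing_times ::
  "('s::t2_space, 'v, 'p) ribbon_surface \<Rightarrow> (real \<Rightarrow> 's) \<Rightarrow> real set" where
  "closed_crossing_times S c = {t \<in> {0..<1}. c t \<in> arcs_union S}"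

definition closed_itinerary :: "('s::t2_space, 'v, 'p) ribbon_surface \<Rightarrow> (real \<Rightarrow> 's) \<Rightarrow>
    (('p \<times> nat) \<times> ('p \<times> nat)) list \<Rightarrow> (('p \<times> nat) \<times> bool) list \<Rightarrow> bool" where
  "closed_itinerary S c xs ws \<longleftrightarrow>
     finite (closed_crossing_times S c) \<and>
     (let ts = sorted_list_of_set (closed_crossing_times S c); r = length ts in
        length xs = r \<and> length ws = r \<and>
        (\<forall>j < r. crosses_at S c (ts ! j) (xs ! j)) \<and>
        (\<forall>j < r. turns S c (ts ! j) (if Suc j < r then ts ! Suc j else ts ! 0 + 1) (ws ! j) \<and>
           entered_side S (ws ! j) = snd (xs ! j) \<and>
           exited_side S (ws ! j) = fst (xs ! (Suc j mod r))))"

definition permissible_closed_curve ::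
  "('s::t2_space, 'v, 'p) ribbon_surface \<Rightarrow> (real \<Rightarrow> 's) \<Rightarrow> bool" where
  "permissible_closed_curve S c \<longleftrightarrow> continuous_on UNIV c \<and> (\<forall>t. c (t + 1) = c t) \<and>
     range c \<subseteq> surf S - surf_boundary S \<and> (\<exists>xs ws. closed_itinerary S c xs ws)"

text \<open>
  The itineraries of a curve are unique. All positions are counted from \<open>0\<close>:
  \<open>crossed_arc S xs j\<close> is the \<open>(j+1)\<close>-st crossed arc, and \<open>ws ! j\<close> is the turn from the \<open>(j+1)\<close>-st to
  the \<open>(j+2)\<close>-nd crossing.
\<close>

definition the_itinerary :: "('s::t2_space, 'v, 'p) ribbon_surface \<Rightarrow> (real \<Rightarrow> 's) \<Rightarrow>
    (('p \<times> nat) \<times> ('p \<times> nat)) list \<times> (('p \<times> nat) \<times> bool) list" where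
  "the_itinerary S c = (SOME (xs, ws). itinerary S c xs ws)"

definition the_closed_itinerary :: "('s::t2_space, 'v, 'p) ribbon_surface \<Rightarrow> (real \<Rightarrow> 's) \<Rightarrow>
    (('p \<times> nat) \<times> ('p \<times> nat)) list \<times> (('p \<times> nat) \<times> bool) list" where
  "the_closed_itinerary S c = (SOME (xs, ws). closed_itinerary S c xs ws)"

definition crossed_arc ::
  "('s, 'v, 'p) ribbon_surface \<Rightarrow> (('p \<times> nat) \<times> ('p \<times> nat)) list \<Rightarrow> nat \<Rightarrow> 'v" where
  "crossed_arc S xs j = (case fst (xs ! j) of (P, i) \<Rightarrow> side_arc S P i)"

definition on_left :: "(('p \<times> nat) \<times> bool) list \<Rightarrow> nat \<Rightarrow> bool" where
  "on_left ws j \<longleftrightarrow> snd (ws ! j)"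

definition on_right :: "(('p \<times> nat) \<times> bool) list \<Rightarrow> nat \<Rightarrow> bool" where
  "on_right ws j \<longleftrightarrow> \<not> snd (ws ! j)"

definition turn_point ::
  "('s, 'v, 'p) ribbon_surface \<Rightarrow> (('p \<times> nat) \<times> bool) list \<Rightarrow> nat \<Rightarrow> 's" where
  "turn_point S ws j = corner_point S (fst (ws ! j))"


section \<open>Modules of curves\<close>

definition curve_module :: "('v, 'a) pre_digraph \<Rightarrow> ('s::t2_space, 'v, 'p) ribbon_surface \<Rightarrow>
    ('a \<Rightarrow> 'p \<times> nat) \<Rightarrow> (real \<Rightarrow> 's) \<Rightarrow> ((('v, 'a) qpath \<Rightarrow> 'k::field) set, nat \<Rightarrow> 'k) module" where
  "curve_module Q S cor c = (let (xs, ws) = the_itinerary S c in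
     walk_module (*) (length xs) (crossed_arc S xs) {..<length ws}
       (\<lambda>l. inv_into (arcs Q) cor (fst (ws ! l))) (on_left ws) (\<lambda>_. id))"

text \<open>\<open>q\<close> is the letter on which \<open>\<phi>\<close> is placed.\<close>

definition closed_curve_module :: "('v, 'a) pre_digraph \<Rightarrow> ('s::t2_space, 'v, 'p) ribbon_surface \<Rightarrow>
    ('a \<Rightarrow> 'p \<times> nat) \<Rightarrow> ('k \<Rightarrow> 'w \<Rightarrow> 'w) \<Rightarrow> (real \<Rightarrow> 's) \<Rightarrow> ('w \<Rightarrow> 'w) \<Rightarrow> nat \<Rightarrow>
    ((('v, 'a) qpath \<Rightarrow> 'k::field) set, nat \<Rightarrow> 'w::ab_group_add) module" where
  "closed_curve_module Q S cor sc c \<phi> q = (let (xs, ws) = the_closed_itinerary S c in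
     walk_module sc (length xs) (crossed_arc S xs) {..<length ws}
       (\<lambda>l. inv_into (arcs Q) cor (fst (ws ! l))) (on_left ws) (\<lambda>l. if l = q then \<phi> else id))"

text \<open>
  \<open>\<phi>\<close> is an automorphism of the space \<open>'w\<close> (nonzero and finite-dimensional)
  whose matrix in some basis is a single Jordan block.
\<close>

definition jordan_block_on :: "('k::field \<Rightarrow> 'w \<Rightarrow> 'w) \<Rightarrow> ('w \<Rightarrow> 'w::ab_group_add) \<Rightarrow> bool" where
  "jordan_block_on sc \<phi> \<longleftrightarrow> vector_space sc \<and> Vector_Spaces.linear sc sc \<phi> \<and>
     (\<exists>\<mu> bs. \<mu> \<noteq> 0 \<and> bs \<noteq> [] \<and> distinct bs \<and>
        \<not> Modules.module.dependent sc (set bs) \<and> Modules.module.span sc (set bs) = UNIV \<and>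
        \<phi> (bs ! 0) = sc \<mu> (bs ! 0) \<and>
        (\<forall>i. Suc i < length bs \<longrightarrow> \<phi> (bs ! Suc i) = sc \<mu> (bs ! Suc i) + bs ! i))"


section \<open>Projective permissible curves\<close>

text \<open>
  A half-edge \<open>(v, b)\<close> is the end of the arc \<open>v\<close> at \<open>gamma S v 0\<close> (\<open>b = False\<close>) or at
  \<open>gamma S v 1\<close> (\<open>b = True\<close>). A side of a polygon, traversed counterclockwise along
  the polygon, leads from its first to its second half-edge.
\<close>

definition half_edge_point :: "('s, 'v, 'p) ribbon_surface \<Rightarrow> 'v \<times> bool \<Rightarrow> 's" where
  "half_edge_point S = (\<lambda>(v, b). gamma S v (if b then 1 else 0))"

definition first_half :: "('s, 'v, 'p) ribbon_surface \<Rightarrow> 'p \<times> nat \<Rightarrow> 'v \<times> bool" where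
  "first_half S = (\<lambda>(P, i). (side_arc S P i, \<not> side_fwd S P i))"

definition second_half :: "('s, 'v, 'p) ribbon_surface \<Rightarrow> 'p \<times> nat \<Rightarrow> 'v \<times> bool" where
  "second_half S = (\<lambda>(P, i). (side_arc S P i, side_fwd S P i))"

text \<open>
  \<open>(h, h') \<in> ccw S\<close>: the half-edges \<open>h\<close> and \<open>h'\<close> have the same marked point, and \<open>h'\<close> comes after \<open>h\<close>
  in the counterclockwise order around it. As marked points are on the boundary, this
  order is linear; immediate successors are separated by a corner of a polygon.
\<close>

definition ccw :: "('s, 'v, 'p) ribbon_surface \<Rightarrow> (('v \<times> bool) \<times> ('v \<times> bool)) set" where
  "ccw S = {(first_half S (P, next_side S P a), second_half S (P, a)) |P a. (P, a) \<in> corners S}\<^sup>+"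

definition surround_ccw :: "('s, 'v, 'p) ribbon_surface \<Rightarrow> ('v \<times> bool) list \<Rightarrow> bool" where
  "surround_ccw S = sorted_wrt (\<lambda>h h'. (h, h') \<in> ccw S)"

definition surround_cw :: "('s, 'v, 'p) ribbon_surface \<Rightarrow> ('v \<times> bool) list \<Rightarrow> bool" where
  "surround_cw S = sorted_wrt (\<lambda>h h'. (h', h) \<in> ccw S)"

text \<open>
  The curve leaves a polygon through the side \<open>fst (xs ! j)\<close>, which runs counterclockwise along that
  polygon, hence from the right of the curve to its left.
\<close>

definition right_half :: "('s, 'v, 'p) ribbon_surface \<Rightarrow> (('p \<times> nat) \<times> ('p \<times> nat)) list \<Rightarrow> nat \<Rightarrow> 'v \<times> bool" where
  "right_half S xs j = first_half S (fst (xs ! j))"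

definition left_half :: "('s, 'v, 'p) ribbon_surface \<Rightarrow> (('p \<times> nat) \<times> ('p \<times> nat)) list \<Rightarrow> nat \<Rightarrow> 'v \<times> bool" where
  "left_half S xs j = second_half S (fst (xs ! j))"

definition projective_curve ::
  "('s::t2_space, 'v, 'p) ribbon_surface \<Rightarrow> 'v \<Rightarrow> (real \<Rightarrow> 's) \<Rightarrow> bool" where
  "projective_curve S v c \<longleftrightarrow> permissible_curve S c \<and>
     (let (xs, ws) = the_itinerary S c; n = length xs in
      \<exists>!i. i < n \<and> crossed_arc S xs i = v \<and>
        (\<forall>j < i. on_right ws j \<and> turn_point S ws j = half_edge_point S (right_half S xs i)) \<and>
        (\<forall>j. i \<le> j \<and> Suc j < n \<longrightarrow>
           on_left ws j \<and> turn_point S ws j = half_edge_point S (left_half S xs i)) \<and>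
        \<not> (\<exists>h. fst h \<in> arc_set S \<and> surround_cw S (h # map (right_half S xs) [0..<Suc i])) \<and>
        \<not> (\<exists>h. fst h \<in> arc_set S \<and> surround_ccw S (map (left_half S xs) [i..<n] @ [h])))"

end

theory Submission
  imports Defs
begin

text \<open>
  A string or band module is generated by its tops, the positions without incoming arrow, which are
  the positions in \<open>J\<close>. The string of a projective curve of \<open>v\<close> has one top, labelled by \<open>v\<close>, with
  two directed branches. An arrow starting at the label of a position \<open>j\<close> starts at one of the two
  sides of the arc crossed there. Hence it either continues the string at \<open>j\<close>, or comes from the
  same polygon as the arrow ending at \<open>j\<close>, which is a relation, or it would extend a branch beyond its
  end, against the maximality of the curve. So the string module is isomorphic to \<open>e\<^sub>v A\<close>, with basis
  the paths from \<open>v\<close> outside \<open>I\<close>.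

  Sending the generators of these modules to basis vectors at the tops gives a surjection onto the
  module of the given curve. Since no arrow acts into a top, the top coordinates of an
  element of the kernel vanish; therefore the kernel is contained in the radical of the direct sum, and
  it is superfluous by Nakayama's lemma.
\<close>

section \<open>Right modules and projective covers\<close>

text \<open>Computations take place with representatives in the path algebra: a projective summand
  is compared with \<open>e\<^sub>v A\<close> by a map \<open>s\<close> into k Q whose coset is
  linear over A, and lying in the radical is read off from the coefficient of the trivial path.
  Module records carry no action of k, so scalars act through multiples of trivial paths. The
  filtration needed for Nakayama's lemma consists of the powers of the arrow ideal, one of which
  vanishes in A by admissibility.

  Both cases are one argument about walks with a vector space at each position. They differ in
  whether the letters close up to a cycle and in the vectors chosen at a top: the scalar 1 for a
  string, a basis of V for a band.

  The obstacle on the geometric side is that an arc may be two sides of the same polygon, so that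
  arcs alone do not tell whether two arrows compose to a relation. Each position is therefore
  described by the pair of sides met there: the one through which the curve leaves a polygon and the
  one through which it enters the next.\<close>

lemma right_moduleD:
  assumes "right_module A M"
  shows "ring A" "abelian_group M"
    "\<And>a x. \<lbrakk>a \<in> carrier A; x \<in> carrier M\<rbrakk> \<Longrightarrow> a \<odot>\<^bsub>M\<^esub> x \<in> carrier M"
    "\<And>a b x. \<lbrakk>a \<in> carrier A; b \<in> carrier A; x \<in> carrier M\<rbrakk> \<Longrightarrow>
        (a \<oplus>\<^bsub>A\<^esub> b) \<odot>\<^bsub>M\<^esub> x = (a \<odot>\<^bsub>M\<^esub> x) \<oplus>\<^bsub>M\<^esub> (b \<odot>\<^bsub>M\<^esub> x)"
    "\<And>a x y. \<lbrakk>a \<in> carrier A; x \<in> carrier M; y \<in> carrier M\<rbrakk> \<Longrightarrow>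
        a \<odot>\<^bsub>M\<^esub> (x \<oplus>\<^bsub>M\<^esub> y) = (a \<odot>\<^bsub>M\<^esub> x) \<oplus>\<^bsub>M\<^esub> (a \<odot>\<^bsub>M\<^esub> y)"
    "\<And>a b x. \<lbrakk>a \<in> carrier A; b \<in> carrier A; x \<in> carrier M\<rbrakk> \<Longrightarrow>
        (a \<otimes>\<^bsub>A\<^esub> b) \<odot>\<^bsub>M\<^esub> x = b \<odot>\<^bsub>M\<^esub> (a \<odot>\<^bsub>M\<^esub> x)"
    "\<And>x. x \<in> carrier M \<Longrightarrow> \<one>\<^bsub>A\<^esub> \<odot>\<^bsub>M\<^esub> x = x"
  using assms unfolding right_module_def by blast+

lemma right_module_smult_zero:
  assumes "right_module A M" "a \<in> carrier A"
  shows "a \<odot>\<^bsub>M\<^esub> \<zero>\<^bsub>M\<^esub> = \<zero>\<^bsub>M\<^esub>"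
proof -
  interpret M: abelian_group M using assms(1) by (rule right_moduleD)
  note [simp] = right_moduleD(3)[OF assms(1)]
  have "a \<odot>\<^bsub>M\<^esub> \<zero>\<^bsub>M\<^esub> \<oplus>\<^bsub>M\<^esub> a \<odot>\<^bsub>M\<^esub> \<zero>\<^bsub>M\<^esub> = a \<odot>\<^bsub>M\<^esub> \<zero>\<^bsub>M\<^esub>"
    using right_moduleD(5)[OF assms(1), of a "\<zero>\<^bsub>M\<^esub>" "\<zero>\<^bsub>M\<^esub>"] assms(2) by simp
  then show ?thesis using assms(2) by (metis M.add.r_cancel_one M.zero_closed right_moduleD(3)[OF assms(1)])
qed

lemma right_module_zero_smult:
  assumes "right_module A M" "x \<in> carrier M"
  shows "\<zero>\<^bsub>A\<^esub> \<odot>\<^bsub>M\<^esub> x = \<zero>\<^bsub>M\<^esub>"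
proof -
  interpret A: ring A using assms(1) by (rule right_moduleD)
  interpret M: abelian_group M using assms(1) by (rule right_moduleD)
  have "\<zero>\<^bsub>A\<^esub> \<odot>\<^bsub>M\<^esub> x \<oplus>\<^bsub>M\<^esub> \<zero>\<^bsub>A\<^esub> \<odot>\<^bsub>M\<^esub> x = \<zero>\<^bsub>A\<^esub> \<odot>\<^bsub>M\<^esub> x"
    using right_moduleD(4)[OF assms(1), of "\<zero>\<^bsub>A\<^esub>" "\<zero>\<^bsub>A\<^esub>" x] assms(2) by simp
  then show ?thesis
    using assms(2) by (metis M.add.r_cancel_one A.zero_closed right_moduleD(3)[OF assms(1)])
qed

lemma right_homD:
  assumes "f \<in> right_hom A M N"
  shows "\<And>x. x \<in> carrier M \<Longrightarrow> f x \<in> carrier N"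
    "\<And>x y. \<lbrakk>x \<in> carrier M; y \<in> carrier M\<rbrakk> \<Longrightarrow> f (x \<oplus>\<^bsub>M\<^esub> y) = f x \<oplus>\<^bsub>N\<^esub> f y"
    "\<And>a x. \<lbrakk>a \<in> carrier A; x \<in> carrier M\<rbrakk> \<Longrightarrow> f (a \<odot>\<^bsub>M\<^esub> x) = a \<odot>\<^bsub>N\<^esub> f x"
  using assms by (auto simp: right_hom_def)

lemma right_hom_zero:
  assumes "f \<in> right_hom A M N" "right_module A M" "right_module A N"
  shows "f \<zero>\<^bsub>M\<^esub> = \<zero>\<^bsub>N\<^esub>"
proof -
  interpret M: abelian_group M using assms(2) by (rule right_moduleD)
  interpret N: abelian_group N using assms(3) by (rule right_moduleD)
  have "f \<zero>\<^bsub>M\<^esub> \<oplus>\<^bsub>N\<^esub> f \<zero>\<^bsub>M\<^esub> = f \<zero>\<^bsub>M\<^esub>"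
    using right_homD(2)[OF assms(1), of "\<zero>\<^bsub>M\<^esub>" "\<zero>\<^bsub>M\<^esub>"] by simp
  then show ?thesis
    by (metis N.add.r_cancel_one M.zero_closed right_homD(1)[OF assms(1)])
qed

lemma right_submodule_image:
  assumes "f \<in> right_hom A M N" "right_module A M" "right_module A N"
  shows "right_submodule A (f ` carrier M) N"
proof -
  interpret M: abelian_group M using assms(2) by (rule right_moduleD)
  note f = right_homD[OF assms(1)]
  have "f x \<oplus>\<^bsub>N\<^esub> f y \<in> f ` carrier M" if "x \<in> carrier M" "y \<in> carrier M" for x y
    using that by (simp flip: f(2))
  moreover have "a \<odot>\<^bsub>N\<^esub> f x \<in> f ` carrier M" if "a \<in> carrier A" "x \<in> carrier M" for a x
    using that by (simp add: right_moduleD(3)[OF assms(2)] flip: f(3))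
  moreover have "\<zero>\<^bsub>N\<^esub> \<in> f ` carrier M"
    using right_hom_zero[OF assms] by (metis M.zero_closed imageI)
  ultimately show ?thesis
    unfolding right_submodule_def using f(1) by blast
qed

lemma right_submodule_kernel:
  assumes "f \<in> right_hom A M N" "right_module A M" "right_module A N"
  shows "right_submodule A {x \<in> carrier M. f x = \<zero>\<^bsub>N\<^esub>} M"
proof -
  interpret M: abelian_group M using assms(2) by (rule right_moduleD)
  interpret N: abelian_group N using assms(3) by (rule right_moduleD)
  show ?thesis
    unfolding right_submodule_def
    using right_homD[OF assms(1)] right_hom_zero[OF assms] right_moduleD(3)[OF assms(2)]
      right_module_smult_zero[OF assms(3)]
    by auto
qed

section \<open>Direct sums of right modules\<close>

lemma direct_sum_simps [simp]:
  "carrier (direct_sum J M) = (\<Pi>\<^sub>E i\<in>J. carrier (M i))"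
  "\<zero>\<^bsub>direct_sum J M\<^esub> = (\<lambda>i\<in>J. \<zero>\<^bsub>M i\<^esub>)"
  "x \<oplus>\<^bsub>direct_sum J M\<^esub> y = (\<lambda>i\<in>J. x i \<oplus>\<^bsub>M i\<^esub> y i)"
  "a \<odot>\<^bsub>direct_sum J M\<^esub> x = (\<lambda>i\<in>J. a \<odot>\<^bsub>M i\<^esub> x i)"
  by (simp_all add: direct_sum_def)

lemma right_module_direct_sum:
  assumes A: "ring A" and M: "\<And>i. i \<in> J \<Longrightarrow> right_module A (M i)"
  shows "right_module A (direct_sum J M)"
proof -
  note m = right_moduleD[OF M]
  have ag: "abelian_group (direct_sum J M)"
  proof (rule abelian_groupI)
    fix x y z assume xyz: "x \<in> carrier (direct_sum J M)" "y \<in> carrier (direct_sum J M)"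
      "z \<in> carrier (direct_sum J M)"
    show "x \<oplus>\<^bsub>direct_sum J M\<^esub> y \<oplus>\<^bsub>direct_sum J M\<^esub> z = x \<oplus>\<^bsub>direct_sum J M\<^esub> (y \<oplus>\<^bsub>direct_sum J M\<^esub> z)"
      using xyz abelian_monoid.a_assoc[OF abelian_group.axioms(1)[OF m(2)]]
      by (auto simp: PiE_iff intro!: ext)
  next
    fix x y assume xyz: "x \<in> carrier (direct_sum J M)" "y \<in> carrier (direct_sum J M)"
    show "x \<oplus>\<^bsub>direct_sum J M\<^esub> y \<in> carrier (direct_sum J M)"
      using xyz abelian_monoid.a_closed[OF abelian_group.axioms(1)[OF m(2)]] by (auto simp: PiE_iff)
    show "x \<oplus>\<^bsub>direct_sum J M\<^esub> y = y \<oplus>\<^bsub>direct_sum J M\<^esub> x"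
      using xyz abelian_monoid.a_comm[OF abelian_group.axioms(1)[OF m(2)]]
      by (auto simp: PiE_iff intro!: restrict_ext)
  next
    show "\<zero>\<^bsub>direct_sum J M\<^esub> \<in> carrier (direct_sum J M)"
      using abelian_monoid.zero_closed[OF abelian_group.axioms(1)[OF m(2)]] by auto
  next
    fix x assume x: "x \<in> carrier (direct_sum J M)"
    show "\<zero>\<^bsub>direct_sum J M\<^esub> \<oplus>\<^bsub>direct_sum J M\<^esub> x = x"
    proof
      fix i
      show "(\<zero>\<^bsub>direct_sum J M\<^esub> \<oplus>\<^bsub>direct_sum J M\<^esub> x) i = x i"
      proof (cases "i \<in> J")
        case True
        interpret abelian_group "M i" using m(2)[OF True] .
        show ?thesis using x True by (simp add: PiE_iff)
      qed (use x in auto)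
    qed
    have "\<exists>y\<in>carrier (M i). y \<oplus>\<^bsub>M i\<^esub> x i = \<zero>\<^bsub>M i\<^esub>" if i: "i \<in> J" for i
    proof -
      interpret abelian_group "M i" using m(2)[OF i] .
      show ?thesis using x i l_neg by (metis direct_sum_simps(1) PiE_mem a_inv_closed)
    qed
    then obtain y where "\<And>i. i \<in> J \<Longrightarrow> y i \<in> carrier (M i) \<and> y i \<oplus>\<^bsub>M i\<^esub> x i = \<zero>\<^bsub>M i\<^esub>" by metis
    then show "\<exists>y\<in>carrier (direct_sum J M). y \<oplus>\<^bsub>direct_sum J M\<^esub> x = \<zero>\<^bsub>direct_sum J M\<^esub>"
      by (intro bexI[of _ "restrict y J"]) (auto intro!: restrict_ext)
  qed
  have 1: "a \<odot>\<^bsub>direct_sum J M\<^esub> x \<in> carrier (direct_sum J M)"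
    if "a \<in> carrier A" "x \<in> carrier (direct_sum J M)" for a x
    using that m(3) by (auto simp: PiE_iff)
  have 2: "(a \<oplus>\<^bsub>A\<^esub> b) \<odot>\<^bsub>direct_sum J M\<^esub> x
      = (a \<odot>\<^bsub>direct_sum J M\<^esub> x) \<oplus>\<^bsub>direct_sum J M\<^esub> (b \<odot>\<^bsub>direct_sum J M\<^esub> x)"
    if "a \<in> carrier A" "b \<in> carrier A" "x \<in> carrier (direct_sum J M)" for a b x
    using that m(4) by (auto simp: PiE_iff intro!: restrict_ext)
  have 3: "a \<odot>\<^bsub>direct_sum J M\<^esub> (x \<oplus>\<^bsub>direct_sum J M\<^esub> y)
      = (a \<odot>\<^bsub>direct_sum J M\<^esub> x) \<oplus>\<^bsub>direct_sum J M\<^esub> (a \<odot>\<^bsub>direct_sum J M\<^esub> y)"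
    if "a \<in> carrier A" "x \<in> carrier (direct_sum J M)" "y \<in> carrier (direct_sum J M)" for a x y
    using that m(5) by (auto simp: PiE_iff intro!: restrict_ext)
  have 4: "(a \<otimes>\<^bsub>A\<^esub> b) \<odot>\<^bsub>direct_sum J M\<^esub> x = b \<odot>\<^bsub>direct_sum J M\<^esub> (a \<odot>\<^bsub>direct_sum J M\<^esub> x)"
    if "a \<in> carrier A" "b \<in> carrier A" "x \<in> carrier (direct_sum J M)" for a b x
    using that m(6) by (auto simp: PiE_iff intro!: restrict_ext)
  have 5: "\<one>\<^bsub>A\<^esub> \<odot>\<^bsub>direct_sum J M\<^esub> x = x" if "x \<in> carrier (direct_sum J M)" for x
    using that m(7) by (auto simp: PiE_iff extensional_def)
  show ?thesis unfolding right_module_def using A ag 1 2 3 4 5 by blast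
qed

lemma regular_module_simps [simp]:
  "carrier (regular_module A) = carrier A"
  "\<zero>\<^bsub>regular_module A\<^esub> = \<zero>\<^bsub>A\<^esub>"
  "x \<oplus>\<^bsub>regular_module A\<^esub> y = x \<oplus>\<^bsub>A\<^esub> y"
  "a \<odot>\<^bsub>regular_module A\<^esub> x = x \<otimes>\<^bsub>A\<^esub> a"
  by (simp_all add: regular_module_def)

definition inj_summand :: "'i set \<Rightarrow> ('i \<Rightarrow> ('r, 'm) module) \<Rightarrow> 'i \<Rightarrow> 'm \<Rightarrow> 'i \<Rightarrow> 'm" where
  "inj_summand J M i x = (\<lambda>j\<in>J. if j = i then x else \<zero>\<^bsub>M j\<^esub>)"

lemma inj_summand_closed:
  assumes "\<And>j. j \<in> J \<Longrightarrow> right_module A (M j)" "x \<in> carrier (M i)"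
  shows "inj_summand J M i x \<in> carrier (direct_sum J M)"
  using assms(2) abelian_monoid.zero_closed[OF abelian_group.axioms(1)[OF right_moduleD(2)[OF assms(1)]]]
  by (auto simp: inj_summand_def)

lemma inj_summand_smult:
  assumes "\<And>j. j \<in> J \<Longrightarrow> right_module A (M j)" "a \<in> carrier A"
  shows "a \<odot>\<^bsub>direct_sum J M\<^esub> inj_summand J M i x = inj_summand J M i (a \<odot>\<^bsub>M i\<^esub> x)"
  using assms right_module_smult_zero[OF assms(1)] by (auto simp: inj_summand_def intro!: restrict_ext)

text \<open>A point of a finite direct sum is the sum of its components; the induction adds them one
  at a time, with zero outside the set \<open>J'\<close> reached so far. This lets the superfluity
  argument treat each projective summand separately.\<close>

lemma direct_sum_in_submodule:
  assumes J: "finite J" and M: "\<And>j. j \<in> J \<Longrightarrow> right_module A (M j)"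
    and N: "right_submodule A N (direct_sum J M)"
    and x: "x \<in> carrier (direct_sum J M)" and sN: "\<And>i. i \<in> J \<Longrightarrow> inj_summand J M i (x i) \<in> N"
  shows "x \<in> N"
proof -
  have grp: "\<And>j. j \<in> J \<Longrightarrow> abelian_group (M j)" by (rule right_moduleD[OF M])
  have N_add: "\<And>y z. \<lbrakk>y \<in> N; z \<in> N\<rbrakk> \<Longrightarrow> y \<oplus>\<^bsub>direct_sum J M\<^esub> z \<in> N"
    using N unfolding right_submodule_def by blast
  have "(\<lambda>j\<in>J. if j \<in> J' then x j else \<zero>\<^bsub>M j\<^esub>) \<in> N" if "J' \<subseteq> J" for J'
    using finite_subset[OF that J] that
  proof (induction J' rule: finite_induct)
    case empty
    then show ?case using N by (simp add: right_submodule_def restrict_def cong: if_cong)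
  next
    case (insert i J')
    have "(\<lambda>j\<in>J. if j \<in> insert i J' then x j else \<zero>\<^bsub>M j\<^esub>)
      = inj_summand J M i (x i) \<oplus>\<^bsub>direct_sum J M\<^esub> (\<lambda>j\<in>J. if j \<in> J' then x j else \<zero>\<^bsub>M j\<^esub>)"
    proof (simp add: inj_summand_def, rule restrict_ext)
      fix j assume j: "j \<in> J"
      interpret abelian_group "M j" using grp[OF j] .
      have "x j \<in> carrier (M j)" using x j by auto
      then have "x j \<oplus>\<^bsub>M j\<^esub> \<zero>\<^bsub>M j\<^esub> = x j" "\<zero>\<^bsub>M j\<^esub> \<oplus>\<^bsub>M j\<^esub> x j = x j"
        "\<zero>\<^bsub>M j\<^esub> \<oplus>\<^bsub>M j\<^esub> \<zero>\<^bsub>M j\<^esub> = \<zero>\<^bsub>M j\<^esub>" by simp_all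
      then show "(if j = i \<or> j \<in> J' then x j else \<zero>\<^bsub>M j\<^esub>) =
        (if j \<in> J then if j = i then x i else \<zero>\<^bsub>M j\<^esub> else undefined) \<oplus>\<^bsub>M j\<^esub>
        (if j \<in> J then if j \<in> J' then x j else \<zero>\<^bsub>M j\<^esub> else undefined)"
        using j insert.hyps by auto
    qed
    moreover have "inj_summand J M i (x i) \<in> N" using insert.prems sN by simp
    moreover have "(\<lambda>j\<in>J. if j \<in> J' then x j else \<zero>\<^bsub>M j\<^esub>) \<in> N" using insert by blast
    ultimately show ?case by (simp only: N_add)
  qed
  from this[of J] have "(\<lambda>j\<in>J. if j \<in> J then x j else \<zero>\<^bsub>M j\<^esub>) \<in> N" by simp
  moreover have "(\<lambda>j\<in>J. if j \<in> J then x j else \<zero>\<^bsub>M j\<^esub>) = x"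
    using x by (auto simp: PiE_iff extensional_def)
  ultimately show ?thesis by simp
qed

lemma right_hom_finsum:
  assumes J: "finite J" and P: "\<And>i. i \<in> J \<Longrightarrow> right_module A (P i)" and M: "right_module A M"
    and h: "\<And>i. i \<in> J \<Longrightarrow> h i \<in> right_hom A (P i) M"
  shows "(\<lambda>x. finsum M (\<lambda>i. h i (x i)) J) \<in> right_hom A (direct_sum J P) M"
proof -
  interpret M: abelian_group M using M by (rule right_moduleD)
  note h' = right_homD[OF h]
  have cl: "(\<lambda>i. h i (x i)) \<in> J \<rightarrow> carrier M" if "x \<in> carrier (direct_sum J P)" for x
    using that h' by auto
  have "finsum M (\<lambda>i. h i ((x \<oplus>\<^bsub>direct_sum J P\<^esub> y) i)) J
      = finsum M (\<lambda>i. h i (x i)) J \<oplus>\<^bsub>M\<^esub> finsum M (\<lambda>i. h i (y i)) J"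
    if "x \<in> carrier (direct_sum J P)" "y \<in> carrier (direct_sum J P)" for x y
  proof -
    have "finsum M (\<lambda>i. h i ((x \<oplus>\<^bsub>direct_sum J P\<^esub> y) i)) J
        = finsum M (\<lambda>i. h i (x i) \<oplus>\<^bsub>M\<^esub> h i (y i)) J"
      using that h' cl by (intro M.finsum_cong') (auto simp: PiE_iff)
    then show ?thesis using M.finsum_addf[OF cl cl] that by simp
  qed
  moreover have "finsum M (\<lambda>i. h i ((a \<odot>\<^bsub>direct_sum J P\<^esub> x) i)) J = a \<odot>\<^bsub>M\<^esub> finsum M (\<lambda>i. h i (x i)) J"
    if a: "a \<in> carrier A" and x: "x \<in> carrier (direct_sum J P)" for a x
  proof -
    have "finsum M (\<lambda>i. a \<odot>\<^bsub>M\<^esub> h i (x i)) J' = a \<odot>\<^bsub>M\<^esub> finsum M (\<lambda>i. h i (x i)) J'"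
      if "J' \<subseteq> J" for J'
      using finite_subset[OF that J] that
    proof (induction J' rule: finite_induct)
      case empty then show ?case using right_module_smult_zero[OF M a] by simp
    next
      case (insert j J')
      have "\<And>i. i \<in> insert j J' \<Longrightarrow> h i (x i) \<in> carrier M" using cl[OF x] insert.prems by blast
      then show ?case
        using insert a by (simp add: M.finsum_insert Pi_iff right_moduleD[OF M] M.finsum_closed)
    qed
    from this[of J] have "finsum M (\<lambda>i. a \<odot>\<^bsub>M\<^esub> h i (x i)) J = a \<odot>\<^bsub>M\<^esub> finsum M (\<lambda>i. h i (x i)) J" by simp
    moreover have "finsum M (\<lambda>i. h i ((a \<odot>\<^bsub>direct_sum J P\<^esub> x) i)) J = finsum M (\<lambda>i. a \<odot>\<^bsub>M\<^esub> h i (x i)) J"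
      using that h' right_moduleD(3)[OF M] by (intro M.finsum_cong') (auto simp: PiE_iff)
    ultimately show ?thesis by simp
  qed
  ultimately show ?thesis
    unfolding right_hom_def using M.finsum_closed[OF cl] by simp
qed

lemma fg_projective_direct_sum:
  assumes J: "finite J" and A: "ring A"
    and P: "\<And>i. i \<in> J \<Longrightarrow> right_module A (P i)"
    and s: "\<And>i. i \<in> J \<Longrightarrow> s i \<in> right_hom A (P i) (regular_module A)"
    and g: "\<And>i. i \<in> J \<Longrightarrow> g i \<in> carrier (P i)"
    and sg: "\<And>i x. \<lbrakk>i \<in> J; x \<in> carrier (P i)\<rbrakk> \<Longrightarrow> s i x \<odot>\<^bsub>P i\<^esub> g i = x"
  shows "fg_projective A (direct_sum J P)"
proof -
  \<comment> \<open>The free module in \<open>fg_projective\<close> is indexed by an initial segment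
    of the naturals, so the summands are enumerated first. Then \<open>f\<close> collects the
    sections \<open>s i\<close>, and \<open>h\<close> the retractions letting ring elements act on
    \<open>g i\<close>.\<close>
  obtain b where b: "bij_betw b {..<card J} J"
    using ex_bij_betw_nat_finite[OF J] by (auto simp: lessThan_atLeast0)
  let ?F = "direct_sum {..<card J} (\<lambda>_. regular_module A)"
  define \<iota> where "\<iota> = inv_into {..<card J} b"
  have bJ: "b n \<in> J" if "n < card J" for n using b that by (auto simp: bij_betw_def)
  have \<iota>: "\<iota> i < card J" "b (\<iota> i) = i" if "i \<in> J" for i
    using b that by (auto simp: \<iota>_def bij_betw_def inv_into_into f_inv_into_f)
       (metis inv_into_into lessThan_iff)
  define f where "f x = (\<lambda>n\<in>{..<card J}. s (b n) (x (b n)))" for x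
  define h where "h y = (\<lambda>i\<in>J. y (\<iota> i) \<odot>\<^bsub>P i\<^esub> g i)" for y
  have "f \<in> right_hom A (direct_sum J P) ?F"
    using bJ right_homD[OF s] by (auto simp: right_hom_def f_def PiE_iff intro!: restrict_ext)
  moreover have "h \<in> right_hom A ?F (direct_sum J P)"
    using \<iota> g right_moduleD(3,4,6)[OF P]
    by (auto simp: right_hom_def h_def PiE_iff intro!: restrict_ext)
  moreover have "h (f x) = x" if "x \<in> carrier (direct_sum J P)" for x
  proof
    fix i
    show "h (f x) i = x i"
      using that \<iota>[of i] sg[of i "x i"] by (cases "i \<in> J") (auto simp: h_def f_def)
  qed
  ultimately show ?thesis
    unfolding fg_projective_def Let_def
    by (intro conjI exI[of _ "card J"] bexI[of _ f] bexI[of _ h] ballI right_module_direct_sum[OF A P])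
qed

text \<open>Nakayama's lemma: \<open>R d\<close> plays the role of the \<open>d\<close>-th power of a nilpotent ideal.\<close>

lemma superfluousI:
  assumes P: "right_module A P" and K: "right_submodule A K P"
    and R0: "R 0 = carrier A" and RA: "\<And>d. R d \<subseteq> carrier A" and Rm: "R m = {\<zero>\<^bsub>A\<^esub>}"
    and KR: "\<And>N d z a. \<lbrakk>right_submodule A N P; z \<in> K; a \<in> R d;
        \<And>a' y. \<lbrakk>a' \<in> R (Suc d); y \<in> carrier P\<rbrakk> \<Longrightarrow> a' \<odot>\<^bsub>P\<^esub> y \<in> N\<rbrakk> \<Longrightarrow> a \<odot>\<^bsub>P\<^esub> z \<in> N"
  shows "superfluous A K P"
  unfolding superfluous_def
proof (intro conjI K allI impI, elim conjE)
  fix N assume N: "right_submodule A N P"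
    and gen: "\<forall>x\<in>carrier P. \<exists>y\<in>N. \<exists>z\<in>K. x = y \<oplus>\<^bsub>P\<^esub> z"
  have NP: "N \<subseteq> carrier P" using N by (simp add: right_submodule_def)
  have KP: "K \<subseteq> carrier P" using K by (simp add: right_submodule_def)
  \<comment> \<open>Downward induction along the filtration, at level \<open>m - e\<close>: level
    \<open>m\<close> is zero, and level 0 contains the identity of A, which yields all of P.\<close>
  have "\<forall>a\<in>R (m - e). \<forall>y\<in>carrier P. a \<odot>\<^bsub>P\<^esub> y \<in> N" if "e \<le> m" for e
    using that
  proof (induction e)
    case 0
    then show ?case using N right_module_zero_smult[OF P] by (simp add: Rm right_submodule_def)
  next
    case (Suc e)
    then have d: "m - e = Suc (m - Suc e)" by simp
    show ?case
    proof (intro ballI)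
      fix a y assume a: "a \<in> R (m - Suc e)" and y: "y \<in> carrier P"
      then have aA: "a \<in> carrier A" using RA by blast
      obtain n z where nz: "n \<in> N" "z \<in> K" "y = n \<oplus>\<^bsub>P\<^esub> z" using gen y by blast
      have "a \<odot>\<^bsub>P\<^esub> z \<in> N" using Suc by (intro KR[OF N nz(2) a]) (simp add: d)
      moreover have "a \<odot>\<^bsub>P\<^esub> n \<in> N" using N nz aA by (simp add: right_submodule_def)
      moreover have "a \<odot>\<^bsub>P\<^esub> y = a \<odot>\<^bsub>P\<^esub> n \<oplus>\<^bsub>P\<^esub> a \<odot>\<^bsub>P\<^esub> z"
        unfolding nz(3) using nz(1,2) aA NP KP by (intro right_moduleD[OF P]) auto
      ultimately show "a \<odot>\<^bsub>P\<^esub> y \<in> N" using N by (simp add: right_submodule_def)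
    qed
  qed
  from this[of m] have "a \<odot>\<^bsub>P\<^esub> y \<in> N" if "a \<in> carrier A" "y \<in> carrier P" for a y
    using that by (simp add: R0)
  then have "carrier P \<subseteq> N"
    using right_moduleD(7)[OF P] monoid.one_closed[OF ring.axioms(2)[OF right_moduleD(1)[OF P]]]
    by (metis subsetI)
  then show "N = carrier P" using NP by blast
qed

text \<open>The model is \<open>P i\<close> = \<open>e\<^sub>v A\<close>: \<open>s i\<close> is its
  embedding into A and \<open>s i (g i)\<close> the idempotent at v, so \<open>sm\<close> says that
  \<open>m i\<close> is supported at v. By \<open>ker\<close> the components of the kernel lie in
  level 1 of the filtration, and by \<open>R_mult\<close> such a factor raises the level.\<close>

lemma projective_cover_direct_sum:
  assumes J: "finite J" and M: "right_module A M"
    and P: "\<And>i. i \<in> J \<Longrightarrow> right_module A (P i)"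
    and s: "\<And>i. i \<in> J \<Longrightarrow> s i \<in> right_hom A (P i) (regular_module A)"
    and g: "\<And>i. i \<in> J \<Longrightarrow> g i \<in> carrier (P i)"
    and sg: "\<And>i x. \<lbrakk>i \<in> J; x \<in> carrier (P i)\<rbrakk> \<Longrightarrow> s i x \<odot>\<^bsub>P i\<^esub> g i = x"
    and m: "\<And>i. i \<in> J \<Longrightarrow> m i \<in> carrier M"
    and sm: "\<And>i. i \<in> J \<Longrightarrow> s i (g i) \<odot>\<^bsub>M\<^esub> m i = m i"
    and gen: "\<And>N. \<lbrakk>right_submodule A N M; \<And>i. i \<in> J \<Longrightarrow> m i \<in> N\<rbrakk> \<Longrightarrow> carrier M \<subseteq> N"
    and R0: "R 0 = carrier A" and RA: "\<And>d. R d \<subseteq> carrier A" and Rm: "R e = {\<zero>\<^bsub>A\<^esub>}"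
    and R_mult: "\<And>a b d. \<lbrakk>a \<in> R 1; b \<in> R d\<rbrakk> \<Longrightarrow> a \<otimes>\<^bsub>A\<^esub> b \<in> R (Suc d)"
    and ker: "\<And>x i. \<lbrakk>x \<in> carrier (direct_sum J P); i \<in> J;
        finsum M (\<lambda>i. s i (x i) \<odot>\<^bsub>M\<^esub> m i) J = \<zero>\<^bsub>M\<^esub>\<rbrakk> \<Longrightarrow> s i (x i) \<in> R 1"
  shows "projective_cover A (direct_sum J P) (\<lambda>x. finsum M (\<lambda>i. s i (x i) \<odot>\<^bsub>M\<^esub> m i) J) M"
proof -
  let ?\<pi> = "\<lambda>x. finsum M (\<lambda>i. s i (x i) \<odot>\<^bsub>M\<^esub> m i) J"
  let ?P = "direct_sum J P"
  have A: "ring A" using M by (rule right_moduleD)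
  have P': "right_module A ?P" by (rule right_module_direct_sum[OF A P])
  interpret M: abelian_group M using M by (rule right_moduleD)
  have h: "(\<lambda>x. s i x \<odot>\<^bsub>M\<^esub> m i) \<in> right_hom A (P i) M" if "i \<in> J" for i
    using right_homD[OF s[OF that]] m[OF that] right_moduleD[OF M] by (auto simp: right_hom_def)
  have \<pi>: "?\<pi> \<in> right_hom A ?P M" by (rule right_hom_finsum[OF J P M h])
  have "m i \<in> ?\<pi> ` carrier ?P" if i: "i \<in> J" for i
  proof (rule image_eqI)
    show x: "inj_summand J P i (g i) \<in> carrier ?P" using g[OF i] by (intro inj_summand_closed[OF P])
    have "?\<pi> (inj_summand J P i (g i)) = finsum M (\<lambda>j. if i = j then m j else \<zero>\<^bsub>M\<^esub>) J"
    proof (rule M.finsum_cong')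
      fix j assume j: "j \<in> J"
      show "s j (inj_summand J P i (g i) j) \<odot>\<^bsub>M\<^esub> m j = (if i = j then m j else \<zero>\<^bsub>M\<^esub>)"
        using j sm right_hom_zero[OF h[OF j] P[OF j] M] by (simp add: inj_summand_def)
    qed (use m in auto)
    also have "\<dots> = m i" using M.finsum_singleton[OF i J, of m] m by auto
    finally show "m i = ?\<pi> (inj_summand J P i (g i))" by simp
  qed
  then have "carrier M \<subseteq> ?\<pi> ` carrier ?P"
    by (intro gen right_submodule_image[OF \<pi> P' M])
  then have surj: "?\<pi> ` carrier ?P = carrier M" using right_homD(1)[OF \<pi>] by blast
  have "superfluous A {x \<in> carrier ?P. ?\<pi> x = \<zero>\<^bsub>M\<^esub>} ?P"
  proof (rule superfluousI[where R=R, OF P' right_submodule_kernel[OF \<pi> P' M] R0 RA Rm])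
    fix N d z a assume N: "right_submodule A N ?P" and z: "z \<in> {x \<in> carrier ?P. ?\<pi> x = \<zero>\<^bsub>M\<^esub>}"
      and a: "a \<in> R d" and IH: "\<And>a' y. \<lbrakk>a' \<in> R (Suc d); y \<in> carrier ?P\<rbrakk> \<Longrightarrow> a' \<odot>\<^bsub>?P\<^esub> y \<in> N"
    have aA: "a \<in> carrier A" using a RA by blast
    show "a \<odot>\<^bsub>?P\<^esub> z \<in> N"
    proof (rule direct_sum_in_submodule[OF J P N])
      show "a \<odot>\<^bsub>?P\<^esub> z \<in> carrier ?P" using right_moduleD(3)[OF P' aA] z by blast
      fix i assume i: "i \<in> J"
      have zi: "z i \<in> carrier (P i)" using z i by auto
      \<comment> \<open>\<open>z i\<close> is \<open>g i\<close> times the element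
        \<open>s i (z i)\<close> of level 1. Acting by \<open>a\<close> of level \<open>d\<close>
        gives \<open>g i\<close> times an element of level \<open>d + 1\<close>, where the
        hypothesis \<open>IH\<close> applies.\<close>
      have r: "s i (z i) \<in> R 1" using ker[of z i] z i by blast
      have rA: "s i (z i) \<in> carrier A" using r RA by blast
      have "a \<odot>\<^bsub>P i\<^esub> z i = (s i (z i) \<otimes>\<^bsub>A\<^esub> a) \<odot>\<^bsub>P i\<^esub> g i"
        using sg[OF i zi] right_moduleD(6)[OF P[OF i] rA aA g[OF i]] by simp
      then have "inj_summand J P i ((a \<odot>\<^bsub>?P\<^esub> z) i) = (s i (z i) \<otimes>\<^bsub>A\<^esub> a) \<odot>\<^bsub>?P\<^esub> inj_summand J P i (g i)"
        using i R_mult[OF r a] RA by (subst inj_summand_smult[OF P]) auto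
      also have "\<dots> \<in> N" using R_mult[OF r a] g[OF i] by (intro IH inj_summand_closed[OF P])
      finally show "inj_summand J P i ((a \<odot>\<^bsub>?P\<^esub> z) i) \<in> N" .
    qed
  qed
  moreover have "fg_projective A ?P"
    by (rule fg_projective_direct_sum[OF J A P s g sg])
  ultimately show ?thesis
    unfolding projective_cover_def using M \<pi> surj by blast
qed

section \<open>Bound quiver algebras\<close>

text \<open>A scalar multiple of a path. The record \<open>path_algebra\<close> is a ring without
  scalar multiplication, so the coefficient is carried along.\<close>

definition path_monomial :: "'k \<Rightarrow> ('v, 'a) qpath \<Rightarrow> ('v, 'a) qpath \<Rightarrow> 'k::field" where
  "path_monomial c w = (\<lambda>x. if x = w then c else 0)"

lemma path_elt_eq_monomial: "path_elt w = path_monomial 1 w"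
  by (simp add: path_elt_def path_monomial_def)

lemma path_algebra_carrier:
  "f \<in> carrier (path_algebra Q) \<longleftrightarrow> finite {w. f w \<noteq> 0} \<and> {w. f w \<noteq> 0} \<subseteq> qpaths Q"
  by (simp add: path_algebra_def)

lemma path_algebra_add: "f \<oplus>\<^bsub>path_algebra Q\<^esub> g = (\<lambda>w. f w + g w)"
  by (simp add: path_algebra_def)

lemma path_algebra_zero: "\<zero>\<^bsub>path_algebra Q\<^esub> = (\<lambda>_. 0)"
  by (simp add: path_algebra_def)

lemma path_algebra_mult:
  "(f \<otimes>\<^bsub>path_algebra Q\<^esub> g) (u, p) = (\<Sum>i\<le>length p.
     f (u, take i p) * g (pre_digraph.awlast Q u (take i p), drop i p))"
  by (simp add: path_algebra_def)

lemma path_monomial_closed: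
  "w \<in> qpaths Q \<Longrightarrow> path_monomial c w \<in> carrier (path_algebra Q)"
  by (auto simp: path_algebra_carrier path_monomial_def intro: finite_subset[of _ "{w}"])

lemma path_monomial_mult:
  "path_monomial c (u, p) \<otimes>\<^bsub>path_algebra Q\<^esub> path_monomial d (v, q) =
     (if pre_digraph.awlast Q u p = v then path_monomial (c * d) (u, p @ q)
      else \<zero>\<^bsub>path_algebra Q\<^esub>)"
proof
  fix w :: "('a, 'b) qpath"
  obtain u' r where w: "w = (u', r)" by fastforce
  \<comment> \<open>A concatenation determines its cutting point, so at most the term
    \<open>i = length p\<close> of the convolution survives.\<close>
  have *: "take i r = p \<and> drop i r = q \<longleftrightarrow> i = length p \<and> r = p @ q" if "i \<le> length r" for i
    using that by (metis append_eq_conv_conj append_take_drop_id length_take min.absorb2)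
  have "(path_monomial c (u, p) \<otimes>\<^bsub>path_algebra Q\<^esub> path_monomial d (v, q)) w
     = (\<Sum>i\<le>length r. if i = length p then
          (if r = p @ q \<and> u' = u \<and> pre_digraph.awlast Q u p = v then c * d else 0) else 0)"
    unfolding w path_algebra_mult
  proof (rule sum.cong[OF refl])
    fix i assume "i \<in> {..length r}"
    then have "take i r = p \<and> drop i r = q \<longleftrightarrow> i = length p \<and> r = p @ q" using * by simp
    then show "path_monomial c (u, p) (u', take i r) *
        path_monomial d (v, q) (pre_digraph.awlast Q u' (take i r), drop i r) =
      (if i = length p then (if r = p @ q \<and> u' = u \<and> pre_digraph.awlast Q u p = v then c * d else 0) else 0)"
      unfolding path_monomial_def by (cases "take i r = p"; cases "drop i r = q") simp_all
  qed
  also have "\<dots> = (if r = p @ q \<and> u' = u \<and> pre_digraph.awlast Q u p = v then c * d else 0)"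
    by (subst sum.delta) auto
  finally show "(path_monomial c (u, p) \<otimes>\<^bsub>path_algebra Q\<^esub> path_monomial d (v, q)) w =
     (if pre_digraph.awlast Q u p = v then path_monomial (c * d) (u, p @ q)
      else \<zero>\<^bsub>path_algebra Q\<^esub>) w"
    by (auto simp: w path_monomial_def path_algebra_zero)
qed

text \<open>Induction on a finite set containing the support: setting one coefficient to zero splits
  off a monomial.\<close>

lemma path_algebra_induct [consumes 1, case_names zero monomial add]:
  assumes "f \<in> carrier (path_algebra Q)"
    and "P \<zero>\<^bsub>path_algebra Q\<^esub>"
    and "\<And>c w. w \<in> qpaths Q \<Longrightarrow> P (path_monomial c w)"
    and "\<And>f g. \<lbrakk>f \<in> carrier (path_algebra Q); g \<in> carrier (path_algebra Q); P f; P g\<rbrakk>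
      \<Longrightarrow> P (f \<oplus>\<^bsub>path_algebra Q\<^esub> g)"
  shows "P f"
proof -
  have "P f" if "finite W" "{w. f w \<noteq> 0} \<subseteq> W" "W \<subseteq> qpaths Q" for f W
    using that
  proof (induction W arbitrary: f rule: finite_induct)
    case empty
    then have "f = \<zero>\<^bsub>path_algebra Q\<^esub>" by (auto simp: path_algebra_zero)
    then show ?case using assms(2) by simp
  next
    case (insert w W)
    have "P (f(w := 0))" using insert.prems by (intro insert.IH) auto
    moreover have "f(w := 0) \<in> carrier (path_algebra Q)"
      using insert.prems insert.hyps(1)
      by (auto simp: path_algebra_carrier intro: finite_subset[of _ W])
    moreover have "f = path_monomial (f w) w \<oplus>\<^bsub>path_algebra Q\<^esub> f(w := 0)"
      by (auto simp: path_algebra_add path_monomial_def)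
    ultimately show ?case
      using assms(3)[of w "f w"] assms(4)[of "path_monomial (f w) w" "f(w := 0)"]
        path_monomial_closed[of w Q "f w"] insert.prems by auto
  qed
  then show ?thesis using assms(1) unfolding path_algebra_carrier by blast
qed

lemma arrow_ideal_power_mult:
  fixes f g :: "('v, 'a) qpath \<Rightarrow> 'k::field"
  assumes "ring (path_algebra Q :: (('v, 'a) qpath \<Rightarrow> 'k) ring)" "f \<in> arrow_ideal_power Q m" "g \<in> arrow_ideal_power Q n"
  shows "f \<otimes>\<^bsub>path_algebra Q\<^esub> g \<in> arrow_ideal_power Q (m + n)"
  unfolding arrow_ideal_power_def
proof (intro CollectI conjI allI impI)
  interpret ring "path_algebra Q :: (('v, 'a) qpath \<Rightarrow> 'k) ring" by fact
  show "f \<otimes>\<^bsub>path_algebra Q\<^esub> g \<in> carrier (path_algebra Q)"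
    using assms by (simp add: arrow_ideal_power_def)
  fix w assume *: "(f \<otimes>\<^bsub>path_algebra Q\<^esub> g) w \<noteq> 0"
  obtain u p where w: "w = (u, p)" by fastforce
  obtain i where i: "i \<le> length p" "f (u, take i p) \<noteq> 0"
      "g (pre_digraph.awlast Q u (take i p), drop i p) \<noteq> 0"
    using * unfolding w path_algebra_mult by (metis (no_types, lifting) sum.neutral atMost_iff mult_eq_0_iff)
  then have "m \<le> i" "n \<le> length p - i"
    using assms(2,3) unfolding arrow_ideal_power_def by force+
  then show "m + n \<le> length (snd w)" using i(1) by (simp add: w)
qed

section \<open>Cosets in the quotient of a path algebra\<close>

locale bound_quiver = fin_digraph Q
  for Q :: "('v, 'a) pre_digraph" +
  fixes I :: "(('v, 'a) qpath \<Rightarrow> 'k::field) set"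
  assumes admissible: "admissible_ideal Q I"
begin

abbreviation KQ :: "(('v, 'a) qpath \<Rightarrow> 'k) ring" where "KQ \<equiv> path_algebra Q"
abbreviation A :: "(('v, 'a) qpath \<Rightarrow> 'k) set ring" where "A \<equiv> bound_quiver_algebra Q I"

lemma ideal_I: "ideal I KQ"
  using admissible by (simp add: admissible_ideal_def)

sublocale I: ideal I KQ by (rule ideal_I)

lemma ring_A: "ring A"
  unfolding bound_quiver_algebra_def by (rule I.quotient_is_ring)

definition coset :: "(('v, 'a) qpath \<Rightarrow> 'k) \<Rightarrow> (('v, 'a) qpath \<Rightarrow> 'k) set" where
  "coset f = I +>\<^bsub>KQ\<^esub> f"

lemma carrier_A: "carrier A = coset ` carrier KQ"
  by (auto simp: bound_quiver_algebra_def FactRing_def A_RCOSETS_def' coset_def a_r_coset_def')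

lemma coset_closed: "f \<in> carrier KQ \<Longrightarrow> coset f \<in> carrier A"
  by (simp add: carrier_A)

lemma coset_add: "\<lbrakk>f \<in> carrier KQ; g \<in> carrier KQ\<rbrakk> \<Longrightarrow> coset f \<oplus>\<^bsub>A\<^esub> coset g = coset (f \<oplus>\<^bsub>KQ\<^esub> g)"
  by (simp add: bound_quiver_algebra_def FactRing_def coset_def I.a_rcos_sum)

lemma coset_mult: "\<lbrakk>f \<in> carrier KQ; g \<in> carrier KQ\<rbrakk> \<Longrightarrow> coset f \<otimes>\<^bsub>A\<^esub> coset g = coset (f \<otimes>\<^bsub>KQ\<^esub> g)"
  by (simp add: bound_quiver_algebra_def FactRing_def coset_def I.rcoset_mult_add)

lemma coset_one: "\<one>\<^bsub>A\<^esub> = coset \<one>\<^bsub>KQ\<^esub>"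
  by (simp add: bound_quiver_algebra_def FactRing_def coset_def)

lemma coset_zero: "f \<in> I \<Longrightarrow> coset f = \<zero>\<^bsub>A\<^esub>"
  by (simp add: bound_quiver_algebra_def FactRing_def coset_def I.a_rcos_const)

text \<open>A coset acts on a walk module through a representative picked by \<open>SOME\<close>;
  this one differs from any given representative by an element of I.\<close>

lemma coset_representative:
  assumes "f \<in> carrier KQ"
  shows "\<exists>i\<in>I. (SOME g. g \<in> coset f) = i \<oplus>\<^bsub>KQ\<^esub> f"
proof -
  have "f \<in> coset f" using assms by (simp add: coset_def I.a_rcos_self)
  then have "(SOME g. g \<in> coset f) \<in> coset f" by (rule someI[of "\<lambda>g. g \<in> coset f"])
  then show ?thesis by (auto simp: coset_def a_r_coset_def')
qed

lemma arrow_ideal_power_nilpotent: "\<exists>m. \<forall>f \<in> arrow_ideal_power Q m. f \<in> I"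
  using admissible by (auto simp: admissible_ideal_def)

lemma qpaths_snoc:
  "(u, p @ [\<alpha>]) \<in> qpaths Q \<longleftrightarrow> (u, p) \<in> qpaths Q \<and> \<alpha> \<in> arcs Q \<and> tail Q \<alpha> = awlast u p"
  by (auto simp: qpaths_def awalk_append_iff awalk_simps intro: arc_implies_awalk)

lemma awlast_snoc: "awlast u (p @ [\<alpha>]) = head Q \<alpha>"
  by (simp add: awalk_verts_conv)

lemma qpaths_Nil: "(u, []) \<in> qpaths Q \<longleftrightarrow> u \<in> verts Q"
  by (auto simp: qpaths_def awalk_Nil_iff)

lemma qpaths_arc: "\<alpha> \<in> arcs Q \<Longrightarrow> (tail Q \<alpha>, [\<alpha>]) \<in> qpaths Q"
  using qpaths_snoc[of "tail Q \<alpha>" "[]" \<alpha>] by (simp add: qpaths_Nil)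

text \<open>A nontrivial path is a shorter path times its last arrow. Compatibility with products,
  as in \<open>coset_rep_act\<close>, thus has to be checked on trivial paths and single arrows
  only.\<close>

lemma path_algebra_generated [consumes 1, case_names zero vertex arrow add mult]:
  assumes f: "f \<in> carrier KQ"
    and zero: "P \<zero>\<^bsub>KQ\<^esub>"
    and vertex: "\<And>c u. u \<in> verts Q \<Longrightarrow> P (path_monomial c (u, []))"
    and arrow: "\<And>\<alpha>. \<alpha> \<in> arcs Q \<Longrightarrow> P (path_elt (tail Q \<alpha>, [\<alpha>]))"
    and add: "\<And>f g. \<lbrakk>f \<in> carrier KQ; g \<in> carrier KQ; P f; P g\<rbrakk> \<Longrightarrow> P (f \<oplus>\<^bsub>KQ\<^esub> g)"
    and mult: "\<And>f g. \<lbrakk>f \<in> carrier KQ; g \<in> carrier KQ; P f; P g\<rbrakk> \<Longrightarrow> P (f \<otimes>\<^bsub>KQ\<^esub> g)"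
  shows "P f"
  using f zero
proof (induction rule: path_algebra_induct)
  case (monomial c w)
  obtain u p where w: "w = (u, p)" by fastforce
  have "P (path_monomial c (u, p))" using monomial(1) unfolding w
  proof (induction p rule: rev_induct)
    case Nil
    then show ?case by (simp add: vertex qpaths_Nil)
  next
    case (snoc \<alpha> p)
    then have *: "(u, p) \<in> qpaths Q" "\<alpha> \<in> arcs Q" "tail Q \<alpha> = awlast u p" by (auto simp: qpaths_snoc)
    have "path_monomial c (u, p @ [\<alpha>]) = path_monomial c (u, p) \<otimes>\<^bsub>KQ\<^esub> path_elt (tail Q \<alpha>, [\<alpha>])"
      by (simp add: path_elt_eq_monomial path_monomial_mult *(3))
    moreover have "path_elt (tail Q \<alpha>, [\<alpha>]) \<in> carrier KQ"
      using *(2) by (simp add: path_elt_eq_monomial path_monomial_closed qpaths_arc)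
    ultimately show ?case
      using *(1,2) snoc.IH by (auto intro!: mult arrow path_monomial_closed)
  qed
  then show ?case by (simp add: w)
qed (use add in auto)

end

section \<open>Modules of walks\<close>

text \<open>Ends of a letter in the direction of its arrow rather than of the walk; in these terms
  the two sums of \<open>walk_arrow\<close> become one.\<close>

definition letter_src :: "nat \<Rightarrow> (nat \<Rightarrow> bool) \<Rightarrow> nat \<Rightarrow> nat" where
  "letter_src n dir l = (if dir l then l else Suc l mod n)"

definition letter_tgt :: "nat \<Rightarrow> (nat \<Rightarrow> bool) \<Rightarrow> nat \<Rightarrow> nat" where
  "letter_tgt n dir l = (if dir l then Suc l mod n else l)"

definition single :: "nat \<Rightarrow> 'w \<Rightarrow> nat \<Rightarrow> 'w::zero" where
  "single j w = (\<lambda>i. if i = j then w else 0)"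

text \<open>The action of the trivial path at \<open>u\<close>, an idempotent of the
  algebra.\<close>

definition at_vertex :: "nat \<Rightarrow> (nat \<Rightarrow> 'v) \<Rightarrow> 'v \<Rightarrow> (nat \<Rightarrow> 'w) \<Rightarrow> nat \<Rightarrow> 'w::zero" where
  "at_vertex n lab u x = (\<lambda>j. if j < n \<and> lab j = u then x j else 0)"

context bound_quiver
begin

text \<open>
  The module \<open>P\<close> is \<open>e\<^sub>v A\<close>, with generator \<open>g\<close> and the isomorphism given by representatives
  \<open>s x\<close> in the path algebra.
\<close>

definition presents_vertex ::
  "'v \<Rightarrow> ((('v, 'a) qpath \<Rightarrow> 'k) set, 'm) module \<Rightarrow> ('m \<Rightarrow> ('v, 'a) qpath \<Rightarrow> 'k) \<Rightarrow> 'm \<Rightarrow> bool" where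
  "presents_vertex v P s g \<longleftrightarrow> right_module A P \<and>
     (\<forall>x \<in> carrier P. s x \<in> carrier KQ \<and> (\<forall>w. s x w \<noteq> 0 \<longrightarrow> fst w = v)) \<and>
     (\<lambda>x. coset (s x)) \<in> right_hom A P (regular_module A) \<and>
     g \<in> carrier P \<and> s g = path_elt (v, []) \<and>
     (\<forall>x \<in> carrier P. coset (s x) \<odot>\<^bsub>P\<^esub> g = x)"

end

text \<open>By \<open>reduced\<close> an arrow maps a vector at one position to a vector at a single
  position, and by \<open>no_relation\<close> the generators of I act as zero. Surjectivity of
  \<open>F l\<close> allows a vector to be lifted along a letter towards a top. The predicate
  \<open>rel\<close> stands for the generating set of I.\<close>

locale walk = bound_quiver Q I + V: vector_space sc
  for Q :: "('v, 'a) pre_digraph" and I :: "(('v, 'a) qpath \<Rightarrow> 'k::field) set"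
    and sc :: "'k \<Rightarrow> 'w \<Rightarrow> 'w::ab_group_add" +
  fixes n :: nat and lab :: "nat \<Rightarrow> 'v" and L :: "nat set" and ar :: "nat \<Rightarrow> 'a"
    and dir :: "nat \<Rightarrow> bool" and F :: "nat \<Rightarrow> 'w \<Rightarrow> 'w" and rel :: "'a \<Rightarrow> 'a \<Rightarrow> bool"
  assumes letters: "L \<subseteq> {..<n}"
    and labels: "j < n \<Longrightarrow> lab j \<in> verts Q"
    and arrows: "l \<in> L \<Longrightarrow> ar l \<in> arcs Q"
      "l \<in> L \<Longrightarrow> tail Q (ar l) = lab (letter_src n dir l)"
      "l \<in> L \<Longrightarrow> head Q (ar l) = lab (letter_tgt n dir l)"
    and linear: "l \<in> L \<Longrightarrow> Vector_Spaces.linear sc sc (F l)"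
    and surjective: "l \<in> L \<Longrightarrow> surj (F l)"
    and reduced: "\<lbrakk>l \<in> L; l' \<in> L; letter_src n dir l = letter_src n dir l'; ar l = ar l'\<rbrakk> \<Longrightarrow> l = l'"
    and no_relation: "\<lbrakk>l \<in> L; l' \<in> L; letter_tgt n dir l = letter_src n dir l'\<rbrakk> \<Longrightarrow> \<not> rel (ar l) (ar l')"
    and rel_composable: "\<lbrakk>\<alpha> \<in> arcs Q; \<beta> \<in> arcs Q; rel \<alpha> \<beta>\<rbrakk> \<Longrightarrow> head Q \<alpha> = tail Q \<beta>"
    and relations: "I = Idl\<^bsub>path_algebra Q\<^esub> {path_elt (tail Q \<alpha>, [\<alpha>, \<beta>]) |\<alpha> \<beta>.
           \<alpha> \<in> arcs Q \<and> \<beta> \<in> arcs Q \<and> rel \<alpha> \<beta>}"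
begin

abbreviation "src \<equiv> letter_src n dir"
abbreviation "tgt \<equiv> letter_tgt n dir"
abbreviation "warr \<equiv> walk_arrow n L ar dir F"
abbreviation "wpath \<equiv> walk_path n lab L ar dir F"
abbreviation "vert \<equiv> at_vertex n lab"
abbreviation M :: "((('v, 'a) qpath \<Rightarrow> 'k) set, nat \<Rightarrow> 'w) module" where
  "M \<equiv> walk_module sc n lab L ar dir F"

lemma finite_L: "finite L" using letters finite_subset by blast

lemma src_less: "l \<in> L \<Longrightarrow> src l < n" and tgt_less: "l \<in> L \<Longrightarrow> tgt l < n"
  using letters by (auto simp: letter_src_def letter_tgt_def)

lemma F_simps:
  assumes "l \<in> L"
  shows "F l (x + y) = F l x + F l y" "F l (sc c x) = sc c (F l x)" "F l 0 = 0"
proof -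
  interpret Vector_Spaces.linear sc sc "F l" using linear[OF assms] .
  show "F l (x + y) = F l x + F l y" "F l (sc c x) = sc c (F l x)" "F l 0 = 0"
    by (rule add scale zero)+
qed

section \<open>Arrows and paths acting on a walk module\<close>

lemma walk_arrow_eq: "warr \<alpha> x j = (\<Sum>l \<in> {l \<in> L. ar l = \<alpha> \<and> tgt l = j}. F l (x (src l)))"
proof -
  have "{l \<in> L. ar l = \<alpha> \<and> tgt l = j} = {l \<in> L. ar l = \<alpha> \<and> dir l \<and> j = Suc l mod n}
      \<union> {l \<in> L. ar l = \<alpha> \<and> \<not> dir l \<and> j = l}" by (auto simp: letter_tgt_def)
  then have "(\<Sum>l \<in> {l \<in> L. ar l = \<alpha> \<and> tgt l = j}. F l (x (src l)))
     = (\<Sum>l \<in> {l \<in> L. ar l = \<alpha> \<and> dir l \<and> j = Suc l mod n}. F l (x (src l)))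
      + (\<Sum>l \<in> {l \<in> L. ar l = \<alpha> \<and> \<not> dir l \<and> j = l}. F l (x (src l)))"
    by (simp only:, intro sum.union_disjoint) (auto simp: finite_L)
  then show ?thesis
    unfolding walk_arrow_def by (simp add: letter_src_def cong: conj_cong)
qed

lemma walk_arrow_add: "warr \<alpha> (\<lambda>j. x j + y j) = (\<lambda>j. warr \<alpha> x j + warr \<alpha> y j)"
  by (auto simp: walk_arrow_eq F_simps sum.distrib)

lemma walk_arrow_scale: "warr \<alpha> (\<lambda>j. sc c (x j)) = (\<lambda>j. sc c (warr \<alpha> x j))"
  by (auto simp: walk_arrow_eq F_simps V.scale_sum_right)

lemma walk_arrow_zero: "warr \<alpha> (\<lambda>_. 0) = (\<lambda>_. 0)"
  by (auto simp: walk_arrow_eq F_simps)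

lemma walk_arrow_nonzero: "warr \<alpha> x j \<noteq> 0 \<Longrightarrow> \<exists>l \<in> L. ar l = \<alpha> \<and> tgt l = j"
  unfolding walk_arrow_eq by (metis (mono_tags, lifting) mem_Collect_eq sum.neutral)

lemma walk_arrow_single:
  assumes "l \<in> L"
  shows "warr (ar l) (single (src l) w) = single (tgt l) (F l w)"
proof
  fix j
  have "warr (ar l) (single (src l) w) j
      = (\<Sum>l' \<in> {l' \<in> L. ar l' = ar l \<and> tgt l' = j}. if l' = l then F l w else 0)"
    unfolding walk_arrow_eq using assms reduced by (intro sum.cong) (auto simp: single_def F_simps)
  also have "\<dots> = single (tgt l) (F l w) j"
    using assms by (subst sum.delta) (auto simp: finite_L single_def)
  finally show "warr (ar l) (single (src l) w) j = single (tgt l) (F l w) j" .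
qed

lemma walk_arrow_single_eq_zero:
  assumes "\<And>l. \<lbrakk>l \<in> L; ar l = \<alpha>\<rbrakk> \<Longrightarrow> src l \<noteq> j"
  shows "warr \<alpha> (single j w) = (\<lambda>_. 0)"
  unfolding walk_arrow_eq using assms by (auto simp: single_def F_simps intro!: ext sum.neutral)

lemma walk_path_Nil: "wpath (u, []) x = vert u x"
  by (simp add: walk_path_def at_vertex_def)

lemma walk_path_snoc: "wpath (u, p @ [\<alpha>]) x = warr \<alpha> (wpath (u, p) x)"
  by (simp add: walk_path_def)

lemma walk_path_append: "wpath (u, p @ q) x = fold warr q (wpath (u, p) x)"
  by (simp add: walk_path_def)

lemma walk_path_add: "wpath (u, p) (\<lambda>j. x j + y j) = (\<lambda>j. wpath (u, p) x j + wpath (u, p) y j)"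
  by (induction p rule: rev_induct)
     (auto simp: walk_path_Nil walk_path_snoc walk_arrow_add at_vertex_def)

lemma walk_path_scale: "wpath (u, p) (\<lambda>j. sc c (x j)) = (\<lambda>j. sc c (wpath (u, p) x j))"
  by (induction p rule: rev_induct)
     (auto simp: walk_path_Nil walk_path_snoc walk_arrow_scale at_vertex_def)

lemma walk_path_zero: "wpath (u, p) (\<lambda>_. 0) = (\<lambda>_. 0)"
  by (induction p rule: rev_induct)
     (auto simp: walk_path_Nil walk_path_snoc walk_arrow_zero at_vertex_def)

lemma walk_path_support:
  "\<lbrakk>(u, p) \<in> qpaths Q; wpath (u, p) x j \<noteq> 0\<rbrakk> \<Longrightarrow> j < n \<and> lab j = awlast u p"
proof (induction p arbitrary: j rule: rev_induct)
  case Nil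
  then show ?case by (auto simp: walk_path_Nil at_vertex_def split: if_splits)
next
  case (snoc \<alpha> p)
  then obtain l where "l \<in> L" "ar l = \<alpha>" "tgt l = j"
    using walk_arrow_nonzero unfolding walk_path_snoc by blast
  then show ?case using tgt_less arrows(3) by (auto simp: awlast_snoc)
qed

text \<open>The result of a path is concentrated at its end vertex. Hence the projection with which
  the second path begins is the identity or zero on it.\<close>

lemma walk_path_comp:
  assumes "(u, p) \<in> qpaths Q"
  shows "wpath (v, q) (wpath (u, p) x) = (if awlast u p = v then wpath (u, p @ q) x else (\<lambda>_. 0))"
proof -
  have "vert v (wpath (u, p) x) = (if awlast u p = v then wpath (u, p) x else (\<lambda>_. 0))"
    using walk_path_support[OF assms] by (fastforce simp: at_vertex_def)
  moreover have "fold warr q (\<lambda>_. 0) = (\<lambda>_. 0)"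
    by (induction q) (auto simp: walk_arrow_zero)
  ultimately show ?thesis
    using walk_path_append[of v "[]" q] by (simp add: walk_path_append walk_path_Nil)
qed

section \<open>The action of the path algebra and of its quotient\<close>

definition act :: "(('v, 'a) qpath \<Rightarrow> 'k) \<Rightarrow> (nat \<Rightarrow> 'w) \<Rightarrow> nat \<Rightarrow> 'w" where
  "act f x = (\<lambda>j. \<Sum>w | f w \<noteq> 0. sc (f w) (wpath w x j))"

lemma act_superset:
  "\<lbrakk>finite W; {w. f w \<noteq> 0} \<subseteq> W\<rbrakk> \<Longrightarrow> act f x j = (\<Sum>w\<in>W. sc (f w) (wpath w x j))"
  unfolding act_def by (rule sum.mono_neutral_left) auto

lemma act_add:
  assumes "f \<in> carrier KQ" "g \<in> carrier KQ"
  shows "act (f \<oplus>\<^bsub>KQ\<^esub> g) x = (\<lambda>j. act f x j + act g x j)"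
proof
  fix j
  let ?W = "{w. f w \<noteq> 0} \<union> {w. g w \<noteq> 0}"
  have W: "finite ?W" using assms by (simp add: path_algebra_carrier)
  have "act (f \<oplus>\<^bsub>KQ\<^esub> g) x j = (\<Sum>w\<in>?W. sc (f w + g w) (wpath w x j))"
    by (subst act_superset[OF W]) (auto simp: path_algebra_add)
  then show "act (f \<oplus>\<^bsub>KQ\<^esub> g) x j = act f x j + act g x j"
    by (simp add: act_superset[OF W] V.scale_left_distrib sum.distrib)
qed

lemma act_zero: "act \<zero>\<^bsub>KQ\<^esub> x = (\<lambda>_. 0)"
  by (simp add: act_def path_algebra_zero)

lemma act_monomial: "act (path_monomial c w) x = (\<lambda>j. sc c (wpath w x j))"
  by (rule ext, subst act_superset[of "{w}"]) (auto simp: path_monomial_def)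

lemma act_linear:
  "act f (\<lambda>j. x j + y j) = (\<lambda>j. act f x j + act f y j)"
  "act f (\<lambda>j. sc c (x j)) = (\<lambda>j. sc c (act f x j))"
  "act f (\<lambda>_. 0) = (\<lambda>_. 0)"
proof -
  have *: "wpath w (\<lambda>j. x j + y j) = (\<lambda>j. wpath w x j + wpath w y j)"
    "wpath w (\<lambda>j. sc c (x j)) = (\<lambda>j. sc c (wpath w x j))" "wpath w (\<lambda>_. 0) = (\<lambda>_. 0)" for w
    using walk_path_add walk_path_scale walk_path_zero by (cases w; simp)+
  show "act f (\<lambda>j. x j + y j) = (\<lambda>j. act f x j + act f y j)"
    "act f (\<lambda>j. sc c (x j)) = (\<lambda>j. sc c (act f x j))"
    "act f (\<lambda>_. 0) = (\<lambda>_. 0)"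
    unfolding act_def * by (auto simp: V.scale_right_distrib sum.distrib V.scale_sum_right mult.commute)
qed

lemma act_mult:
  assumes "f \<in> carrier KQ" "g \<in> carrier KQ"
  shows "act (f \<otimes>\<^bsub>KQ\<^esub> g) x = act g (act f x)"
  using assms(1)
proof (induction rule: path_algebra_induct)
  case zero
  then show ?case using assms by (simp add: act_zero act_linear)
next
  case (monomial c w)
  obtain u p where w: "w = (u, p)" by fastforce
  show ?case using assms(2)
  proof (induction rule: path_algebra_induct)
    case zero
    then show ?case using monomial by (simp add: act_zero path_monomial_closed)
  next
    case (monomial d w')
    obtain v q where w': "w' = (v, q)" by fastforce
    show ?case
      using \<open>w \<in> qpaths Q\<close>
      by (simp add: w w' path_monomial_mult act_monomial act_zero walk_path_comp walk_path_scale mult.commute)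
  next
    case (add g h)
    then show ?case using monomial
      by (simp add: I.r_distr act_add path_monomial_closed)
  qed
next
  case (add f f')
  then show ?case using assms(2) by (simp add: I.l_distr act_add act_linear)
qed

lemma act_support: 
  assumes "f \<in> carrier KQ" "n \<le> j"
  shows "act f x j = 0"
proof -
  have "wpath w x j = 0" if "w \<in> qpaths Q" for w
    using that walk_path_support[of "fst w" "snd w" x j] assms(2) by force
  then show ?thesis using assms(1) unfolding act_def path_algebra_carrier
    by (intro sum.neutral) auto
qed

text \<open>The elements that act as zero form an ideal, so it suffices to look at the generators of
  I. A nonzero composition of two arrows would need two letters, the second starting where the first
  ends, whose arrows form a relation.\<close>

lemma act_ideal:
  assumes "f \<in> I"
  shows "act f x = (\<lambda>_. 0)"
proof -
  let ?Z = "{f \<in> carrier KQ. \<forall>x. act f x = (\<lambda>_. 0)}"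
  let ?R = "{path_elt (tail Q \<alpha>, [\<alpha>, \<beta>]) |\<alpha> \<beta>. \<alpha> \<in> arcs Q \<and> \<beta> \<in> arcs Q \<and> rel \<alpha> \<beta>} :: (('v, 'a) qpath \<Rightarrow> 'k) set"
  have Z_neg: "act (\<ominus>\<^bsub>KQ\<^esub> f) x = (\<lambda>_. 0)" if "f \<in> ?Z" for f x
    using act_add[of f "\<ominus>\<^bsub>KQ\<^esub> f" x] that by (simp add: I.r_neg act_zero)
  have "ideal ?Z KQ"
  proof (rule idealI)
    show "subgroup ?Z (add_monoid KQ)"
    proof (rule I.add.subgroupI)
      show "?Z \<noteq> {}" using act_zero by blast
    qed (use Z_neg in \<open>auto simp: act_add\<close>)
  qed (auto simp: I.ring_axioms act_mult act_linear)
  moreover have "?R \<subseteq> ?Z"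
  proof
    fix f assume "f \<in> ?R"
    then obtain \<alpha> \<beta> where f: "f = path_elt (tail Q \<alpha>, [\<alpha>, \<beta>])" and ab: "\<alpha> \<in> arcs Q" "\<beta> \<in> arcs Q" "rel \<alpha> \<beta>"
      by blast
    have "warr \<beta> (warr \<alpha> y) j = 0" for y j
    proof -
      have "warr \<alpha> y (src l) = 0" if "l \<in> L" "ar l = \<beta>" for l
        using walk_arrow_nonzero[of \<alpha> y "src l"] no_relation[of _ l] that ab(3) by blast
      then show ?thesis unfolding walk_arrow_eq[of \<beta>] by (auto simp: F_simps intro!: sum.neutral)
    qed
    then have "act f x = (\<lambda>_. 0)" for x
      unfolding f path_elt_eq_monomial act_monomial
      using walk_path_snoc[of "tail Q \<alpha>" "[\<alpha>]" \<beta> x] walk_path_snoc[of "tail Q \<alpha>" "[]" \<alpha> x] by auto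
    moreover have "f \<in> carrier KQ"
      unfolding f path_elt_eq_monomial using ab qpaths_snoc[of "tail Q \<alpha>" "[\<alpha>]" \<beta>]
      by (intro path_monomial_closed) (simp add: qpaths_arc rel_composable)
    ultimately show "f \<in> ?Z" by simp
  qed
  ultimately have "I \<subseteq> ?Z" unfolding relations by (rule I.genideal_minimal)
  then show ?thesis using assms by blast
qed

lemma walk_module_simps [simp]:
  "x \<in> carrier M \<longleftrightarrow> (\<forall>j\<ge>n. x j = 0)" "\<zero>\<^bsub>M\<^esub> = (\<lambda>_. 0)" "x \<oplus>\<^bsub>M\<^esub> y = (\<lambda>j. x j + y j)"
  by (simp_all add: walk_module_def)

lemma smult_coset:
  assumes "f \<in> carrier KQ"
  shows "coset f \<odot>\<^bsub>M\<^esub> x = act f x"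
proof -
  obtain i where i: "i \<in> I" "(SOME g. g \<in> coset f) = i \<oplus>\<^bsub>KQ\<^esub> f"
    using coset_representative[OF assms] by blast
  have "coset f \<odot>\<^bsub>M\<^esub> x = act (i \<oplus>\<^bsub>KQ\<^esub> f) x"
    by (simp add: walk_module_def act_def Let_def i(2))
  also have "\<dots> = act f x"
    using i(1) assms by (subst act_add) (auto simp: act_ideal)
  finally show ?thesis .
qed

lemma carrier_induct [consumes 1, case_names zero single add]:
  assumes "x \<in> carrier M" "P (\<lambda>_. 0)" "\<And>j w. j < n \<Longrightarrow> P (single j w)"
    "\<And>x y. \<lbrakk>x \<in> carrier M; y \<in> carrier M; P x; P y\<rbrakk> \<Longrightarrow> P (\<lambda>j. x j + y j)"
  shows "P x"
proof -
  have "P (\<lambda>j. if j < k then x j else 0)" if "k \<le> n" for k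
    using that
  proof (induction k)
    case (Suc k)
    have "P (\<lambda>j. (if j < k then x j else 0) + single k (x k) j)"
      using Suc by (intro assms(4) assms(3)) (auto simp: single_def)
    moreover have "(\<lambda>j. (if j < k then x j else 0) + single k (x k) j) = (\<lambda>j. if j < Suc k then x j else 0)"
      by (auto simp: single_def)
    ultimately show ?case by simp
  qed (simp add: assms(2))
  from this[of n] have "P (\<lambda>j. if j < n then x j else 0)" by simp
  moreover have "(\<lambda>j. if j < n then x j else 0) = x" using assms(1) by auto
  ultimately show ?thesis by simp
qed

lemma single_in_carrier: "j < n \<Longrightarrow> single j w \<in> carrier M"
  by (simp add: single_def)

lemma act_one: "x \<in> carrier M \<Longrightarrow> act \<one>\<^bsub>KQ\<^esub> x = x"
proof
  fix j assume x: "x \<in> carrier M"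
  \<comment> \<open>The identity of the path algebra is the sum of the trivial paths, and each
    position is kept by exactly one of them, the one at its label.\<close>
  let ?W = "(\<lambda>u. (u, [])) ` verts Q"
  have one: "\<one>\<^bsub>KQ\<^esub> = (\<lambda>(u, p). if u \<in> verts Q \<and> p = [] then 1 else 0)"
    by (simp add: path_algebra_def)
  have "act \<one>\<^bsub>KQ\<^esub> x j = (\<Sum>w\<in>?W. sc (\<one>\<^bsub>KQ\<^esub> w) (wpath w x j))"
    by (rule act_superset) (auto simp: one split: if_splits)
  also have "\<dots> = (\<Sum>u\<in>verts Q. vert u x j)"
    by (subst sum.reindex) (auto simp: inj_on_def one walk_path_Nil)
  also have "\<dots> = (\<Sum>u\<in>verts Q. if u = lab j then (if j < n then x j else 0) else 0)"
    by (intro sum.cong) (auto simp: at_vertex_def)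
  also have "\<dots> = x j"
    using x labels[of j] by (subst sum.delta) auto
  finally show "act \<one>\<^bsub>KQ\<^esub> x j = x j" .
qed

lemma right_module_M: "right_module A M"
  unfolding right_module_def
proof (intro conjI ballI)
  show "abelian_group M"
  proof (rule abelian_groupI)
    fix x assume x: "x \<in> carrier M"
    show "\<exists>y\<in>carrier M. y \<oplus>\<^bsub>M\<^esub> x = \<zero>\<^bsub>M\<^esub>"
      using x by (intro bexI[of _ "\<lambda>j. - x j"]) auto
  qed (auto simp: ac_simps)
next
  fix a x assume "a \<in> carrier A" "x \<in> carrier M"
  then show "a \<odot>\<^bsub>M\<^esub> x \<in> carrier M" by (auto simp: carrier_A smult_coset act_support)
next
  fix a b x assume "a \<in> carrier A" "b \<in> carrier A" "x \<in> carrier M"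
  then show "(a \<oplus>\<^bsub>A\<^esub> b) \<odot>\<^bsub>M\<^esub> x = a \<odot>\<^bsub>M\<^esub> x \<oplus>\<^bsub>M\<^esub> b \<odot>\<^bsub>M\<^esub> x"
    by (auto simp: carrier_A smult_coset coset_add act_add)
next
  fix a x y assume "a \<in> carrier A" "x \<in> carrier M" "y \<in> carrier M"
  then show "a \<odot>\<^bsub>M\<^esub> (x \<oplus>\<^bsub>M\<^esub> y) = a \<odot>\<^bsub>M\<^esub> x \<oplus>\<^bsub>M\<^esub> a \<odot>\<^bsub>M\<^esub> y"
    by (auto simp: carrier_A smult_coset act_linear)
next
  fix a b x assume "a \<in> carrier A" "b \<in> carrier A" "x \<in> carrier M"
  then show "(a \<otimes>\<^bsub>A\<^esub> b) \<odot>\<^bsub>M\<^esub> x = b \<odot>\<^bsub>M\<^esub> (a \<odot>\<^bsub>M\<^esub> x)"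
    by (auto simp: carrier_A smult_coset coset_mult act_mult)
next
  fix x assume "x \<in> carrier M"
  then show "\<one>\<^bsub>A\<^esub> \<odot>\<^bsub>M\<^esub> x = x" by (simp add: coset_one smult_coset act_one)
qed (rule ring_A)

section \<open>Tops and generation\<close>

definition is_top :: "nat \<Rightarrow> bool" where
  "is_top i \<longleftrightarrow> i < n \<and> (\<forall>l \<in> L. tgt l \<noteq> i)"

lemma submodule_act:
  assumes "right_submodule A N M" "f \<in> carrier KQ" "x \<in> N"
  shows "act f x \<in> N"
  using assms coset_closed[OF assms(2)] smult_coset[OF assms(2)]
  unfolding right_submodule_def by metis

text \<open>
  Going up from a position one meets a is_top or climbs arbitrarily long paths, which act as zero.
\<close>

lemma generated_by_tops:
  assumes N: "right_submodule A N M" and tops: "\<And>i w. is_top i \<Longrightarrow> single i w \<in> N"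
  shows "carrier M \<subseteq> N"
proof
  have N0: "(\<lambda>_. 0) \<in> N" and N_add: "\<And>x y. \<lbrakk>x \<in> N; y \<in> N\<rbrakk> \<Longrightarrow> (\<lambda>j. x j + y j) \<in> N"
    using N by (auto simp: right_submodule_def)
  \<comment> \<open>Counting steps by \<open>d\<close> instead of following the walk to an end also
    covers cyclic walks, where an ascent need not stop a priori.\<close>
  have climb: "single j w \<in> N \<or> (\<exists>p j' w'. p \<in> qpaths Q \<and> length (snd p) = d \<and>
      single j w = wpath p (single j' w'))" if "j < n" for d j w
    using that
  proof (induction d arbitrary: j w)
    case 0
    then have "single j w = wpath (lab j, []) (single j w)"
      by (auto simp: walk_path_Nil at_vertex_def single_def)
    then show ?case using 0 labels by (metis qpaths_Nil list.size(3) snd_conv)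
  next
    case (Suc d)
    show ?case
    proof (cases "is_top j")
      case False
      then obtain l where l: "l \<in> L" "tgt l = j" using Suc.prems by (auto simp: is_top_def)
      obtain w' where w': "w = F l w'" using surjective[OF l(1)] by blast
      have *: "single j w = warr (ar l) (single (src l) w')"
        using walk_arrow_single[OF l(1)] l(2) w' by simp
      consider "single (src l) w' \<in> N" | u p j' w'' where "(u, p) \<in> qpaths Q" "length p = d"
          "single (src l) w' = wpath (u, p) (single j' w'')"
        using Suc.IH[OF src_less[OF l(1)], of w'] by fastforce
      then show ?thesis
      proof cases
        case 1
        have "act (path_elt (tail Q (ar l), [ar l])) (single (src l) w') \<in> N"
          using arrows(1)[OF l(1)] 1
          by (intro submodule_act[OF N]) (auto simp: path_elt_eq_monomial path_monomial_closed qpaths_arc)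
        moreover have "wpath (tail Q (ar l), []) (single (src l) w') = single (src l) w'"
          using l arrows(2) src_less by (auto simp: walk_path_Nil at_vertex_def single_def)
        ultimately show ?thesis
          using walk_path_snoc[of "tail Q (ar l)" "[]" "ar l"]
          by (simp add: path_elt_eq_monomial act_monomial *)
      next
        case 2
        have eq: "single j w = wpath (u, p @ [ar l]) (single j' w'')"
          by (simp add: walk_path_snoc * 2(3))
        show ?thesis
        \<comment> \<open>That the path \<open>p\<close> ends at the label of \<open>src l\<close>
          can be seen only from a nonzero value; the zero vector lies in \<open>N\<close>
          anyway.\<close>
        proof (cases "w' = 0")
          case True
          then have "single j w = (\<lambda>_. 0)" by (simp add: w' F_simps l single_def cong: if_cong)
          then show ?thesis using N0 by simp
        next
          case False
          then have "lab (src l) = awlast u p"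
            using walk_path_support[OF 2(1), of "single j' w''" "src l"] 2(3)
            by (metis single_def)
          then have "(u, p @ [ar l]) \<in> qpaths Q"
            using 2(1) arrows[OF l(1)] by (simp add: qpaths_snoc)
          then show ?thesis using eq 2(2)
            by (intro disjI2 exI[of _ "(u, p @ [ar l])"] exI[of _ j'] exI[of _ w'']) simp
        qed
      qed
    qed (simp add: tops)
  qed
  obtain m where m: "\<And>f. f \<in> arrow_ideal_power Q m \<Longrightarrow> f \<in> I"
    using arrow_ideal_power_nilpotent by blast
  \<comment> \<open>A path of length \<open>m\<close> lies in I, so the second alternative of
    \<open>climb\<close> forces \<open>single j w\<close> to be zero.\<close>
  have single_N: "single j w \<in> N" if "j < n" for j w
    using climb[OF that, of w m]
  proof (elim disjE exE conjE)
    fix p j' w' assume p: "p \<in> qpaths Q" "length (snd p) = m" "single j w = wpath p (single j' w')"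
    then have "path_monomial 1 p \<in> arrow_ideal_power Q m"
      by (auto simp: arrow_ideal_power_def path_monomial_closed) (auto simp: path_monomial_def split: if_splits)
    from act_ideal[OF m[OF this], of "single j' w'"] have "single j w = (\<lambda>_. 0)"
      by (simp add: act_monomial p(3))
    then show ?thesis using N0 by simp
  qed
  show "x \<in> N" if "x \<in> carrier M" for x
    using that by (induction rule: carrier_induct) (auto intro: N0 N_add single_N)
qed

text \<open>A path of positive length ends with an arrow, and no letter ends at a top. What remains
  is the coefficient of the trivial path; for an element whose paths all start at
  \<open>lab i\<close> it decides membership in the arrow ideal.\<close>

lemma act_at_top:
  assumes "f \<in> carrier KQ" "is_top i"
  shows "act f x i = sc (f (lab i, [])) (x i)"
  using assms(1)
proof (induction rule: path_algebra_induct)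
  case zero
  then show ?case by (simp add: act_zero) (simp add: path_algebra_zero)
next
  case (monomial c w)
  obtain u p where w: "w = (u, p)" by fastforce
  show ?case
  proof (cases p rule: rev_cases)
    case Nil
    then have "act (path_monomial c w) x i = sc c (vert u x i)"
      by (simp add: w act_monomial walk_path_Nil)
    then show ?thesis using assms(2) Nil
      by (auto simp: w at_vertex_def path_monomial_def is_top_def)
  next
    case (snoc q \<alpha>)
    then have "wpath w x i = 0"
      using assms(2) walk_arrow_nonzero[of \<alpha> "wpath (u, q) x" i] by (auto simp: w walk_path_snoc is_top_def)
    then have "act (path_monomial c w) x i = 0" by (simp add: act_monomial)
    then show ?thesis by (simp add: w snoc path_monomial_def)
  qed
next
  case (add f g)
  then show ?case by (simp add: act_add) (simp add: path_algebra_add V.scale_left_distrib)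
qed

section \<open>Projective cover of a walk module\<close>

lemma finsum_eq:
  "\<lbrakk>finite K; \<And>k. k \<in> K \<Longrightarrow> h k \<in> carrier M\<rbrakk> \<Longrightarrow> finsum M h K j = (\<Sum>k\<in>K. h k j)"
proof (induction K rule: finite_induct)
  interpret M: abelian_group M by (rule right_moduleD[OF right_module_M])
  {
    case empty
    then show ?case by simp
  next
    case (insert k K)
    then have "finsum M h (insert k K) = h k \<oplus>\<^bsub>M\<^esub> finsum M h K"
      by (intro M.finsum_insert) auto
    then show ?case using insert by simp
  }
qed

text \<open>The generator of the summand \<open>k\<close> goes to the vector \<open>bv k\<close> at
  the top \<open>pos k\<close>; \<open>span\<close> and \<open>indep\<close> say that the vectors
  over one top form a basis. For a string the indices are the tops themselves, for a band pairs of a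
  top and the number of a basis vector.\<close>

theorem projective_cover_walk:
  fixes P :: "'i \<Rightarrow> ((('v, 'a) qpath \<Rightarrow> 'k) set, 'm) module"
  assumes K: "finite K" and pos: "\<And>k. k \<in> K \<Longrightarrow> is_top (pos k)"
    and P: "\<And>k. k \<in> K \<Longrightarrow> \<exists>s g. presents_vertex (lab (pos k)) (P k) s g"
    and span: "\<And>i. is_top i \<Longrightarrow> V.span (bv ` {k \<in> K. pos k = i}) = UNIV"
    and indep: "\<And>i c k. \<lbrakk>(\<Sum>k \<in> {k \<in> K. pos k = i}. sc (c k) (bv k)) = 0; k \<in> K; pos k = i\<rbrakk> \<Longrightarrow> c k = 0"
  shows "\<exists>\<pi>. projective_cover A (direct_sum K P) \<pi> M"
proof -
  obtain s g where sg0: "\<And>k. k \<in> K \<Longrightarrow> presents_vertex (lab (pos k)) (P k) (s k) (g k)"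
    using P by metis
  from sg0 have sg: "\<And>k. k \<in> K \<Longrightarrow> right_module A (P k) \<and>
     (\<forall>x \<in> carrier (P k). s k x \<in> carrier KQ \<and> (\<forall>w. s k x w \<noteq> 0 \<longrightarrow> fst w = lab (pos k))) \<and>
     (\<lambda>x. coset (s k x)) \<in> right_hom A (P k) (regular_module A) \<and>
     g k \<in> carrier (P k) \<and> s k (g k) = path_elt (lab (pos k), []) \<and>
     (\<forall>x \<in> carrier (P k). coset (s k x) \<odot>\<^bsub>P k\<^esub> g k = x)"
    unfolding presents_vertex_def by blast
  let ?m = "\<lambda>k. single (pos k) (bv k)"
  let ?R = "\<lambda>d. coset ` arrow_ideal_power Q d"
  obtain e where e: "\<And>f. f \<in> arrow_ideal_power Q e \<Longrightarrow> f \<in> I"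
    using arrow_ideal_power_nilpotent by blast
  have m: "?m k \<in> carrier M" if "k \<in> K" for k
    using pos[OF that] by (intro single_in_carrier) (simp add: is_top_def)
  have unit: "act (path_monomial c (lab i, [])) (single i w) = single i (sc c w)" if "i < n" for c i w
    using that by (auto simp: act_monomial walk_path_Nil at_vertex_def single_def)
  have R0: "?R 0 = carrier A" by (simp add: carrier_A arrow_ideal_power_def)
  have RA: "\<And>d. ?R d \<subseteq> carrier A" by (auto simp: carrier_A arrow_ideal_power_def)
  have "\<zero>\<^bsub>KQ\<^esub> \<in> arrow_ideal_power Q e"
    by (simp add: arrow_ideal_power_def) (simp add: path_algebra_zero)
  then have Re: "?R e = {\<zero>\<^bsub>A\<^esub>}" using coset_zero e by force
  have R_mult: "a \<otimes>\<^bsub>A\<^esub> b \<in> ?R (Suc d)" if ab: "a \<in> ?R 1" "b \<in> ?R d" for a b d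
  proof -
    obtain f h where "a = coset f" "b = coset h" and fh: "f \<in> arrow_ideal_power Q 1" "h \<in> arrow_ideal_power Q d"
      using ab by blast
    moreover have "f \<in> carrier KQ" "h \<in> carrier KQ" using fh by (auto simp: arrow_ideal_power_def)
    ultimately show ?thesis
      using arrow_ideal_power_mult[OF I.ring_axioms fh] by (auto simp: coset_mult)
  qed
  have "projective_cover A (direct_sum K P) (\<lambda>x. finsum M (\<lambda>k. coset (s k (x k)) \<odot>\<^bsub>M\<^esub> ?m k) K) M"
  proof (rule projective_cover_direct_sum[where R = ?R and e = e and g = g, OF K right_module_M])
    fix k assume k: "k \<in> K"
    have "pos k < n" using pos[OF k] by (simp add: is_top_def)
    then show "coset (s k (g k)) \<odot>\<^bsub>M\<^esub> ?m k = ?m k"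
      using sg[OF k] labels unit[of "pos k" 1 "bv k"]
      by (simp add: path_elt_eq_monomial smult_coset path_monomial_closed qpaths_Nil)
  next
    fix N assume N: "right_submodule A N M" and mN: "\<And>k. k \<in> K \<Longrightarrow> ?m k \<in> N"
    show "carrier M \<subseteq> N"
    proof (rule generated_by_tops[OF N])
      fix i w assume i: "is_top i"
      then have "i < n" by (simp add: is_top_def)
      \<comment> \<open>A submodule is closed under A, so closure under scalars comes from multiples
        of the trivial path at \<open>lab i\<close>.\<close>
      have "V.subspace {w. single i w \<in> N}"
      proof (rule V.subspaceI)
        fix v w assume "v \<in> {w. single i w \<in> N}" "w \<in> {w. single i w \<in> N}"
        moreover have "single i (v + w) = single i v \<oplus>\<^bsub>M\<^esub> single i w" by (auto simp: single_def)
        ultimately show "v + w \<in> {w. single i w \<in> N}"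
          using N unfolding right_submodule_def by (metis mem_Collect_eq)
      next
        have "single i 0 = \<zero>\<^bsub>M\<^esub>" by (simp add: single_def cong: if_cong)
        then show "0 \<in> {w. single i w \<in> N}" using N unfolding right_submodule_def by (metis mem_Collect_eq)
      next
        fix c w assume "w \<in> {w. single i w \<in> N}"
        then show "sc c w \<in> {w. single i w \<in> N}"
          using submodule_act[OF N, of "path_monomial c (lab i, [])" "single i w"] \<open>i < n\<close> labels
          by (simp add: unit path_monomial_closed qpaths_Nil)
      qed
      moreover have "bv ` {k \<in> K. pos k = i} \<subseteq> {w. single i w \<in> N}" using mN by auto
      ultimately have "V.span (bv ` {k \<in> K. pos k = i}) \<subseteq> {w. single i w \<in> N}"
        by (rule V.span_minimal[rotated])
      then show "single i w \<in> N" using span[OF i] by auto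
    qed
  next
    fix x k assume x: "x \<in> carrier (direct_sum K P)" and k: "k \<in> K"
      and 0: "finsum M (\<lambda>k. coset (s k (x k)) \<odot>\<^bsub>M\<^esub> ?m k) K = \<zero>\<^bsub>M\<^esub>"
    have sx: "s k (x k) \<in> carrier KQ" "\<And>w. s k (x k) w \<noteq> 0 \<Longrightarrow> fst w = lab (pos k)" if "k \<in> K" for k
      using sg[OF that] PiE_mem[OF x[unfolded direct_sum_simps] that] by blast+
    let ?i = "pos k"
    have "0 = (\<Sum>k'\<in>K. (coset (s k' (x k')) \<odot>\<^bsub>M\<^esub> ?m k') ?i)"
      using fun_cong[OF 0, of ?i] m sx
      by (subst (asm) finsum_eq[OF K]) (auto intro!: right_moduleD(3)[OF right_module_M] coset_closed
            simp del: walk_module_simps(1) simp: walk_module_simps(2))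
    also have "\<dots> = (\<Sum>k'\<in>K. if pos k' = ?i then sc (s k' (x k') (lab ?i, [])) (bv k') else 0)"
      using sx by (intro sum.cong) (auto simp: smult_coset act_at_top[OF _ pos[OF k]] single_def)
    also have "\<dots> = (\<Sum>k'\<in>{k' \<in> K. pos k' = ?i}. sc (s k' (x k') (lab ?i, [])) (bv k'))"
      using K by (simp add: sum.inter_filter)
    finally have "(\<Sum>k'\<in>{k' \<in> K. pos k' = ?i}. sc (s k' (x k') (lab ?i, [])) (bv k')) = 0" by simp
    \<comment> \<open>Vanishing at the top is a linear relation between the vectors over it. As all
      paths in \<open>s k (x k)\<close> start at \<open>lab ?i\<close>, a zero coefficient of the
      trivial path leaves only paths of positive length.\<close>
    then have "s k (x k) (lab ?i, []) = 0" by (rule indep[OF _ k refl])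
    then have "s k (x k) \<in> arrow_ideal_power Q 1"
      using sx[OF k] unfolding arrow_ideal_power_def
      by (auto simp: Suc_le_eq)
    then show "coset (s k (x k)) \<in> ?R 1" by blast
  next
    fix k x assume "k \<in> K" "x \<in> carrier (P k)"
    then show "coset (s k x) \<odot>\<^bsub>P k\<^esub> g k = x" using sg by blast
  next
    fix k assume k: "k \<in> K"
    show "right_module A (P k)" "(\<lambda>x. coset (s k x)) \<in> right_hom A (P k) (regular_module A)"
      "g k \<in> carrier (P k)"
      using sg[OF k] by blast+
    show "?m k \<in> carrier M" by (rule m[OF k])
  next
    fix a b d assume "a \<in> ?R 1" "b \<in> ?R d"
    then show "a \<otimes>\<^bsub>A\<^esub> b \<in> ?R (Suc d)" by (rule R_mult)
  qed (rule R0 RA Re)+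
  then show ?thesis by blast
qed

end

text \<open>
  A string module with exactly one top \<open>t\<close>; the path \<open>p j\<close> leads from the top to the position \<open>j\<close>.
  By \<open>maximal\<close>, each path which leaves the string is zero in the algebra.
\<close>

locale rooted_walk = walk Q I "(*)" n lab L ar dir F rel
  for Q :: "('v, 'a) pre_digraph" and I :: "(('v, 'a) qpath \<Rightarrow> 'k::field) set"
    and n lab L ar dir F rel +
  fixes t :: nat and p :: "nat \<Rightarrow> 'a list"
  assumes trivial_on_letters: "l \<in> L \<Longrightarrow> F l c = c"
    and root: "t < n" "p t = []"
    and parent: "\<lbrakk>j < n; j \<noteq> t\<rbrakk> \<Longrightarrow> \<exists>l \<in> L. tgt l = j"
    and path_step: "l \<in> L \<Longrightarrow> p (tgt l) = p (src l) @ [ar l]"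
    and maximal: "\<lbrakk>j < n; \<alpha> \<in> arcs Q; tail Q \<alpha> = lab j; \<And>l. \<lbrakk>l \<in> L; ar l = \<alpha>\<rbrakk> \<Longrightarrow> src l \<noteq> j\<rbrakk>
      \<Longrightarrow> \<exists>l \<in> L. tgt l = j \<and> rel (ar l) \<alpha>"
begin

text \<open>Induction on the length of \<open>p j\<close>: the letter ending at \<open>j\<close>
  comes from a position whose path is shorter by that arrow.\<close>

lemma path_to_position:
  assumes "j < n"
  shows "(lab t, p j) \<in> qpaths Q" "awlast (lab t) (p j) = lab j"
    "wpath (lab t, p j) (single t c) = single j c"
proof -
  have "(lab t, p j) \<in> qpaths Q \<and> awlast (lab t) (p j) = lab j \<and>
      wpath (lab t, p j) (single t c) = single j c" if "j < n" for j
    using that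
  proof (induction "length (p j)" arbitrary: j rule: less_induct)
    case less
    show ?case
    proof (cases "j = t")
      case True
      then show ?thesis using root labels
        by (auto simp: qpaths_Nil walk_path_Nil at_vertex_def single_def)
    next
      case False
      then obtain l where l: "l \<in> L" "tgt l = j" using parent less.prems by blast
      have pj: "p j = p (src l) @ [ar l]" using path_step[OF l(1)] l(2) by simp
      have "(lab t, p (src l)) \<in> qpaths Q \<and> awlast (lab t) (p (src l)) = lab (src l) \<and>
          wpath (lab t, p (src l)) (single t c) = single (src l) c"
        using src_less[OF l(1)] by (intro less.hyps) (simp_all add: pj)
      then show ?thesis
        using l arrows[OF l(1)] walk_arrow_single[OF l(1), of c]
        by (simp add: pj qpaths_snoc awlast_snoc walk_path_snoc trivial_on_letters)
    qed
  qed
  then show "(lab t, p j) \<in> qpaths Q" "awlast (lab t) (p j) = lab j"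
    "wpath (lab t, p j) (single t c) = single j c"
    using assms by blast+
qed

text \<open>Modulo I, the inverse of the map letting elements of \<open>e\<^sub>v A\<close> act on
  the generator at the top, with v its label: the basis vector at \<open>j\<close> corresponds to
  the path leading there.\<close>

definition rep :: "(nat \<Rightarrow> 'k) \<Rightarrow> ('v, 'a) qpath \<Rightarrow> 'k" where
  "rep x = (\<lambda>w. \<Sum>j<n. path_monomial (x j) (lab t, p j) w)"

lemma rep_add: "rep (\<lambda>j. x j + y j) = rep x \<oplus>\<^bsub>KQ\<^esub> rep y"
  by (auto simp: rep_def path_algebra_add path_monomial_def sum.distrib[symmetric] intro!: ext sum.cong)

lemma rep_zero: "rep (\<lambda>_. 0) = \<zero>\<^bsub>KQ\<^esub>"
  by (auto simp: rep_def path_algebra_zero path_monomial_def)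

lemma rep_single: "j < n \<Longrightarrow> rep (single j c) = path_monomial c (lab t, p j)"
proof
  fix w assume j: "j < n"
  have "rep (single j c) w = (\<Sum>i<n. if i = j then path_monomial c (lab t, p j) w else 0)"
    unfolding rep_def by (intro sum.cong) (auto simp: single_def path_monomial_def)
  then show "rep (single j c) w = path_monomial c (lab t, p j) w" using j by simp
qed

lemma rep_closed: "x \<in> carrier M \<Longrightarrow> rep x \<in> carrier KQ"
  by (induction rule: carrier_induct)
     (auto simp: rep_zero rep_single rep_add path_monomial_closed path_to_position(1))

lemma rep_source: "rep x w \<noteq> 0 \<Longrightarrow> fst w = lab t"
  unfolding rep_def path_monomial_def by (auto elim!: sum.not_neutral_contains_not_neutral split: if_splits)

lemma act_rep: "x \<in> carrier M \<Longrightarrow> act (rep x) (single t 1) = x"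
proof (induction rule: carrier_induct)
  case (single j c)
  then show ?case
    using path_to_position(3)[OF single, of 1]
    by (simp add: rep_single act_monomial) (auto simp: single_def)
next
  case (add x y)
  then show ?case by (simp add: rep_add act_add rep_closed del: walk_module_simps(1))
qed (simp add: rep_zero act_zero)

lemma act_closed: "\<lbrakk>f \<in> carrier KQ\<rbrakk> \<Longrightarrow> act f x \<in> carrier M"
  by (simp add: act_support)

lemma coset_rep_add:
  assumes "x \<in> carrier M" "y \<in> carrier M"
  shows "coset (rep (\<lambda>j. x j + y j)) = coset (rep x) \<oplus>\<^bsub>A\<^esub> coset (rep y)"
  using assms[THEN rep_closed] by (simp add: rep_add coset_add)

text \<open>The last two arrows form a relation: \<open>maximal\<close> provides a letter ending at
  \<open>j\<close> whose arrow must not be followed by \<alpha>, and \<open>path_step\<close> makes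
  it the last arrow of \<open>p j\<close>.\<close>

lemma leaving_path_in_ideal:
  assumes j: "j < n" and \<alpha>: "\<alpha> \<in> arcs Q" "tail Q \<alpha> = lab j"
    and leaving: "\<And>l. \<lbrakk>l \<in> L; ar l = \<alpha>\<rbrakk> \<Longrightarrow> src l \<noteq> j"
  shows "path_monomial c (lab t, p j @ [\<alpha>]) \<in> I"
proof -
  obtain l where l: "l \<in> L" "tgt l = j" "rel (ar l) \<alpha>" using maximal[OF j \<alpha> leaving] by blast
  then have "path_elt (tail Q (ar l), [ar l, \<alpha>]) \<in> I"
    unfolding relations genideal_def using arrows(1)[OF l(1)] \<alpha>(1) by blast
  moreover have "path_monomial c (lab t, p (src l)) \<in> carrier KQ"
    using path_to_position(1)[OF src_less[OF l(1)]] by (rule path_monomial_closed)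
  ultimately have "path_monomial c (lab t, p (src l)) \<otimes>\<^bsub>KQ\<^esub> path_elt (tail Q (ar l), [ar l, \<alpha>]) \<in> I"
    by (rule I.I_l_closed)
  then show ?thesis
    using path_to_position(2)[OF src_less[OF l(1)]] path_step[OF l(1)] arrows(2)[OF l(1)] l(2)
    by (simp add: path_elt_eq_monomial path_monomial_mult)
qed

text \<open>Sums and products in f reduce the claim to trivial paths and arrows, sums in x to a
  vector at one position. An arrow then either belongs to a letter starting there, or it leaves the
  string: \<open>act\<close> gives zero and the product falls into I.\<close>

lemma coset_rep_act:
  assumes "f \<in> carrier KQ" "x \<in> carrier M"
  shows "coset (rep (act f x)) = coset (rep x) \<otimes>\<^bsub>A\<^esub> coset f"
  using assms
proof (induction arbitrary: x rule: path_algebra_generated)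
  case zero
  then show ?case by (simp add: act_zero rep_zero coset_mult rep_closed del: walk_module_simps(1))
next
  case (vertex c u)
  have cu: "path_monomial c (u, []) \<in> carrier KQ"
    using vertex(1) by (simp add: path_monomial_closed qpaths_Nil)
  show ?case using vertex(2)
  proof (induction rule: carrier_induct)
    case zero
    then show ?case using cu by (simp add: act_linear rep_zero coset_mult)
  next
    case (single j d)
    have "act (path_monomial c (u, [])) (single j d) = (if lab j = u then single j (c * d) else (\<lambda>_. 0))"
      using single by (auto simp: act_monomial walk_path_Nil at_vertex_def single_def)
    then show ?case
      using single cu path_to_position[OF single]
      by (auto simp: rep_single rep_zero coset_mult path_monomial_closed path_monomial_mult mult.commute)
  next
    case (add x y)
    interpret A: ring A by (rule ring_A)
    show ?case
      using add cu
      by (simp add: act_linear coset_rep_add act_closed A.l_distr coset_closed rep_closed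
            del: walk_module_simps(1))
  qed
next
  case (arrow \<alpha>)
  let ?\<alpha> = "path_elt (tail Q \<alpha>, [\<alpha>]) :: ('v, 'a) qpath \<Rightarrow> 'k"
  have cu: "?\<alpha> \<in> carrier KQ"
    using arrow(1) by (simp add: path_elt_eq_monomial path_monomial_closed qpaths_arc)
  show ?case using arrow(2)
  proof (induction rule: carrier_induct)
    case zero
    then show ?case using cu by (simp add: act_linear rep_zero coset_mult)
  next
    case (single j d)
    have "wpath (tail Q \<alpha>, []) (single j d) = (if lab j = tail Q \<alpha> then single j d else (\<lambda>_. 0))"
      using single by (auto simp: walk_path_Nil at_vertex_def single_def)
    then have act: "act ?\<alpha> (single j d) = (if lab j = tail Q \<alpha> then warr \<alpha> (single j d) else (\<lambda>_. 0))"
      using walk_path_snoc[of "tail Q \<alpha>" "[]" \<alpha> "single j d"]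
      by (auto simp: path_elt_eq_monomial act_monomial walk_arrow_zero)
    have prod: "coset (rep (single j d)) \<otimes>\<^bsub>A\<^esub> coset ?\<alpha> =
      (if lab j = tail Q \<alpha> then coset (path_monomial d (lab t, p j @ [\<alpha>])) else coset \<zero>\<^bsub>KQ\<^esub>)"
      using single cu path_to_position[OF single]
      by (auto simp: rep_single coset_mult path_monomial_closed)
         (auto simp: path_elt_eq_monomial path_monomial_mult)
    show ?case
    proof (cases "lab j = tail Q \<alpha>")
      case True
      show ?thesis
      proof (cases "\<exists>l\<in>L. ar l = \<alpha> \<and> src l = j")
        case True
        then obtain l where l: "l \<in> L" "ar l = \<alpha>" "src l = j" by blast
        then have "warr \<alpha> (single j d) = single (tgt l) d" using walk_arrow_single[OF l(1), of d] by (simp add: trivial_on_letters)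
        then show ?thesis
          unfolding act prod using l tgt_less[OF l(1)] path_step[OF l(1)] \<open>lab j = tail Q \<alpha>\<close>
          by (simp add: rep_single)
      next
        case False
        then have "warr \<alpha> (single j d) = (\<lambda>_. 0)" by (intro walk_arrow_single_eq_zero) blast
        moreover have "path_monomial d (lab t, p j @ [\<alpha>]) \<in> I"
          using single arrow(1) True False by (intro leaving_path_in_ideal) auto
        ultimately show ?thesis
          unfolding act prod using True by (simp add: rep_zero coset_zero)
      qed
    next
      case False
      then show ?thesis unfolding act prod by (simp add: rep_zero)
    qed
  next
    case (add x y)
    interpret A: ring A by (rule ring_A)
    show ?case
      using add cu
      by (simp add: act_linear coset_rep_add act_closed A.l_distr coset_closed rep_closed
            del: walk_module_simps(1))
  qed
next
  case (add f g)
  interpret A: ring A by (rule ring_A)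
  show ?case
    using add
    by (simp add: act_add coset_rep_add act_closed coset_add[symmetric] A.r_distr coset_closed rep_closed
            del: walk_module_simps(1))
next
  case (mult f g)
  interpret A: ring A by (rule ring_A)
  show ?case
    using mult
    by (simp add: act_mult act_closed coset_mult[symmetric] A.m_assoc coset_closed rep_closed
            del: walk_module_simps(1))
qed

theorem presents_vertex_root: "presents_vertex (lab t) M rep (single t 1)"
  unfolding presents_vertex_def
proof (intro conjI ballI allI impI)
  show "(\<lambda>x. coset (rep x)) \<in> right_hom A M (regular_module A)"
    unfolding right_hom_def
  proof (intro CollectI conjI ballI)
    fix a x assume "a \<in> carrier A" "x \<in> carrier M"
    then show "coset (rep (a \<odot>\<^bsub>M\<^esub> x)) = a \<odot>\<^bsub>regular_module A\<^esub> coset (rep x)"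
      by (auto simp: carrier_A smult_coset coset_rep_act simp del: walk_module_simps(1))
  qed (auto simp: coset_rep_add coset_closed rep_closed simp del: walk_module_simps(1)
        simp: walk_module_simps(3))
  show "single t 1 \<in> carrier M" by (rule single_in_carrier[OF root(1)])
  show "rep (single t 1) = path_elt (lab t, [])"
    using root by (simp add: rep_single path_elt_eq_monomial)
qed (auto simp: right_module_M rep_closed smult_coset act_rep dest: rep_source simp del: walk_module_simps(1))

end

section \<open>Itineraries\<close>

definition valid_side :: "('s, 'v, 'p) ribbon_surface \<Rightarrow> 'p \<times> nat \<Rightarrow> bool" where
  "valid_side S = (\<lambda>(P, i). P \<in> polygons S \<and> i < nsides S P)"

definition arc_of_side :: "('s, 'v, 'p) ribbon_surface \<Rightarrow> 'p \<times> nat \<Rightarrow> 'v" where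
  "arc_of_side S = (\<lambda>(P, i). side_arc S P i)"

text \<open>The polygons on the two sides of an arc may coincide, hence the sides and not the
  polygons are required to differ.\<close>

definition opposite_sides :: "('s, 'v, 'p) ribbon_surface \<Rightarrow> ('p \<times> nat) \<times> ('p \<times> nat) \<Rightarrow> bool" where
  "opposite_sides S = (\<lambda>(o1, o2). valid_side S o1 \<and> valid_side S o2 \<and> o1 \<noteq> o2 \<and>
     arc_of_side S o1 = arc_of_side S o2)"

text \<open>The arrow of a corner \<open>q\<close> leads from the arc of the side \<open>tail_side S q\<close> to that of the side \<open>q\<close>.\<close>

definition tail_side :: "('s, 'v, 'p) ribbon_surface \<Rightarrow> 'p \<times> nat \<Rightarrow> 'p \<times> nat" where
  "tail_side S = (\<lambda>(P, a). (P, next_side S P a))"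

text \<open>The arrow of \<open>q\<close> ends at the side \<open>q\<close>. If the next arrow
  starts at this very side, both corners belong to one polygon; if it starts at the opposite side of
  the arc, the composition goes on around the same marked point and is no relation.\<close>

lemma corner_relation_iff: "corner_relation S q q' \<longleftrightarrow> q = tail_side S q'"
  by (auto simp: corner_relation_def tail_side_def split: prod.splits)

lemma entered_side_eq: "entered_side S w = (if snd w then tail_side S (fst w) else fst w)"
  and exited_side_eq: "exited_side S w = (if snd w then fst w else tail_side S (fst w))"
  by (auto simp: entered_side_def exited_side_def tail_side_def split: prod.splits)

lemma valid_corner: "q \<in> corners S \<Longrightarrow> valid_side S q"
  by (auto simp: corners_def valid_side_def)

lemma valid_tail_side: "q \<in> corners S \<Longrightarrow> valid_side S (tail_side S q)"
  by (auto simp: corners_def valid_side_def tail_side_def next_side_def split: prod.splits)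

lemma inj_on_Suc_mod: "inj_on (\<lambda>a. Suc a mod n) {..<n}"
proof (rule inj_onI)
  fix a b assume "a \<in> {..<n}" "b \<in> {..<n}" "Suc a mod n = Suc b mod n"
  then show "a = b"
    by (cases "Suc a = n"; cases "Suc b = n") (simp_all add: mod_less[of "Suc _"] Suc_lessI)
qed

lemma tail_side_inj: "\<lbrakk>q \<in> corners S; q' \<in> corners S; tail_side S q = tail_side S q'\<rbrakk> \<Longrightarrow> q = q'"
  by (auto simp: corners_def tail_side_def next_side_def dest: inj_onD[OF inj_on_Suc_mod] split: prod.splits)

section \<open>Sides and half-edges of arcs\<close>

context
  fixes S :: "('s::t2_space, 'v, 'p) ribbon_surface"
  assumes S: "marked_ribbon_surface S"
begin

lemma polygon: "P \<in> polygons S \<Longrightarrow> elementary_polygon S P"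
  using S by (simp add: marked_ribbon_surface_def)

lemma arc_of_side_in_arc_set: "valid_side S s \<Longrightarrow> arc_of_side S s \<in> arc_set S"
  using polygon by (auto simp: valid_side_def arc_of_side_def elementary_polygon_def)

lemma side_unique:
  assumes "valid_side S s" "valid_side S s'" "arc_of_side S s = arc_of_side S s'"
    "side_fwd S (fst s) (snd s) = side_fwd S (fst s') (snd s')"
  shows "s = s'"
proof -
  have "\<forall>v \<in> arc_set S. \<forall>b. \<exists>!(P, i).
      P \<in> polygons S \<and> i < nsides S P \<and> side_arc S P i = v \<and> side_fwd S P i = b"
    using S unfolding marked_ribbon_surface_def by (elim conjE) assumption
  then have "\<exists>!(P, i). P \<in> polygons S \<and> i < nsides S P \<and> side_arc S P i = arc_of_side S s \<and>
      side_fwd S P i = side_fwd S (fst s) (snd s)"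
    using arc_of_side_in_arc_set[OF assms(1)] by simp
  moreover have "case s of (P, i) \<Rightarrow> P \<in> polygons S \<and> i < nsides S P \<and> side_arc S P i = arc_of_side S s \<and>
      side_fwd S P i = side_fwd S (fst s) (snd s)"
    using assms(1) by (auto simp: valid_side_def arc_of_side_def)
  moreover have "case s' of (P, i) \<Rightarrow> P \<in> polygons S \<and> i < nsides S P \<and> side_arc S P i = arc_of_side S s \<and>
      side_fwd S P i = side_fwd S (fst s) (snd s)"
    using assms(2-4) by (auto simp: valid_side_def arc_of_side_def)
  ultimately show ?thesis by (elim ex1E) blast
qed

text \<open>The two sides of an arc run along it in opposite directions, so passing to the other
  side exchanges beginning and end.\<close>

lemma opposite_sides_halves:
  assumes "opposite_sides S x"
  shows "second_half S (snd x) = first_half S (fst x)" "first_half S (snd x) = second_half S (fst x)"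
proof -
  have "side_fwd S (fst (snd x)) (snd (snd x)) \<noteq> side_fwd S (fst (fst x)) (snd (fst x))"
    using assms side_unique[of "fst x" "snd x"] by (auto simp: opposite_sides_def split: prod.splits)
  then show "second_half S (snd x) = first_half S (fst x)" "first_half S (snd x) = second_half S (fst x)"
    using assms
    by (auto simp: opposite_sides_def first_half_def second_half_def arc_of_side_def split: prod.splits)
qed

text \<open>An arc has one side for each value of \<open>side_fwd\<close>, and the two sides in
  \<open>x\<close> already take both values.\<close>

lemma side_cases:
  assumes "opposite_sides S x" "valid_side S s" "arc_of_side S s = arc_of_side S (fst x)"
  shows "s = fst x \<or> s = snd x"
proof -
  have "valid_side S (fst x)" "valid_side S (snd x)" "fst x \<noteq> snd x" "arc_of_side S (fst x) = arc_of_side S (snd x)"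
    using assms(1) by (auto simp: opposite_sides_def)
  then show ?thesis using assms(2,3) side_unique by metis
qed

lemma point_of_open_side:
  assumes P: "P \<in> polygons S" "i < nsides S P" and z: "z \<in> open_side S P i"
  shows "\<exists>x \<in> {0<..<1}. cell S P z = gamma S (side_arc S P i) x"
proof -
  obtain x where x: "x \<in> {real i<..<real i + 1}" "z = rim S P x" using z by (auto simp: open_side_def)
  have "\<forall>i < nsides S P. side_arc S P i \<in> arc_set S \<and>
        (\<forall>x \<in> {0..1}. cell S P (rim S P (real i + x)) =
           gamma S (side_arc S P i) (if side_fwd S P i then x else 1 - x))"
    using polygon[OF P(1)] unfolding elementary_polygon_def by (elim conjE) assumption
  moreover have "x - real i \<in> {0..1}" using x(1) by simp
  ultimately have "cell S P (rim S P (real i + (x - real i))) =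
      gamma S (side_arc S P i) (if side_fwd S P i then x - real i else 1 - (x - real i))"
    using P(2) by blast
  then show ?thesis
    using x by (intro bexI[of _ "if side_fwd S P i then x - real i else 1 - (x - real i)"]) auto
qed

text \<open>Both lifts meet at \<open>c t\<close>, which is an interior point of the arcs of both
  sides; interior points lie on one arc only.\<close>

lemma crosses_at_opposite_sides:
  assumes "crosses_at S c t x"
  shows "opposite_sides S x"
proof -
  obtain P i P' i' where x: "x = ((P, i), (P', i'))" by (metis prod.collapse)
  obtain e d1 d2 where e: "0 < e" and ne: "(P, i) \<noteq> (P', i')" and i: "i < nsides S P" "i' < nsides S P'"
    and d1: "lifts S c (t - e) t P d1" "d1 1 \<in> open_side S P i"
    and d2: "lifts S c t (t + e) P' d2" "d2 0 \<in> open_side S P' i'"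
    using assms unfolding crosses_at_def x by auto
  have P: "P \<in> polygons S" "P' \<in> polygons S" using d1 d2 by (auto simp: lifts_def)
  have "cell S P (d1 1) = c (linepath (t - e) t 1)" "cell S P' (d2 0) = c (linepath t (t + e) 0)"
    using d1(1) d2(1) unfolding lifts_def by auto
  then have eq: "cell S P (d1 1) = cell S P' (d2 0)" by (simp add: linepath_def)
  have "side_arc S P i = side_arc S P' i'"
  proof -
    have "side_arc S P i \<in> arc_set S" "side_arc S P' i' \<in> arc_set S"
      using arc_of_side_in_arc_set[of "(P, i)"] arc_of_side_in_arc_set[of "(P', i')"] P i
      by (auto simp: valid_side_def arc_of_side_def)
    moreover have "\<forall>v \<in> arc_set S. \<forall>w \<in> arc_set S. \<forall>x \<in> {0<..<1}. \<forall>y \<in> {0<..<1}.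
        gamma S v x = gamma S w y \<longrightarrow> v = w \<and> x = y"
      using S unfolding marked_ribbon_surface_def by (elim conjE) assumption
    ultimately show ?thesis
      using eq point_of_open_side[OF P(1) i(1) d1(2)] point_of_open_side[OF P(2) i(2) d2(2)]
      by metis
  qed
  then show ?thesis
    using P i ne by (auto simp: opposite_sides_def valid_side_def arc_of_side_def x)
qed

end

text \<open>The combinatorial content of an itinerary, for curves and closed curves alike.\<close>

definition crossing_word :: "('s::t2_space, 'v, 'p) ribbon_surface \<Rightarrow> nat set \<Rightarrow>
    (('p \<times> nat) \<times> ('p \<times> nat)) list \<Rightarrow> (('p \<times> nat) \<times> bool) list \<Rightarrow> bool" where
  "crossing_word S L xs ws \<longleftrightarrow> L \<subseteq> {..<length xs} \<and>
     (\<forall>j < length xs. opposite_sides S (xs ! j)) \<and>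
     (\<forall>l \<in> L. fst (ws ! l) \<in> corners S \<and> entered_side S (ws ! l) = snd (xs ! l) \<and>
        exited_side S (ws ! l) = fst (xs ! (Suc l mod length xs)))"

text \<open>Letter \<open>l\<close> lies in the polygon between crossing \<open>l\<close> and the
  next one, so it touches the second side of the former and the first side of the latter, whatever
  the direction of its arrow. The two ends of letters meeting at a position thus lie on opposite
  sides of the crossed arc.\<close>

lemma crossing_word_letter:
  assumes "crossing_word S L xs ws" "l \<in> L"
  defines "n \<equiv> length xs"
  shows "tail_side S (fst (ws ! l)) = (if on_left ws l then snd (xs ! letter_src n (on_left ws) l)
            else fst (xs ! letter_src n (on_left ws) l))"
    "fst (ws ! l) = (if on_left ws l then fst (xs ! letter_tgt n (on_left ws) l)
            else snd (xs ! letter_tgt n (on_left ws) l))"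
  using assms
  by (auto simp: crossing_word_def entered_side_eq exited_side_eq on_left_def letter_src_def letter_tgt_def)

lemma turns_corner: "turns S c s t w \<Longrightarrow> fst w \<in> corners S"
  by (cases w) (auto simp: turns_def)

text \<open>This lemma and its closed analogue pass from topology to combinatorics. For a curve with
  ends no letter wraps around, so the index modulo \<open>length xs\<close> is the plain
  successor.\<close>

lemma itinerary_crossing_word:
  assumes S: "marked_ribbon_surface S" and it: "itinerary S c xs ws"
  shows "crossing_word S {..<length ws} xs ws" "length ws = length xs - 1"
proof -
  show len: "length ws = length xs - 1" using it by (simp add: itinerary_def Let_def)
  show "crossing_word S {..<length ws} xs ws"
    unfolding crossing_word_def
  proof (intro conjI allI impI ballI)
    fix j assume "j < length xs"
    then show "opposite_sides S (xs ! j)"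
      using it crosses_at_opposite_sides[OF S] unfolding itinerary_def Let_def by blast
  next
    fix l assume l: "l \<in> {..<length ws}"
    then have "turns S c (sorted_list_of_set (crossing_times S c) ! l)
        (sorted_list_of_set (crossing_times S c) ! Suc l) (ws ! l)" "entered_side S (ws ! l) = snd (xs ! l)"
        "exited_side S (ws ! l) = fst (xs ! Suc l)"
      using it by (auto simp: itinerary_def Let_def)
    then show "fst (ws ! l) \<in> corners S" "entered_side S (ws ! l) = snd (xs ! l)"
        "exited_side S (ws ! l) = fst (xs ! (Suc l mod length xs))"
      using l len by (auto dest: turns_corner)
  qed (use len in auto)
qed

lemma closed_itinerary_crossing_word:
  assumes S: "marked_ribbon_surface S" and it: "closed_itinerary S c xs ws"
  shows "crossing_word S {..<length ws} xs ws" "length ws = length xs"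
proof -
  show len: "length ws = length xs" using it by (simp add: closed_itinerary_def Let_def)
  show "crossing_word S {..<length ws} xs ws"
    unfolding crossing_word_def
  proof (intro conjI allI impI ballI)
    fix j assume "j < length xs"
    then show "opposite_sides S (xs ! j)"
      using it crosses_at_opposite_sides[OF S] unfolding closed_itinerary_def Let_def by metis
  next
    fix l assume l: "l \<in> {..<length ws}"
    then have "\<exists>s t. turns S c s t (ws ! l)" "entered_side S (ws ! l) = snd (xs ! l)"
        "exited_side S (ws ! l) = fst (xs ! (Suc l mod length xs))"
      using it unfolding closed_itinerary_def Let_def by (metis lessThan_iff)+
    then show "fst (ws ! l) \<in> corners S" "entered_side S (ws ! l) = snd (xs ! l)"
        "exited_side S (ws ! l) = fst (xs ! (Suc l mod length xs))"
      by (auto dest: turns_corner)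
  qed (use len in auto)
qed

lemma the_itinerary_itinerary:
  assumes "permissible_curve S c" "the_itinerary S c = (xs, ws)"
  shows "itinerary S c xs ws"
proof -
  have "\<exists>p. case p of (xs, ws) \<Rightarrow> itinerary S c xs ws"
    using assms(1) by (auto simp: permissible_curve_def)
  from someI_ex[OF this] show ?thesis using assms(2) by (simp add: the_itinerary_def)
qed

lemma the_closed_itinerary_closed_itinerary:
  assumes "permissible_closed_curve S c" "the_closed_itinerary S c = (xs, ws)"
  shows "closed_itinerary S c xs ws"
proof -
  have "\<exists>p. case p of (xs, ws) \<Rightarrow> closed_itinerary S c xs ws"
    using assms(1) by (auto simp: permissible_closed_curve_def)
  from someI_ex[OF this] show ?thesis using assms(2) by (simp add: the_closed_itinerary_def)
qed

section \<open>Curves as walks over the algebra of a surface\<close>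

locale surface_algebra = bound_quiver Q I
  for Q :: "('v, 'a) pre_digraph" and I :: "(('v, 'a) qpath \<Rightarrow> 'k::field) set" +
  fixes S :: "('s::t2_space, 'v, 'p) ribbon_surface" and cor :: "'a \<Rightarrow> 'p \<times> nat"
  assumes surface: "marked_ribbon_surface S"
    and algebra: "algebra_of_surface Q I S cor"
begin

abbreviation corner_arrow :: "(('p \<times> nat) \<times> bool) list \<Rightarrow> nat \<Rightarrow> 'a" where
  "corner_arrow ws \<equiv> (\<lambda>l. inv_into (arcs Q) cor (fst (ws ! l)))"

abbreviation rel :: "'a \<Rightarrow> 'a \<Rightarrow> bool" where
  "rel \<equiv> (\<lambda>\<alpha> \<beta>. corner_relation S (cor \<alpha>) (cor \<beta>))"

lemma verts_eq: "verts Q = arc_set S"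
  using algebra by (simp add: algebra_of_surface_def surface_quiver_def)

lemma cor_bij: "bij_betw cor (arcs Q) (corners S)"
  using algebra by (simp add: algebra_of_surface_def surface_quiver_def)

lemma cor_corner: "\<alpha> \<in> arcs Q \<Longrightarrow> cor \<alpha> \<in> corners S"
  using cor_bij by (auto simp: bij_betw_def)

lemma cor_ends:
  assumes "\<alpha> \<in> arcs Q"
  shows "tail Q \<alpha> = arc_of_side S (tail_side S (cor \<alpha>))" "head Q \<alpha> = arc_of_side S (cor \<alpha>)"
  using algebra assms
  by (auto simp: algebra_of_surface_def surface_quiver_def arc_of_side_def tail_side_def split: prod.splits)

lemma crossed_arc_eq: "crossed_arc S xs j = arc_of_side S (fst (xs ! j))"
  by (simp add: crossed_arc_def arc_of_side_def)

lemma corner_arrow: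
  assumes "crossing_word S L xs ws" "l \<in> L"
  shows "corner_arrow ws l \<in> arcs Q" "cor (corner_arrow ws l) = fst (ws ! l)"
proof -
  have "fst (ws ! l) \<in> cor ` arcs Q"
    using assms cor_bij by (auto simp: crossing_word_def bij_betw_def)
  then show "corner_arrow ws l \<in> arcs Q" "cor (corner_arrow ws l) = fst (ws ! l)"
    by (rule inv_into_into, rule f_inv_into_f)
qed

lemma crossing_word_walk:
  assumes w: "crossing_word S L xs ws" and sc: "vector_space sc"
    and F: "\<And>l. l \<in> L \<Longrightarrow> Vector_Spaces.linear sc sc (F l)" "\<And>l. l \<in> L \<Longrightarrow> surj (F l)"
  shows "walk Q I sc (length xs) (crossed_arc S xs) L (corner_arrow ws) (on_left ws) F rel"
proof -
  interpret V: vector_space sc by fact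
  let ?n = "length xs" and ?d = "on_left ws"
  have L: "L \<subseteq> {..<?n}" and opp: "\<And>j. j < ?n \<Longrightarrow> opposite_sides S (xs ! j)"
    using w by (auto simp: crossing_word_def)
  have sides: "valid_side S (fst (xs ! j))" "arc_of_side S (fst (xs ! j)) = arc_of_side S (snd (xs ! j))"
     "fst (xs ! j) \<noteq> snd (xs ! j)" if "j < ?n" for j
    using opp[OF that] by (auto simp: opposite_sides_def)
  have lt: "letter_src ?n ?d l < ?n" "letter_tgt ?n ?d l < ?n" if "l \<in> L" for l
  proof -
    have "l < ?n" "Suc l mod ?n < ?n" using that L by (auto intro: mod_less_divisor)
    then show "letter_src ?n ?d l < ?n" "letter_tgt ?n ?d l < ?n"
      by (simp_all add: letter_src_def letter_tgt_def)
  qed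
  note letter = crossing_word_letter[OF w]
  show ?thesis
  proof (intro walk.intro walk_axioms.intro bound_quiver_axioms sc)
    show "L \<subseteq> {..<?n}" by (rule L)
    show "crossed_arc S xs j \<in> verts Q" if "j < ?n" for j
      using arc_of_side_in_arc_set[OF surface sides(1)[OF that]] by (simp add: crossed_arc_eq verts_eq)
    fix l assume l: "l \<in> L"
    show "corner_arrow ws l \<in> arcs Q" by (rule corner_arrow[OF w l])
    show "tail Q (corner_arrow ws l) = crossed_arc S xs (letter_src ?n ?d l)"
      using sides(2)[OF lt(1)[OF l]] letter(1)[OF l]
      by (simp add: cor_ends corner_arrow[OF w l] crossed_arc_eq)
    have "head Q (corner_arrow ws l) = arc_of_side S (fst (ws ! l))"
      by (simp add: cor_ends corner_arrow[OF w l])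
    also have "\<dots> = crossed_arc S xs (letter_tgt ?n ?d l)"
      unfolding crossed_arc_eq by (subst letter(2)[OF l]) (simp add: sides(2)[OF lt(2)[OF l]])
    finally show "head Q (corner_arrow ws l) = crossed_arc S xs (letter_tgt ?n ?d l)" .
    show "Vector_Spaces.linear sc sc (F l)" "surj (F l)" using F l by auto
    fix l' assume l': "l' \<in> L"
    show "l = l'" if "letter_src ?n ?d l = letter_src ?n ?d l'" "corner_arrow ws l = corner_arrow ws l'"
    proof -
      \<comment> \<open>Equal arrows have equal corners and start at the same side; as the two sides
        at a position differ, the letters have the same direction and hence the same index.\<close>
      have "fst (ws ! l) = fst (ws ! l')" using that(2) corner_arrow(2)[OF w] l l' by metis
      then have "?d l = ?d l'"
        using letter(1)[OF l] letter(1)[OF l'] that(1) sides(3)[OF lt(1)[OF l]] by (auto split: if_splits)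
      then show ?thesis
        using that(1) L l l' by (auto simp: letter_src_def dest: inj_onD[OF inj_on_Suc_mod] split: if_splits)
    qed
    show "\<not> rel (corner_arrow ws l) (corner_arrow ws l')" if eq: "letter_tgt ?n ?d l = letter_src ?n ?d l'"
    proof
      assume "rel (corner_arrow ws l) (corner_arrow ws l')"
      \<comment> \<open>In a relation the second arrow starts at the very side where the first one
        ends. The letters before and after a position touch opposite sides, so both would be the
        same letter, with both directions at once.\<close>
      then have "fst (ws ! l) = tail_side S (fst (ws ! l'))"
        by (simp add: corner_relation_iff corner_arrow[OF w] l l')
      then have "?d l \<noteq> ?d l'"
        using letter(2)[OF l] letter(1)[OF l'] eq sides(3)[OF lt(1)[OF l']] by (auto split: if_splits)
      moreover from this have "l = l'"
        using eq L l l'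
        by (auto simp: letter_src_def letter_tgt_def dest: inj_onD[OF inj_on_Suc_mod] split: if_splits)
      ultimately show False by simp
    qed
  next
    show "head Q \<alpha> = tail Q \<beta>" if "\<alpha> \<in> arcs Q" "\<beta> \<in> arcs Q" "rel \<alpha> \<beta>" for \<alpha> \<beta>
      using that by (simp add: corner_relation_iff cor_ends)
    show "I = Idl\<^bsub>KQ\<^esub> {path_elt (tail Q \<alpha>, [\<alpha>, \<beta>]) |\<alpha> \<beta>. \<alpha> \<in> arcs Q \<and> \<beta> \<in> arcs Q \<and> rel \<alpha> \<beta>}"
      using algebra by (simp add: algebra_of_surface_def)
  qed
qed

text \<open>An arrow starting at the outer side of the first or last crossing would add its head
  half-edge to the fan around the marked point. As \<open>ccw\<close> is transitive, comparing
  neighbouring half-edges suffices.\<close>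

lemma maximal_at_ends:
  assumes it: "itinerary S c xs ws" and n: "n = length xs" and i: "i < n"
    and right: "\<And>j. j < i \<Longrightarrow> on_right ws j"
    and left: "\<And>j. \<lbrakk>i \<le> j; Suc j < n\<rbrakk> \<Longrightarrow> on_left ws j"
  shows "\<nexists>h. fst h \<in> arc_set S \<and> surround_cw S (h # map (right_half S xs) [0..<Suc i]) \<Longrightarrow>
      q \<in> corners S \<Longrightarrow> tail_side S q \<noteq> fst (xs ! 0)"
    and "\<nexists>h. fst h \<in> arc_set S \<and> surround_ccw S (map (left_half S xs) [i..<n] @ [h]) \<Longrightarrow>
      q \<in> corners S \<Longrightarrow> tail_side S q \<noteq> snd (xs ! (n - 1))"
proof -
  have w: "crossing_word S {..<length ws} xs ws" and len: "length ws = n - 1"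
    using itinerary_crossing_word[OF surface it] n by auto
  have opp: "opposite_sides S (xs ! j)" if "j < n" for j using w that n by (auto simp: crossing_word_def)
  have step: "(first_half S (tail_side S q), second_half S q) \<in> ccw S" if "q \<in> corners S" for q
    unfolding ccw_def using that by (cases q) (auto simp: tail_side_def intro!: r_into_trancl)
  have corner: "fst (ws ! l) \<in> corners S" "entered_side S (ws ! l) = snd (xs ! l)"
      "exited_side S (ws ! l) = fst (xs ! Suc l)" if "Suc l < n" for l
    using w that len n by (auto simp: crossing_word_def)
  have trans_ccw: "trans (ccw S)" unfolding ccw_def by (rule trans_trancl)
  have fst_half: "fst (second_half S q) \<in> arc_set S" if "q \<in> corners S" for q
    using arc_of_side_in_arc_set[OF surface valid_corner[OF that]]
    by (cases q) (auto simp: second_half_def arc_of_side_def)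
  {
    assume max: "\<nexists>h. fst h \<in> arc_set S \<and> surround_cw S (h # map (right_half S xs) [0..<Suc i])"
      and q: "q \<in> corners S"
    show "tail_side S q \<noteq> fst (xs ! 0)"
    proof
      assume eq: "tail_side S q = fst (xs ! 0)"
      let ?hs = "second_half S q # map (right_half S xs) [0..<Suc i]"
      have "(?hs ! Suc k, ?hs ! k) \<in> ccw S" if "Suc k < length ?hs" for k
      proof (cases k)
        case 0
        have "(right_half S xs 0, second_half S q) \<in> ccw S" using step[OF q] eq by (simp add: right_half_def)
        then show ?thesis using 0 by (simp add: nth_append upt_rec)
      next
        case (Suc j)
        then have j: "j < i" "Suc j < n" using that i by auto
        \<comment> \<open>The corner of a right turn is on the right, and its arrow runs
          counterclockwise around it, from crossing \<open>j + 1\<close> back to crossing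
          \<open>j\<close>.\<close>
        have "(right_half S xs (Suc j), right_half S xs j) \<in> ccw S"
          using step[OF corner(1)[OF j(2)]] corner(2,3)[OF j(2)] right[OF j(1)] j i
            opposite_sides_halves(1)[OF surface opp[of j]]
          by (auto simp: right_half_def on_right_def entered_side_eq exited_side_eq)
        then show ?thesis using Suc j by (simp del: upt_Suc)
      qed
      then have "surround_cw S ?hs"
        unfolding surround_cw_def using trans_ccw
        by (subst sorted_wrt_iff_nth_Suc_transp) (auto intro!: transpI elim: transE simp del: upt_Suc)
      then show False using max fst_half[OF q] by blast
    qed
  }
  {
    assume max: "\<nexists>h. fst h \<in> arc_set S \<and> surround_ccw S (map (left_half S xs) [i..<n] @ [h])"
      and q: "q \<in> corners S"
    show "tail_side S q \<noteq> snd (xs ! (n - 1))"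
    proof
      assume eq: "tail_side S q = snd (xs ! (n - 1))"
      let ?hs = "map (left_half S xs) [i..<n] @ [second_half S q]"
      have "(?hs ! k, ?hs ! Suc k) \<in> ccw S" if "Suc k < length ?hs" for k
      proof (cases "Suc (i + k) < n")
        case False
        then have k: "i + k = n - 1" "Suc k = n - i" using that i by auto
        have "(left_half S xs (n - 1), second_half S q) \<in> ccw S"
          using step[OF q] eq opposite_sides_halves(2)[OF surface opp[of "n - 1"]] i by (simp add: left_half_def)
        then show ?thesis using k i by (simp add: nth_append)
      next
        case True
        have "(left_half S xs (i + k), left_half S xs (Suc (i + k))) \<in> ccw S"
          using step[OF corner(1)[OF True]] corner(2,3)[OF True] left[OF _ True]
            opposite_sides_halves(2)[OF surface opp[of "i + k"]] True
          by (auto simp: left_half_def on_left_def entered_side_eq exited_side_eq)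
        moreover have "Suc k < n - i" using True by simp
        ultimately show ?thesis by (simp add: nth_append)
      qed
      then have "surround_ccw S ?hs"
        unfolding surround_ccw_def using trans_ccw
        by (subst sorted_wrt_iff_nth_Suc_transp) (auto intro!: transpI elim: transE)
      then show False using max fst_half[OF q] by blast
    qed
  }
qed

lemma projective_curve_presents_vertex:
  assumes "projective_curve S v c"
  shows "\<exists>s g. presents_vertex v (curve_module Q S cor c) s g"
proof -
  obtain xs ws where it: "the_itinerary S c = (xs, ws)" by fastforce
  let ?n = "length xs" and ?d = "on_left ws" and ?L = "{..<length ws}" and ?ar = "corner_arrow ws"
  have perm: "permissible_curve S c" using assms by (simp add: projective_curve_def)
  have iti: "itinerary S c xs ws" by (rule the_itinerary_itinerary[OF perm it])
  obtain i where i: "i < ?n" "crossed_arc S xs i = v" and right: "\<And>j. j < i \<Longrightarrow> on_right ws j"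
    and left: "\<And>j. \<lbrakk>i \<le> j; Suc j < ?n\<rbrakk> \<Longrightarrow> on_left ws j"
    and max: "\<nexists>h. fst h \<in> arc_set S \<and> surround_cw S (h # map (right_half S xs) [0..<Suc i])"
      "\<nexists>h. fst h \<in> arc_set S \<and> surround_ccw S (map (left_half S xs) [i..<?n] @ [h])"
    using assms unfolding projective_curve_def Let_def it by (auto elim!: ex1E)
  have ends: "tail_side S q \<noteq> fst (xs ! 0)" "tail_side S q \<noteq> snd (xs ! (?n - 1))" if "q \<in> corners S" for q
    by (rule maximal_at_ends(1)[OF iti refl i(1) _ _ max(1) that]; simp add: right left)
       (rule maximal_at_ends(2)[OF iti refl i(1) _ _ max(2) that]; simp add: right left)
  have w: "crossing_word S ?L xs ws" and len: "length ws = ?n - 1"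
    using itinerary_crossing_word[OF surface iti] by auto
  have d: "?d l \<longleftrightarrow> i \<le> l" if "l \<in> ?L" for l
    using right[of l] left[of l] that len by (auto simp: on_left_def on_right_def not_le[symmetric])
  have letter_ends: "letter_src ?n ?d l = (if i \<le> l then l else Suc l)"
    "letter_tgt ?n ?d l = (if i \<le> l then Suc l else l)" if "l \<in> ?L" for l
    using d[OF that] that len by (auto simp: letter_src_def letter_tgt_def)
  interpret walk Q I "(*)" ?n "crossed_arc S xs" ?L ?ar ?d "\<lambda>_. id" rel
    by (rule crossing_word_walk[OF w]) (auto simp: vector_space_over_itself.linear_id intro: vector_space_over_itself.vector_space_axioms)
  \<comment> \<open>Before position \<open>i\<close> the arrows point towards lower positions, so
    the path from \<open>i\<close> down to \<open>j\<close> reads the letters backwards from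
    \<open>i - 1\<close> to \<open>j\<close>.\<close>
  define p where "p j = (if j \<le> i then map ?ar (rev [j..<i]) else map ?ar [i..<j])" for j
  interpret rooted_walk Q I ?n "crossed_arc S xs" ?L ?ar ?d "\<lambda>_. id" rel i p
  proof unfold_locales
    show "id c = c" for c :: 'k by simp
    show "i < ?n" "p i = []" using i by (simp_all add: p_def)
    show "\<exists>l\<in>?L. letter_tgt ?n ?d l = j" if "j < ?n" "j \<noteq> i" for j
    proof (cases "j < i")
      case True
      then show ?thesis using i len by (intro bexI[of _ j]) (auto simp: letter_ends)
    next
      case False
      then show ?thesis using that i len by (intro bexI[of _ "j - 1"]) (auto simp: letter_ends)
    qed
    show "p (letter_tgt ?n ?d l) = p (letter_src ?n ?d l) @ [?ar l]" if l: "l \<in> ?L" for l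
      using upt_conv_Cons[of l i] unfolding letter_ends[OF l] p_def by auto
    fix j \<alpha> assume j: "j < ?n" and \<alpha>: "\<alpha> \<in> arcs Q" "tail Q \<alpha> = crossed_arc S xs j"
      and leaving: "\<And>l. \<lbrakk>l \<in> ?L; ?ar l = \<alpha>\<rbrakk> \<Longrightarrow> letter_src ?n ?d l \<noteq> j"
    have q: "cor \<alpha> \<in> corners S" using \<alpha>(1) by (rule cor_corner)
    \<comment> \<open>A side determines the arrow starting at it, so \<alpha> would be the arrow of
      a letter that starts at \<open>j\<close>.\<close>
    have same_tail: False if "l \<in> ?L" "letter_src ?n ?d l = j" "tail_side S (fst (ws ! l)) = tail_side S (cor \<alpha>)" for l
    proof -
      have "fst (ws ! l) = cor \<alpha>"
        using tail_side_inj[OF _ q that(3)] w that(1) by (auto simp: crossing_word_def)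
      then have "?ar l = \<alpha>" using cor_bij \<alpha>(1) by (simp add: bij_betw_def)
      then show False using leaving that by blast
    qed
    have rel_intro: "\<exists>l\<in>?L. letter_tgt ?n ?d l = j \<and> rel (?ar l) \<alpha>"
      if "l \<in> ?L" "letter_tgt ?n ?d l = j" "fst (ws ! l) = tail_side S (cor \<alpha>)" for l
      using that corner_arrow(2)[OF w that(1)] by (intro bexI[of _ l]) (auto simp: corner_relation_iff)
    have "opposite_sides S (xs ! j)" using w j by (auto simp: crossing_word_def)
    moreover have "arc_of_side S (tail_side S (cor \<alpha>)) = arc_of_side S (fst (xs ! j))"
      using \<alpha> by (simp add: cor_ends crossed_arc_eq)
    ultimately consider "tail_side S (cor \<alpha>) = fst (xs ! j)" | "tail_side S (cor \<alpha>) = snd (xs ! j)"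
      using side_cases[OF surface _ valid_tail_side[OF q]] by blast
    then show "\<exists>l\<in>?L. letter_tgt ?n ?d l = j \<and> rel (?ar l) \<alpha>"
    proof cases
      case 1
      \<comment> \<open>The side \<open>fst (xs ! j)\<close> is the one touched by letter
        \<open>j - 1\<close>. For \<open>j\<close> after \<open>i\<close> this letter ends at
        \<open>j\<close> and gives a relation; otherwise it starts at \<open>j\<close> and its arrow
        would be \<alpha>. Case 2 is the mirror image, with letter \<open>j\<close>.\<close>
      then have "j \<noteq> 0" using ends(1)[OF q] by metis
      then have l: "j - 1 \<in> ?L" using j len by auto
      show ?thesis
      proof (cases "i < j")
        case True
        then show ?thesis
          using rel_intro[OF l] crossing_word_letter(2)[OF w l] 1 l d[OF l] letter_ends[OF l] by auto
      next
        case False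
        then show ?thesis
          using same_tail[OF l] crossing_word_letter(1)[OF w l] 1 \<open>j \<noteq> 0\<close> d[OF l] letter_ends[OF l] by auto
      qed
    next
      case 2
      then have "j \<noteq> ?n - 1" using ends(2)[OF q] by metis
      then have l: "j \<in> ?L" using j len by auto
      show ?thesis
      proof (cases "i \<le> j")
        case True
        then show ?thesis
          using same_tail[OF l] crossing_word_letter(1)[OF w l] 2 d[OF l] letter_ends[OF l] by auto
      next
        case False
        then show ?thesis
          using rel_intro[OF l] crossing_word_letter(2)[OF w l] 2 l d[OF l] letter_ends[OF l] by auto
      qed
    qed
  qed
  have "curve_module Q S cor c = M"
    unfolding curve_module_def it by (simp only: Let_def prod.case)
  then show ?thesis using presents_vertex_root i(2) by metis
qed

section \<open>Projective covers of the string and band modules of curves\<close>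

theorem projective_cover_curve_module:
  assumes c: "permissible_curve S c" "the_itinerary S c = (xs, ws)"
    and J: "J = {i. i < length xs \<and>
                    (0 < i \<longrightarrow> on_right ws (i - 1)) \<and> (Suc i < length xs \<longrightarrow> on_left ws i)}"
    and cproj: "\<And>i. i \<in> J \<Longrightarrow> projective_curve S (crossed_arc S xs i) (cproj i)"
  shows "\<exists>\<pi>. projective_cover A (direct_sum J (\<lambda>i. curve_module Q S cor (cproj i))) \<pi>
     (curve_module Q S cor c)"
proof -
  let ?n = "length xs"
  have it: "itinerary S c xs ws" by (rule the_itinerary_itinerary[OF c])
  have w: "crossing_word S {..<length ws} xs ws" and len: "length ws = ?n - 1"
    using itinerary_crossing_word[OF surface it] by auto
  interpret walk Q I "(*)" ?n "crossed_arc S xs" "{..<length ws}" "corner_arrow ws" "on_left ws" "\<lambda>_. id" rel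
    by (rule crossing_word_walk[OF w]) (auto simp: vector_space_over_itself.linear_id intro: vector_space_over_itself.vector_space_axioms)
  have M: "curve_module Q S cor c = M"
    unfolding curve_module_def c(2) by (simp only: Let_def prod.case)
  \<comment> \<open>At an end of the string one of the two neighbouring letters is missing and its
    condition becomes vacuous; with a single crossing, position 0 is the only top.\<close>
  have top: "is_top i \<longleftrightarrow> i \<in> J" for i
  proof -
    have lw: "l < length ws \<longleftrightarrow> Suc l < ?n" for l using len by auto
    have "(\<forall>l\<in>{..<length ws}. tgt l \<noteq> i) \<longleftrightarrow>
        (0 < i \<longrightarrow> on_right ws (i - 1)) \<and> (Suc i < ?n \<longrightarrow> on_left ws i)" if "i < ?n"
    proof -
      have "(\<forall>l\<in>{..<length ws}. tgt l \<noteq> i) \<longleftrightarrow> (\<forall>l. Suc l < ?n \<longrightarrow> (if on_left ws l then Suc l else l) \<noteq> i)"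
        by (auto simp: letter_tgt_def lw Ball_def)
      also have "\<dots> \<longleftrightarrow> (0 < i \<longrightarrow> on_right ws (i - 1)) \<and> (Suc i < ?n \<longrightarrow> on_left ws i)"
      proof (intro iffI conjI allI impI)
        assume *: "\<forall>l. Suc l < ?n \<longrightarrow> (if on_left ws l then Suc l else l) \<noteq> i"
        show "on_right ws (i - 1)" if "0 < i"
          using *[rule_format, of "i - 1"] \<open>i < ?n\<close> that by (simp add: on_left_def on_right_def split: if_splits)
        show "on_left ws i" if "Suc i < ?n"
          using *[rule_format, of i] that by (simp split: if_splits)
      qed (auto simp: on_left_def on_right_def intro!: gr0I)
      finally show ?thesis .
    qed
    then show ?thesis by (auto simp: is_top_def J)
  qed
  have Ji: "{k \<in> J. k = i} = {i}" if "i \<in> J" for i using that by auto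
  show ?thesis
    unfolding M
  proof (rule projective_cover_walk[where pos = "\<lambda>i. i" and bv = "\<lambda>_. 1"])
    show "finite J" by (simp add: J)
    show "is_top k" if "k \<in> J" for k using that by (simp add: top)
    show "\<exists>s g. presents_vertex (crossed_arc S xs k) (curve_module Q S cor (cproj k)) s g" if "k \<in> J" for k
      by (rule projective_curve_presents_vertex[OF cproj[OF that]])
    show "vector_space_over_itself.span ((\<lambda>_. 1) ` {k \<in> J. k = i}) = UNIV" if "is_top i" for i
      using that vector_space_over_itself.span_scale[OF vector_space_over_itself.span_base[of 1 "{1}"]]
      by (force simp: top Ji)
    show "a k = 0" if "(\<Sum>k \<in> {k \<in> J. k = i}. a k * 1) = 0" "k \<in> J" "k = i" for i k and a :: "nat \<Rightarrow> 'k"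
      using that(1) unfolding that(3)[symmetric] Ji[OF that(2)] by simp
  qed
qed

text \<open>Surjectivity is proved along the Jordan chain: since \<mu> is invertible, each basis
  vector is recovered from its own image and its predecessor.\<close>

lemma jordan_block_onD:
  assumes "jordan_block_on sc \<phi>"
  obtains bs where "vector_space sc" "Vector_Spaces.linear sc sc \<phi>" "surj \<phi>" "distinct bs"
    "\<not> Modules.module.dependent sc (set bs)" "Modules.module.span sc (set bs) = UNIV"
    "vector_space.dim sc UNIV = length bs"
proof -
  obtain \<mu> bs where sc: "vector_space sc" and lin: "Vector_Spaces.linear sc sc \<phi>" and mu: "\<mu> \<noteq> 0"
    and bs: "distinct bs" "\<not> Modules.module.dependent sc (set bs)"
      "Modules.module.span sc (set bs) = UNIV" "\<phi> (bs ! 0) = sc \<mu> (bs ! 0)"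
      "\<And>i. Suc i < length bs \<Longrightarrow> \<phi> (bs ! Suc i) = sc \<mu> (bs ! Suc i) + bs ! i"
    using assms unfolding jordan_block_on_def by blast
  interpret V: vector_space sc by fact
  interpret phi: Vector_Spaces.linear sc sc \<phi> by fact
  have sub: "V.subspace (range \<phi>)" using phi.subspace_image[OF V.subspace_UNIV] .
  have "bs ! i \<in> range \<phi>" if "i < length bs" for i
    using that
  proof (induction i)
    case 0
    have "bs ! 0 = \<phi> (sc (inverse \<mu>) (bs ! 0))" using mu by (simp add: phi.scale bs(4))
    then show ?case by blast
  next
    case (Suc i)
    have "sc \<mu> (bs ! Suc i) = \<phi> (bs ! Suc i) - bs ! i" using bs(5)[OF Suc.prems] by simp
    also have "\<dots> \<in> range \<phi>" using Suc by (intro V.subspace_diff[OF sub]) auto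
    finally have "sc (inverse \<mu>) (sc \<mu> (bs ! Suc i)) \<in> range \<phi>" by (rule V.subspace_scale[OF sub])
    then show ?case using mu by simp
  qed
  then have "set bs \<subseteq> range \<phi>" by (auto simp: in_set_conv_nth)
  then have "surj \<phi>" using V.span_minimal[OF _ sub] bs(3) by blast
  moreover have "V.dim UNIV = length bs"
    using V.dim_eq_card[of "set bs" UNIV] bs by (simp add: distinct_card)
  ultimately show ?thesis using that sc lin bs by blast
qed

text \<open>The multiplicity arises because the space at each top needs a whole basis of generators.
  The letter carrying \<phi> can be climbed like the others, as \<phi> is surjective.\<close>

theorem projective_cover_closed_curve_module:
  fixes sc :: "'k \<Rightarrow> 'w \<Rightarrow> 'w::ab_group_add"
  assumes c: "permissible_closed_curve S c" "the_closed_itinerary S c = (xs, ws)"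
    and \<phi>: "jordan_block_on sc \<phi>"
    and J: "J = {i. i < length xs \<and>
                    on_right ws ((i + length xs - 1) mod length xs) \<and> on_left ws i}"
    and cproj: "\<And>i. i \<in> J \<Longrightarrow> projective_curve S (crossed_arc S xs i) (cproj i)"
  shows "\<exists>\<pi>. projective_cover A
     (direct_sum (J \<times> {..<vector_space.dim sc (UNIV :: 'w set)}) (\<lambda>(i, _). curve_module Q S cor (cproj i)))
     \<pi> (closed_curve_module Q S cor sc c \<phi> q)"
proof -
  let ?n = "length xs"
  obtain bs where sc: "vector_space sc" and lin: "Vector_Spaces.linear sc sc \<phi>" "surj \<phi>"
    and bs: "distinct bs" "\<not> Modules.module.dependent sc (set bs)"
      "Modules.module.span sc (set bs) = UNIV" and dim: "vector_space.dim sc UNIV = length bs"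
    using jordan_block_onD[OF \<phi>] by blast
  have it: "closed_itinerary S c xs ws" by (rule the_closed_itinerary_closed_itinerary[OF c])
  have w: "crossing_word S {..<length ws} xs ws" and len: "length ws = ?n"
    using closed_itinerary_crossing_word[OF surface it] by auto
  interpret walk Q I sc ?n "crossed_arc S xs" "{..<length ws}" "corner_arrow ws" "on_left ws"
      "\<lambda>l. if l = q then \<phi> else id" rel
    using lin vector_space.linear_id[OF sc] by (intro crossing_word_walk[OF w sc]) auto
  have M: "closed_curve_module Q S cor sc c \<phi> q = M"
    unfolding closed_curve_module_def c(2) by (simp only: Let_def prod.case)
  have top: "is_top i \<longleftrightarrow> i \<in> J" for i
  proof -
    have "(\<forall>l\<in>{..<length ws}. tgt l \<noteq> i) \<longleftrightarrow> on_right ws ((i + ?n - 1) mod ?n) \<and> on_left ws i" if i: "i < ?n"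
    proof -
      \<comment> \<open>The letter before position \<open>i\<close>, cyclically; adding
        \<open>?n\<close> first keeps the subtraction of naturals from being cut off at
        \<open>i = 0\<close>.\<close>
      let ?l = "(i + ?n - 1) mod ?n"
      have "Suc ?l mod ?n = Suc (i + ?n - 1) mod ?n" by (rule mod_Suc_eq)
      also have "Suc (i + ?n - 1) = i + ?n" using i by simp
      also have "(i + ?n) mod ?n = i" using i by simp
      finally have "Suc ?l mod ?n = i" .
      moreover have "?l < ?n" using i by (intro mod_less_divisor) auto
      ultimately have "Suc l mod ?n = i \<longleftrightarrow> l = ?l" if "l < ?n" for l
        using that inj_onD[OF inj_on_Suc_mod, of l ?n ?l] by auto
      then show ?thesis
        using i \<open>?l < ?n\<close> unfolding len letter_tgt_def on_left_def on_right_def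
        by (auto split: if_splits)
    qed
    then show ?thesis by (auto simp: is_top_def J)
  qed
  have Ki: "{k \<in> J \<times> {..<length bs}. fst k = i} = {i} \<times> {..<length bs}" if "i \<in> J" for i using that by auto
  show ?thesis
    unfolding M dim
  proof (rule projective_cover_walk[where pos = fst and bv = "\<lambda>k. bs ! snd k"])
    show "finite (J \<times> {..<length bs})" by (simp add: J)
    show "is_top (fst k)" if "k \<in> J \<times> {..<length bs}" for k using that by (auto simp: top)
    show "\<exists>s g. presents_vertex (crossed_arc S xs (fst k)) (case k of (i, _) \<Rightarrow> curve_module Q S cor (cproj i)) s g"
      if "k \<in> J \<times> {..<length bs}" for k
      using that projective_curve_presents_vertex[OF cproj[of "fst k"]] by (auto split: prod.splits)
    fix i :: nat
    have "(\<lambda>k. bs ! snd k) ` ({i} \<times> {..<length bs}) = set bs"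
      by (force simp: set_conv_nth image_iff)
    then show "V.span ((\<lambda>k. bs ! snd k) ` {k \<in> J \<times> {..<length bs}. fst k = i}) = UNIV" if "is_top i"
      using that bs(3) by (simp add: top Ki)
    fix a k assume sum: "(\<Sum>k \<in> {k \<in> J \<times> {..<length bs}. fst k = i}. sc (a k) (bs ! snd k)) = 0"
      and k: "k \<in> J \<times> {..<length bs}" "fst k = i"
    \<comment> \<open>\<open>V.independentD\<close> takes coefficients as a function of the basis
      vectors, so those given by index are carried over along the distinct list
      \<open>bs\<close>.\<close>
    let ?idx = "inv_into {..<length bs} ((!) bs)"
    have inj: "inj_on ((!) bs) {..<length bs}" using bs(1) by (simp add: inj_on_nth)
    have "(\<Sum>v\<in>set bs. sc (a (i, ?idx v)) v) = (\<Sum>e<length bs. sc (a (i, ?idx (bs ! e))) (bs ! e))"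
      by (rule sum.reindex_bij_betw[symmetric]) (simp add: bij_betw_nth[OF bs(1)])
    also have "\<dots> = (\<Sum>e<length bs. sc (a (i, e)) (bs ! e))"
      using inj by (intro sum.cong) auto
    also have "\<dots> = 0"
    proof -
      have "{k \<in> J \<times> {..<length bs}. fst k = i} = Pair i ` {..<length bs}" using k by auto
      then show ?thesis using sum by (simp add: sum.reindex inj_on_def)
    qed
    finally have "a (i, ?idx (bs ! snd k)) = 0"
      using V.independentD[OF bs(2), of "set bs" "\<lambda>v. a (i, ?idx v)" "bs ! snd k"] k by auto
    then show "a k = 0" using inj k by (cases k) auto
  qed
qed

end

theorem theorem4p6:
  fixes Q :: "('v, 'a) pre_digraph"
    and I :: "(('v, 'a) qpath \<Rightarrow> 'k::alg_closed_field) set"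
    and S :: "('s::t2_space, 'v, 'p) ribbon_surface"
    and cor :: "'a \<Rightarrow> 'p \<times> nat"
  assumes "gentle Q I"
    and "marked_ribbon_surface S"
    and "algebra_of_surface Q I S cor"
  shows "(\<forall>c xs ws cproj. \<forall>J :: nat set.
            permissible_curve S c \<and> nontrivial_curve S c \<and> the_itinerary S c = (xs, ws) \<and>
            J = {i. i < length xs \<and>
                    (0 < i \<longrightarrow> on_right ws (i - 1)) \<and> (Suc i < length xs \<longrightarrow> on_left ws i)} \<and>
            (\<forall>i \<in> J. projective_curve S (crossed_arc S xs i) (cproj i)) \<longrightarrow>
            (\<exists>\<pi>. projective_cover (bound_quiver_algebra Q I)
                   (direct_sum J (\<lambda>i. curve_module Q S cor (cproj i))) \<pi>
                   (curve_module Q S cor c)))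
       \<and> (\<forall>c xs ws cproj (sc :: 'k \<Rightarrow> 'w \<Rightarrow> 'w::ab_group_add) \<phi> q. \<forall>J :: nat set.
            permissible_closed_curve S c \<and> the_closed_itinerary S c = (xs, ws) \<and> 2 \<le> length xs \<and>
            jordan_block_on sc \<phi> \<and> q < length xs \<and>
            J = {i. i < length xs \<and>
                    on_right ws ((i + length xs - 1) mod length xs) \<and> on_left ws i} \<and>
            (\<forall>i \<in> J. projective_curve S (crossed_arc S xs i) (cproj i)) \<longrightarrow>
            (\<exists>\<pi>. projective_cover (bound_quiver_algebra Q I)
                   (direct_sum (J \<times> {..<vector_space.dim sc (UNIV :: 'w set)})
                      (\<lambda>(i, _). curve_module Q S cor (cproj i))) \<pi>
                   (closed_curve_module Q S cor sc c \<phi> q)))"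
proof -
  have "fin_digraph Q" "admissible_ideal Q I" using assms(1) by (simp_all add: gentle_def)
  then interpret surface_algebra Q I S cor
    using assms(2,3) by (simp add: surface_algebra_def bound_quiver_def bound_quiver_axioms_def surface_algebra_axioms_def)
  show ?thesis
  proof ((intro conjI allI impI; elim conjE), goal_cases)
    case 1
    show ?case
      by (rule projective_cover_curve_module[OF 1(1,3,4)]) (use 1(5) in blast)
  next
    case 2
    show ?case
      by (rule projective_cover_closed_curve_module[OF 2(1,2,4,6)]) (use 2(7) in blast)
  qed
qed

end
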